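(* Fix $\kappa_2\in(-1,1)$ and let $\tilde\kappa_1>0$ be the threshold defined in the context. Let $\kappa_1^\epsilon\to\tilde\kappa_1$ as $\epsilon\to0$ with $\kappa_1^\epsilon<\tilde\kappa_1$. Denote by $(u_1^\epsilon,u_2^\epsilon)$ the uniformly subsonic spiral flow corresponding to Problem $(\kappa_1^\epsilon,\kappa_2)$, and put $(q^\epsilon)^2=(u_1^\epsilon)^2+(u_2^\epsilon)^2$. Then there exists a subsequence, still labeled $(u_1^\epsilon,u_2^\epsilon)$, and functions $\tilde u_1,\tilde u_2$ on $\Omega$ such that, with $\tilde q^2=\tilde u_1^2+\tilde u_2^2$, almost everywhere in $\Omega$, $$u_1^\epsilon\to\tilde u_1,\quad u_2^\epsilon\to\tilde u_2,\qquad g((q^\epsilon)^2)u_1^\epsilon\to g(\tilde q^2)\tilde u_1,\quad g((q^\epsilon)^2)u_2^\epsilon\to g(\tilde q^2)\tilde u_2 .$$ Moreover, this limit yields a subsonic-sonic spiral flow $(\tilde\rho,\tilde u_1,\tilde u_2)$, $\tilde\rho=g(\tilde q^2)$ (so $\tilde q\le1$ a.e.), which is a weak solution of Problem $(\tilde\kappa_1,\kappa_2)$: it satisfies in the sense of distributions in $\Omega$, with $\tilde p=\tilde\rho^\gamma/\gamma$, $$\partial_{x_1}(\tilde\rho\tilde u_1)+\partial_{x_2}(\tilde\rho\tilde u_2)=0,\quad \partial_{x_1}(\tilde\rho\tilde u_1^2)+\partial_{x_2}(\tilde\rho\tilde u_1\tilde u_2)+\partial_{x_1}\tilde p=0,$$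 $$\partial_{x_1}(\tilde\rho\tilde u_1\tilde u_2)+\partial_{x_2}(\tilde\rho\tilde u_2^2)+\partial_{x_2}\tilde p=0,\quad \partial_{x_2}\tilde u_1-\partial_{x_1}\tilde u_2=0,$$ and it satisfies the boundary condition $\tilde\rho\tilde{\mathbf u}\cdot\vec n=\rho_bU_1\mathbf e_r\cdot\vec n$ on $\Gamma$ (with $\rho_bU_1$ that of the background flow with parameters $(\tilde\kappa_1,\kappa_2)$) as the normal trace of the divergence-measure field $(\tilde\rho\tilde u_1,\tilde\rho\tilde u_2)$ on $\Gamma$.
   Context: Domain: $\mathcal D\subset\mathbb R^2$ is a bounded domain containing the unit disc $B_1(0)$ whose boundary $\Gamma$ is a bounded connected $C^\infty$ smooth curve; $\Omega=\mathbb R^2\setminus\mathcal D$ is its exterior, assumed connected; $\vec n$ is the unit normal on $\Gamma$ pointing into $\mathcal D$. $(r,\theta)$ are polar coordinates, $\mathbf e_r=(\cos\theta,\sin\theta)$. Gas: $\gamma>1$ is fixed, $p=\rho^\gamma/\gamma$; Bernoulli's law is $\frac{q^2}{2}+\frac{\rho^{\gamma-1}}{\gamma-1}=\frac{\gamma+1}{2(\gamma-1)}$, equivalently $\rho=g(q^2):=\big(\frac{\gamma+1-(\gamma-1)q^2}{2}\big)^{1/(\gamma-1)}$, $q=|\mathbf u|$; the flow is subsonic iff $q<1$ and sonic iff $q=1$. For $s\in[0,1]$, $H(s)$ is the unique $\rho\ge1$ with $\frac{s}{2\rho^2}+\frac{\rho^{\gamma-1}}{\gamma-1}=\frac{\gamma+1}{2(\gamma-1)}$.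 Background flow: for $\kappa_1>0$ and $\kappa_2\in\mathbb R$ with $\kappa_1^2+\kappa_2^2<1$, let $\rho_0>0$ be defined by $\frac12(\kappa_1^2+\kappa_2^2)+\frac{\rho_0^{\gamma-1}}{\gamma-1}=\frac{\gamma+1}{2(\gamma-1)}$, and let $(\rho_b,U_1,U_2)(r)$, $r>1$, be the smooth radially symmetric solution of $(\rho_bU_1)'+\frac1r\rho_bU_1=0$, $U_1U_1'+\frac1{\rho_b}p_b'-\frac{U_2^2}{r}=0$, $U_1U_2'+\frac{U_1U_2}{r}=0$ ($p_b=\rho_b^\gamma/\gamma$) with $\rho_b(1)=\rho_0$, $U_1(1)=\kappa_1$, $U_2(1)=\kappa_2$. It is uniformly subsonic and $\rho_bU_1=\rho_0\kappa_1/r$, $U_2=\kappa_2/r$; for limiting parameter values, $\rho_bU_1$ is given by the same formula $\rho_0\kappa_1/r$. Put $\psi_{10}=\rho_0\kappa_1\theta$, $\psi_{20}(r)=-\kappa_2\int_1^r\frac{\rho_b(s)}{s}ds$, $\psi_0=\psi_{10}+\psi_{20}$. Problem $(\kappa_1,\kappa_2)$: find $\psi$ (with $\psi-\psi_0$ single-valued on $\Omega$) such that $\operatorname{div}\big(\frac{\nabla\psi}{H(|\nabla\psi|^2)}\big)=0$ in $\Omega$, $\psi=\psi_{10}$ on $\Gamma$, $|\nabla(\psi-\psi_0)|=O(|x|^{-2})$ as $|x|\to\infty$. A uniformly subsonic spiral flow is the flow given by a smooth solution with $\sup_\Omega|\nabla\psi|<1$, via $\rho=H(|\nabla\psi|^2)$,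 $u_1=\partial_{x_2}\psi/\rho$, $u_2=-\partial_{x_1}\psi/\rho$. Threshold $\tilde\kappa_1$: for small $\varepsilon>0$ let $\tilde H$ be a smooth decreasing function on $[0,\infty)$ with $\tilde H=H$ on $[0,1-2\varepsilon]$ and $\tilde H=H(1-\varepsilon)$ on $[1-\varepsilon,\infty)$. The truncated problem is Problem $(\kappa_1,\kappa_2)$ with $H$ replaced by $\tilde H$; it has a unique classical solution $\psi$. Let $\varepsilon_i\downarrow0$ strictly, and for the fixed $\kappa_2$ let $(0,\kappa_1^i)$ be the maximal interval such that for $\kappa_1\in(0,\kappa_1^i)$ the solution of the truncated problem with $\varepsilon=\varepsilon_i$ satisfies $|\nabla\psi|<\sqrt{1-2\varepsilon_i}$ in $\Omega$. The sequence $\kappa_1^i$ is increasing and $\tilde\kappa_1=\lim_{i\to\infty}\kappa_1^i$, which is positive. For $\kappa_1\in(0,\tilde\kappa_1)$, Problem $(\kappa_1,\kappa_2)$ has a unique uniformly subsonic spiral flow. Normal trace: for a bounded field $\mathbf F$ on $\Omega$ with $\operatorname{div}\mathbf F=0$ in distributions, $\mathbf F\cdot\vec n=h$ on $\Gamma$ in the sense of normal trace means $\int_\Omega\mathbf F\cdot\nabla v\,dx=\int_\Gamma h\,v\,ds$ for all $v\in C_c^\infty(\mathbb R^2)$. *)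

theory Defs
  imports "HOL-Analysis.Analysis" "HOL-Library.Landau_Symbols"
begin

section \<open>Differential calculus\<close>

text \<open>\<open>C\<^sup>k\<close> functions on an open set, via iterated directional derivatives.\<close>

fun Ck_on :: "nat \<Rightarrow> ('a::real_normed_vector \<Rightarrow> 'b::real_normed_vector) \<Rightarrow> 'a set \<Rightarrow> bool" where
  "Ck_on 0 f U \<longleftrightarrow> continuous_on U f"
| "Ck_on (Suc k) f U \<longleftrightarrow>
     f differentiable_on U \<and> (\<forall>v. Ck_on k (\<lambda>x. frechet_derivative f (at x) v) U)"

definition smooth_on :: "('a::real_normed_vector \<Rightarrow> 'b::real_normed_vector) \<Rightarrow> 'a set \<Rightarrow> bool" where
  "smooth_on f U \<longleftrightarrow> (\<forall>k. Ck_on k f U)"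

text \<open>
  Regularity on a closed set \<open>S\<close> (up to the boundary) means that there is an extension of the same
  regularity to an open neighbourhood of \<open>S\<close>.  Functions are total here, so the extension is taken
  to be the function itself; its values outside \<open>S\<close> play no role.
\<close>

definition Ck_near :: "nat \<Rightarrow> ('a::real_normed_vector \<Rightarrow> 'b::real_normed_vector) \<Rightarrow> 'a set \<Rightarrow> bool" where
  "Ck_near k f S \<longleftrightarrow> (\<exists>U. open U \<and> S \<subseteq> U \<and> Ck_on k f U)"

definition smooth_near :: "('a::real_normed_vector \<Rightarrow> 'b::real_normed_vector) \<Rightarrow> 'a set \<Rightarrow> bool" where
  "smooth_near f S \<longleftrightarrow> (\<exists>U. open U \<and> S \<subseteq> U \<and> smooth_on f U)"

definition grad :: "(real^2 \<Rightarrow> real) \<Rightarrow> real^2 \<Rightarrow> real^2" where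
  "grad f x = (\<chi> i. frechet_derivative f (at x) (axis i 1))"

definition divergence :: "(real^2 \<Rightarrow> real^2) \<Rightarrow> real^2 \<Rightarrow> real" where
  "divergence F x = (\<Sum>i\<in>UNIV. frechet_derivative F (at x) (axis i 1) $ i)"

section \<open>Distributional divergence and normal trace\<close>

definition test_function :: "(real^2) set \<Rightarrow> (real^2 \<Rightarrow> real) \<Rightarrow> bool" where
  "test_function U v \<longleftrightarrow>
     smooth_on v UNIV \<and> compact (closure {x. v x \<noteq> 0}) \<and> closure {x. v x \<noteq> 0} \<subseteq> U"

definition distr_div_free :: "(real^2) set \<Rightarrow> (real^2 \<Rightarrow> real^2) \<Rightarrow> bool" where
  "distr_div_free U F \<longleftrightarrow>
     (\<forall>K. compact K \<and> K \<subseteq> U \<longrightarrow> integrable (lebesgue_on K) F) \<and>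
     (\<forall>v. test_function U v \<longrightarrow> (LINT x|lebesgue_on U. F x \<bullet> grad v x) = 0)"

text \<open>Arc-length integral over a closed curve parametrised injectively by \<open>{0..<1}\<close>.\<close>

definition arclength_integral :: "(real \<Rightarrow> real^2) \<Rightarrow> (real^2 \<Rightarrow> real) \<Rightarrow> real" where
  "arclength_integral c f = integral {0..1} (\<lambda>t. f (c t) * norm (vector_derivative c (at t)))"

text \<open>
  \<open>F \<bullet> n = h\<close> on the curve \<open>c\<close> bounding the closed exterior region \<open>S\<close>, in the sense of normal
  traces, for an essentially bounded divergence-free field \<open>F\<close>; \<open>n\<close> enters through \<open>h\<close>.
\<close>

definition has_normal_trace ::
  "(real^2) set \<Rightarrow> (real \<Rightarrow> real^2) \<Rightarrow> (real^2 \<Rightarrow> real^2) \<Rightarrow> (real^2 \<Rightarrow> real) \<Rightarrow> bool" where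
  "has_normal_trace S c F h \<longleftrightarrow>
     F \<in> borel_measurable (lebesgue_on S) \<and>
     (\<exists>C. AE x in lebesgue_on S. norm (F x) \<le> C) \<and>
     distr_div_free (interior S) F \<and>
     (\<forall>v. test_function UNIV v \<longrightarrow>
        (LINT x|lebesgue_on S. F x \<bullet> grad v x) = arclength_integral c (\<lambda>x. h x * v x))"

section \<open>The domain\<close>

definition smooth_closed_curve :: "(real \<Rightarrow> real^2) \<Rightarrow> bool" where
  "smooth_closed_curve c \<longleftrightarrow>
     smooth_on c UNIV \<and> (\<forall>t. c (t + 1) = c t) \<and> inj_on c {0..<1} \<and>
     (\<forall>t. vector_derivative c (at t) \<noteq> 0)"

text \<open>
  The obstacle \<open>D\<close> is open, so the exterior \<open>- D\<close> is closed and contains the boundary curve;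
  equations are imposed in \<open>interior (- D)\<close>.
\<close>

definition obstacle :: "(real^2) set \<Rightarrow> (real \<Rightarrow> real^2) \<Rightarrow> bool" where
  "obstacle D c \<longleftrightarrow>
     open D \<and> connected D \<and> bounded D \<and> ball 0 1 \<subseteq> D \<and>
     smooth_closed_curve c \<and> frontier D = range c \<and> connected (- D)"

definition inward_unit_normal ::
  "(real^2) set \<Rightarrow> (real \<Rightarrow> real^2) \<Rightarrow> (real^2 \<Rightarrow> real^2) \<Rightarrow> bool" where
  "inward_unit_normal D c n \<longleftrightarrow>
     (\<forall>t. norm (n (c t)) = 1 \<and> n (c t) \<bullet> vector_derivative c (at t) = 0 \<and>
          (\<forall>\<^sub>F s in at_right 0. c t + s *\<^sub>R n (c t) \<in> D))"

definition e_r :: "real^2 \<Rightarrow> real^2" where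
  "e_r x = x /\<^sub>R norm x"

text \<open>The gradient of the polar angle, which is single-valued although the angle is not.\<close>

definition grad_angle :: "real^2 \<Rightarrow> real^2" where
  "grad_angle x = vector [- x$2, x$1] /\<^sub>R (norm x)\<^sup>2"

lemma grad_angle_branch:
  fixes \<theta> :: "real^2 \<Rightarrow> real" and x :: "real^2"
  assumes x: "x \<noteq> 0" and diff: "\<theta> differentiable at x"
    and branch: "\<forall>\<^sub>F y in nhds x. y = norm y *\<^sub>R vector [cos (\<theta> y), sin (\<theta> y)]"
  shows "grad \<theta> x = grad_angle x"
proof -
  define L where "L = frechet_derivative \<theta> (at x)"
  have L: "(\<theta> has_derivative L) (at x)"
    using diff frechet_derivative_works unfolding L_def by blast
  have x1: "x$1 = norm x * cos (\<theta> x)" and x2: "x$2 = norm x * sin (\<theta> x)"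
    using arg_cong[OF eventually_nhds_x_imp_x[OF branch], of "\<lambda>z. z$1"]
      arg_cong[OF eventually_nhds_x_imp_x[OF branch], of "\<lambda>z. z$2"] by simp_all
  have ev: "\<forall>\<^sub>F y in nhds x. y$1 * sin (\<theta> y) - y$2 * cos (\<theta> y) = 0"
    using branch
  proof eventually_elim
    case (elim y)
    have "y$1 = norm y * cos (\<theta> y)" "y$2 = norm y * sin (\<theta> y)"
      using arg_cong[OF elim, of "\<lambda>z. z$1"] arg_cong[OF elim, of "\<lambda>z. z$2"] by simp_all
    then show ?case by simp
  qed
  have vn: "((\<lambda>y. y$i) has_derivative (\<lambda>h. h$i)) (at x)" for i :: 2
    by (intro bounded_linear_imp_has_derivative bounded_linear_vec_nth)
  have "((\<lambda>y. y$1 * sin (\<theta> y) - y$2 * cos (\<theta> y)) has_derivative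
      (\<lambda>h. (x$1 * (L h * cos (\<theta> x)) + h$1 * sin (\<theta> x))
         - (x$2 * (L h * (- sin (\<theta> x))) + h$2 * cos (\<theta> x)))) (at x)"
    by (rule derivative_eq_intros vn L refl | simp)+
  moreover have "((\<lambda>y. y$1 * sin (\<theta> y) - y$2 * cos (\<theta> y)) has_derivative (\<lambda>h. 0)) (at x)"
    by (rule has_derivative_transform_eventually[OF has_derivative_const[of 0]])
       (use ev eventually_nhds_x_imp_x[OF ev] in
         \<open>auto simp: eventually_at_filter elim!: eventually_mono\<close>)
  ultimately have "(\<lambda>h. (x$1 * (L h * cos (\<theta> x)) + h$1 * sin (\<theta> x))
      - (x$2 * (L h * (- sin (\<theta> x))) + h$2 * cos (\<theta> x))) = (\<lambda>h. 0)"
    by (rule has_derivative_unique)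
  then have *: "(x$1 * (L h * cos (\<theta> x)) + h$1 * sin (\<theta> x))
      - (x$2 * (L h * (- sin (\<theta> x))) + h$2 * cos (\<theta> x)) = 0" for h
    by (rule fun_cong)
  have **: "norm x * L h = h$2 * cos (\<theta> x) - h$1 * sin (\<theta> x)" for h
  proof -
    have "norm x * L h * ((cos (\<theta> x))\<^sup>2 + (sin (\<theta> x))\<^sup>2) = h$2 * cos (\<theta> x) - h$1 * sin (\<theta> x)"
      using *[of h] unfolding x1 x2 power2_eq_square by algebra
    then show ?thesis by (simp only: sin_cos_squared_add2 mult_1_right)
  qed
  have "L h = (x$1 * h$2 - x$2 * h$1) / (norm x)\<^sup>2" for h
  proof -
    have "(norm x)\<^sup>2 * L h = x$1 * h$2 - x$2 * h$1"
      using **[of h] unfolding x1 x2 power2_eq_square by algebra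
    then show ?thesis using x by (simp add: field_simps)
  qed
  then show ?thesis
    by (simp add: grad_def grad_angle_def vec_eq_iff forall_2 axis_def L_def[symmetric]
        field_simps)
qed

section \<open>The gas\<close>

definition bernoulli :: "real \<Rightarrow> real \<Rightarrow> real \<Rightarrow> bool" where
  "bernoulli \<gamma> q2 \<rho> \<longleftrightarrow> q2 / 2 + \<rho> powr (\<gamma> - 1) / (\<gamma> - 1) = (\<gamma> + 1) / (2 * (\<gamma> - 1))"

text \<open>Density as a function of the squared speed.\<close>

definition g :: "real \<Rightarrow> real \<Rightarrow> real" where
  "g \<gamma> q2 = ((\<gamma> + 1 - (\<gamma> - 1) * q2) / 2) powr (1 / (\<gamma> - 1))"

text \<open>Density as a function of the squared momentum; meaningful for arguments in \<open>{0..1}\<close>.\<close>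

definition H :: "real \<Rightarrow> real \<Rightarrow> real" where
  "H \<gamma> s = (THE \<rho>. \<rho> \<ge> 1 \<and> bernoulli \<gamma> (s / \<rho>\<^sup>2) \<rho>)"

section \<open>The background flow\<close>

definition rho0 :: "real \<Rightarrow> real \<Rightarrow> real \<Rightarrow> real" where
  "rho0 \<gamma> \<kappa>1 \<kappa>2 = (THE \<rho>. \<rho> > 0 \<and> bernoulli \<gamma> (\<kappa>1\<^sup>2 + \<kappa>2\<^sup>2) \<rho>)"

definition background_flow ::
  "real \<Rightarrow> real \<Rightarrow> real \<Rightarrow> (real \<Rightarrow> real) \<Rightarrow> (real \<Rightarrow> real) \<Rightarrow> (real \<Rightarrow> real) \<Rightarrow> bool" where
  "background_flow \<gamma> \<kappa>1 \<kappa>2 \<rho>b U1 U2 \<longleftrightarrow>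
     \<kappa>1 > 0 \<and> \<kappa>1\<^sup>2 + \<kappa>2\<^sup>2 < 1 \<and>
     \<rho>b 1 = rho0 \<gamma> \<kappa>1 \<kappa>2 \<and> U1 1 = \<kappa>1 \<and> U2 1 = \<kappa>2 \<and>
     (\<forall>r\<ge>1. \<rho>b r > 0) \<and>
     (\<forall>f\<in>{\<rho>b, U1, U2}. continuous_on {1..} f \<and> smooth_on f {1<..}) \<and>
     (\<forall>r>1. deriv (\<lambda>s. \<rho>b s * U1 s) r + \<rho>b r * U1 r / r = 0 \<and>
            U1 r * deriv U1 r + deriv (\<lambda>s. \<rho>b s powr \<gamma> / \<gamma>) r / \<rho>b r - (U2 r)\<^sup>2 / r = 0 \<and>
            U1 r * deriv U2 r + U1 r * U2 r / r = 0)"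

definition psi20 :: "real \<Rightarrow> (real \<Rightarrow> real) \<Rightarrow> real \<Rightarrow> real" where
  "psi20 \<kappa>2 \<rho>b r = - \<kappa>2 * integral {1..r} (\<lambda>s. \<rho>b s / s)"

text \<open>
  \<open>\<nabla>\<psi>\<^sub>0 = \<rho>\<^sub>0 \<kappa>\<^sub>1 \<nabla>\<theta> + \<psi>\<^sub>2\<^sub>0'(r) e\<^sub>r\<close>, with \<open>\<psi>\<^sub>2\<^sub>0'\<close> written out because \<open>psi20\<close> is one-sided at
  \<open>r = 1\<close>, which the boundary curve may touch.
\<close>

definition grad_psi0 :: "real \<Rightarrow> real \<Rightarrow> real \<Rightarrow> (real \<Rightarrow> real) \<Rightarrow> real^2 \<Rightarrow> real^2" where
  "grad_psi0 \<gamma> \<kappa>1 \<kappa>2 \<rho>b x =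
     (rho0 \<gamma> \<kappa>1 \<kappa>2 * \<kappa>1) *\<^sub>R grad_angle x - (\<kappa>2 * \<rho>b (norm x) / norm x) *\<^sub>R e_r x"

section \<open>The exterior problem\<close>

text \<open>
  The stream function \<open>\<psi> = \<psi>\<^sub>0 + \<phi>\<close> is multivalued through \<open>\<psi>\<^sub>1\<^sub>0 = \<rho>\<^sub>0 \<kappa>\<^sub>1 \<theta>\<close>; it is represented by
  the single-valued function \<open>\<phi> = \<psi> - \<psi>\<^sub>0\<close>.  In particular \<open>\<psi> = \<psi>\<^sub>1\<^sub>0\<close> on the boundary reads
  \<open>\<phi> = - \<psi>\<^sub>2\<^sub>0\<close>.
\<close>

definition grad_psi ::
  "real \<Rightarrow> real \<Rightarrow> real \<Rightarrow> (real \<Rightarrow> real) \<Rightarrow> (real^2 \<Rightarrow> real) \<Rightarrow> real^2 \<Rightarrow> real^2" where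
  "grad_psi \<gamma> \<kappa>1 \<kappa>2 \<rho>b \<phi> x = grad_psi0 \<gamma> \<kappa>1 \<kappa>2 \<rho>b x + grad \<phi> x"

text \<open>Classical solutions for a density law \<open>h\<close>: the law \<open>H \<gamma>\<close> or a truncation of it.\<close>

definition solves_problem ::
  "(real^2) set \<Rightarrow> real \<Rightarrow> (real \<Rightarrow> real) \<Rightarrow> real \<Rightarrow> real \<Rightarrow> (real \<Rightarrow> real) \<Rightarrow> (real^2 \<Rightarrow> real) \<Rightarrow> bool" where
  "solves_problem D \<gamma> h \<kappa>1 \<kappa>2 \<rho>b \<phi> \<longleftrightarrow>
     (let G = grad_psi \<gamma> \<kappa>1 \<kappa>2 \<rho>b \<phi>; F = (\<lambda>x. G x /\<^sub>R h ((norm (G x))\<^sup>2)) in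
       Ck_near 2 \<phi> (- D) \<and>
       (\<forall>x\<in>interior (- D). F differentiable at x \<and> divergence F x = 0) \<and>
       (\<forall>x\<in>frontier D. \<phi> x = - psi20 \<kappa>2 \<rho>b (norm x)) \<and>
       (\<lambda>x. norm (grad \<phi> x)) \<in> O[at_infinity](\<lambda>x. 1 / (norm x)\<^sup>2))"

definition uniformly_subsonic_spiral_flow ::
  "(real^2) set \<Rightarrow> real \<Rightarrow> real \<Rightarrow> real \<Rightarrow> (real^2 \<Rightarrow> real^2) \<Rightarrow> bool" where
  "uniformly_subsonic_spiral_flow D \<gamma> \<kappa>1 \<kappa>2 u \<longleftrightarrow>
     (\<exists>\<rho>b U1 U2 \<phi>. background_flow \<gamma> \<kappa>1 \<kappa>2 \<rho>b U1 U2 \<and>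
       (let G = grad_psi \<gamma> \<kappa>1 \<kappa>2 \<rho>b \<phi> in
         solves_problem D \<gamma> (H \<gamma>) \<kappa>1 \<kappa>2 \<rho>b \<phi> \<and> smooth_near \<phi> (- D) \<and>
         bdd_above ((\<lambda>x. norm (G x)) ` (- D)) \<and> (SUP x\<in>- D. norm (G x)) < 1 \<and>
         (\<forall>x\<in>- D. u x = vector [G x $ 2, - (G x $ 1)] /\<^sub>R H \<gamma> ((norm (G x))\<^sup>2))))"

section \<open>The threshold\<close>

definition truncation :: "real \<Rightarrow> real \<Rightarrow> (real \<Rightarrow> real) \<Rightarrow> bool" where
  "truncation \<gamma> \<epsilon> Ht \<longleftrightarrow>
     smooth_near Ht {0..} \<and> antimono_on {0..} Ht \<and>
     (\<forall>s\<in>{0..1 - 2 * \<epsilon>}. Ht s = H \<gamma> s) \<and> (\<forall>s\<ge>1 - \<epsilon>. Ht s = H \<gamma> (1 - \<epsilon>))"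

text \<open>The solution of the truncated problem is unique, so the existential quantifier speaks about it.\<close>

definition below_truncation ::
  "(real^2) set \<Rightarrow> real \<Rightarrow> real \<Rightarrow> (real \<Rightarrow> real) \<Rightarrow> real \<Rightarrow> real \<Rightarrow> bool" where
  "below_truncation D \<gamma> \<epsilon> Ht \<kappa>2 \<kappa>1 \<longleftrightarrow>
     (\<exists>\<rho>b U1 U2 \<phi>. background_flow \<gamma> \<kappa>1 \<kappa>2 \<rho>b U1 U2 \<and> solves_problem D \<gamma> Ht \<kappa>1 \<kappa>2 \<rho>b \<phi> \<and>
       (\<forall>x\<in>- D. norm (grad_psi \<gamma> \<kappa>1 \<kappa>2 \<rho>b \<phi> x) < sqrt (1 - 2 * \<epsilon>)))"

text \<open>\<open>{0<..<K}\<close> is the maximal interval on which \<open>P\<close> holds; it is empty if \<open>K = 0\<close>.\<close>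

definition maximal_interval :: "(real \<Rightarrow> bool) \<Rightarrow> real \<Rightarrow> bool" where
  "maximal_interval P K \<longleftrightarrow> K \<ge> 0 \<and> (\<forall>k\<in>{0<..<K}. P k) \<and> (\<forall>K'>K. \<not> (\<forall>k\<in>{0<..<K'}. P k))"

definition is_threshold :: "(real^2) set \<Rightarrow> real \<Rightarrow> real \<Rightarrow> real \<Rightarrow> bool" where
  "is_threshold D \<gamma> \<kappa>2 \<kappa>t \<longleftrightarrow>
     (\<exists>\<epsilon> Ht K. (\<forall>i. 0 < \<epsilon> i \<and> \<epsilon> i < 1 / 2 \<and> \<epsilon> (Suc i) < \<epsilon> i) \<and> \<epsilon> \<longlonglongrightarrow> 0 \<and>
       (\<forall>i. truncation \<gamma> (\<epsilon> i) (Ht i) \<and>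
            maximal_interval (below_truncation D \<gamma> (\<epsilon> i) (Ht i) \<kappa>2) (K i)) \<and>
       K \<longlonglongrightarrow> \<kappa>t)"

end

theory Submission
  imports Defs "HOL-Complex_Analysis.Complex_Analysis" "HOL-Library.Diagonal_Subsequence"
begin

text \<open>
  Density, pressure and momentum depend nonlinearly on the velocity, so the uniform bound
  \<open>q < 1\<close> and weak compactness would not suffice: the velocities have to converge almost
  everywhere. This comes from convergence of the stream functions and from monotonicity of the
  map \<open>u \<mapsto> g(\<bar>u\<bar>\<^sup>2) u\<close>.

  The mass flux of a spiral flow is the rotated gradient of a single-valued function \<open>\<Phi>\<close> plus
  \<open>c x / \<bar>x\<bar>\<^sup>2\<close>, where \<open>c = \<rho>\<^sub>0 \<kappa>\<^sub>1\<close>; the second term is the rotated gradient of \<open>c \<theta>\<close>. Here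
  \<open>\<Phi>\<close> vanishes on the boundary curve, and after extension by zero over the obstacle it is
  Lipschitz with constant \<open>1 + c\<close>, because \<open>\<bar>\<nabla>\<psi>\<bar> < 1\<close> and \<open>\<bar>\<nabla>\<theta>\<bar> \<le> 1\<close> outside the unit disc
  (\<open>spiral_stream_of_flow\<close>). A subsequence of the functions \<open>\<Phi>\<close> therefore converges at every
  point (\<open>equilipschitz_convergent_subsequence\<close>).

  The map \<open>F(u) = g(\<bar>u\<bar>\<^sup>2) u\<close> is strictly monotone on the closed unit disc, sonic circle
  included, and by compactness it is uniformly monotone (\<open>mass_flux_uniformly_monotone\<close>). For
  two flows \<open>i\<close> and \<open>j\<close> the difference of the mass fluxes is the rotated gradient of
  \<open>\<Phi>\<^sub>i - \<Phi>\<^sub>j\<close> plus \<open>(c\<^sub>i - c\<^sub>j) x / \<bar>x\<bar>\<^sup>2\<close>, while the difference of the velocities is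
  curl-free. Testing the curl equation with \<open>\<eta> (\<Phi>\<^sub>i - \<Phi>\<^sub>j)\<close> for a cut-off function \<open>\<eta>\<close> removes
  the derivatives from \<open>\<Phi>\<^sub>i - \<Phi>\<^sub>j\<close> and bounds the integral of
  \<open>\<eta> (F(u\<^sub>i) - F(u\<^sub>j)) \<bullet> (u\<^sub>i - u\<^sub>j)\<close> by the \<open>L\<^sup>1\<close> distance of \<open>\<Phi>\<^sub>i\<close> and \<open>\<Phi>\<^sub>j\<close> near the
  support of \<open>\<eta>\<close> and by \<open>\<bar>c\<^sub>i - c\<^sub>j\<bar>\<close>, up to a constant (\<open>energy_estimate\<close>). So the velocities
  form a Cauchy sequence in \<open>L\<^sup>1\<close> on every small ball of the exterior (\<open>velocity_L1_cauchy\<close>),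
  and a diagonal subsequence over a countable cover by such balls converges almost everywhere
  (\<open>velocity_ae_convergent_subsequence\<close>). Each equation states that a field depending
  continuously on the velocity is divergence-free, and dominated convergence carries it to the
  limit (\<open>distr_div_free_limit\<close>).

  For the normal trace, the rotated gradient of \<open>\<Phi>\<close> contributes nothing, since \<open>\<Phi>\<close> is Lipschitz
  and zero on the obstacle (\<open>spiral_stream_normal_trace\<close>). What is left is \<open>c x / \<bar>x\<bar>\<^sup>2\<close>, and
  its normal trace is Green's formula outside a smooth Jordan curve
  (\<open>radial_field_normal_trace\<close>). That formula is derived from complex analysis: the
  Cauchy-Pompeiu formula expresses the test function on the curve by an area integral of its
  gradient against the Cauchy kernel; after an interchange of the integrations the weight in
  the area integral is a difference of winding numbers, which is the indicator of the exterior
  up to sign. The sign is fixed by comparing the inward normal with the tangent through the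
  jump of the winding number across the curve. Finally \<open>\<rho>\<^sub>0 \<kappa>\<^sub>1\<close> is continuous in \<open>\<kappa>\<^sub>1\<close> up to
  the sonic value (\<open>tendsto_source_strength\<close>).
\<close>

\<comment> \<open>Coefficients of formal power series compete for the symbol that selects vector components.\<close>
no_notation fps_nth (infixl \<open>$\<close> 75)

section \<open>Integrals of derivatives of Lipschitz functions\<close>

lemma lebesgue_integral_translation:
  fixes f :: "'a::euclidean_space \<Rightarrow> 'b::{banach, second_countable_topology}"
  assumes "f \<in> borel_measurable borel"
  shows "(LINT x|lebesgue. f (a + x)) = (LINT x|lebesgue. f x)"
proof -
  have m: "(\<lambda>x. f (a + x)) \<in> borel_measurable borel"
    using assms by measurable
  have "(LINT x|lborel. f x) = (LINT x|distr lborel borel ((+) a). f x)"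
    by (simp add: lborel_distr_plus)
  also have "\<dots> = (LINT x|lborel. f (a + x))"
    using assms by (subst integral_distr) auto
  finally show ?thesis
    using assms m by (simp add: integral_completion)
qed

lemma integrable_continuous_compact_support:
  fixes f :: "'a::euclidean_space \<Rightarrow> 'b::euclidean_space"
  assumes "continuous_on K f" "compact K" "K \<subseteq> U" "\<And>x. x \<in> U - K \<Longrightarrow> f x = 0" "U \<in> sets lebesgue"
  shows "integrable (lebesgue_on U) f"
proof -
  have "integrable lborel (\<lambda>x. if x \<in> K then f x else 0)"
    using borel_integrable_compact[OF assms(2,1)] by (simp add: indicator_scaleR_eq_if)
  then have "integrable lebesgue (\<lambda>x. if x \<in> K then f x else 0)"
    using borel_measurable_integrable integrable_completion by (metis measurable_lborel1)
  moreover have "(\<lambda>x. if x \<in> K then f x else 0) = (\<lambda>x. indicator U x *\<^sub>R f x)"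
    using assms(3,4) by (auto simp: indicator_def fun_eq_iff)
  ultimately show ?thesis
    using assms(5) by (simp add: integrable_restrict_space)
qed

lemma difference_quotient_tendsto:
  fixes f :: "'a::real_normed_vector \<Rightarrow> 'b::real_normed_vector"
  assumes "(f has_derivative f') (at x)" and "d \<longlonglongrightarrow> 0" and "\<And>n::nat. d n \<noteq> 0"
  shows "(\<lambda>n. (f (x + d n *\<^sub>R e) - f x) /\<^sub>R d n) \<longlonglongrightarrow> f' e"
proof -
  have "((\<lambda>t. f (x + t *\<^sub>R e)) has_derivative (\<lambda>t. f' (t *\<^sub>R e))) (at 0)"
    by (rule has_derivative_compose[of "\<lambda>t. x + t *\<^sub>R e"])
       (use assms(1) in \<open>auto intro!: derivative_eq_intros\<close>)
  then have lim: "((\<lambda>t. norm (f (x + t *\<^sub>R e) - f x - f' (t *\<^sub>R e)) / norm t) \<longlongrightarrow> 0) (at 0)"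
    by (simp add: has_derivative_iff_norm)
  have eq: "norm (f (x + t *\<^sub>R e) - f x - f' (t *\<^sub>R e)) / norm t
      = norm ((f (x + t *\<^sub>R e) - f x) /\<^sub>R t - f' e)" if "t \<noteq> 0" for t
  proof -
    have "(f (x + t *\<^sub>R e) - f x) /\<^sub>R t - f' e
        = (f (x + t *\<^sub>R e) - f x - f' (t *\<^sub>R e)) /\<^sub>R t"
      using that has_derivative_bounded_linear[OF assms(1)] by (simp add: linear_simps scaleR_diff_right)
    then show ?thesis by (simp add: divide_inverse mult.commute)
  qed
  have "((\<lambda>t. norm ((f (x + t *\<^sub>R e) - f x) /\<^sub>R t - f' e)) \<longlongrightarrow> 0) (at 0)"
    by (rule Lim_transform_eventually[OF lim])
       (unfold eventually_at_filter, intro always_eventually allI impI, rule eq)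
  then have "((\<lambda>t. (f (x + t *\<^sub>R e) - f x) /\<^sub>R t) \<longlongrightarrow> f' e) (at 0)"
    by (rule LIM_zero_cancel[OF tendsto_norm_zero_cancel])
  then show ?thesis
    by (rule filterlim_compose) (use assms(2,3) in \<open>auto simp: filterlim_at\<close>)
qed

text \<open>The difference quotients integrate to zero by translation invariance. They are bounded by
  the Lipschitz constant on a fixed ball and converge almost everywhere, so dominated
  convergence applies. Differentiability is demanded almost everywhere because stream functions
  extended by zero, and kernels glued along a circle, have kinks.\<close>
lemma integral_derivative_eq_0:
  fixes f :: "'a::euclidean_space \<Rightarrow> 'b::euclidean_space"
  assumes lip: "\<And>x y. norm (f x - f y) \<le> L * norm (x - y)"
    and supp: "\<And>x. R < norm x \<Longrightarrow> f x = 0"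
    and der: "AE x in lebesgue. (f has_derivative f' x) (at x)"
  shows "integrable lebesgue (\<lambda>x. f' x e)" and "(LINT x|lebesgue. f' x e) = 0"
proof -
  define d where "d = (\<lambda>n. inverse (real (Suc n)))"
  define q where "q = (\<lambda>n x. (f (d n *\<^sub>R e + x) - f x) /\<^sub>R d n)"
  \<comment> \<open>The steps \<open>d n\<close> are at most 1, so all difference quotients live in this ball.\<close>
  define w where "w = (\<lambda>x::'a. (\<bar>L\<bar> * norm e) * indicator (cball 0 (R + norm e)) x)"
  have d: "0 < d n" "d n \<le> 1" for n
    unfolding d_def by (simp_all add: inverse_le_1_iff)
  have d0: "d \<longlonglongrightarrow> 0"
    unfolding d_def by (rule LIMSEQ_inverse_real_of_nat)
  have "\<bar>L\<bar>-lipschitz_on UNIV f"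
    by (intro lipschitz_onI) (auto simp: dist_norm intro!: order_trans[OF lip] mult_right_mono)
  then have contf: "continuous_on UNIV f"
    by (rule lipschitz_on_continuous_on)
  have mf: "f \<in> borel_measurable borel"
    using contf by (rule borel_measurable_continuous_onI)
  have intf: "integrable lebesgue f"
    using integrable_continuous_compact_support[of "cball 0 R" f UNIV] contf supp
    by (auto simp: lebesgue_on_UNIV_eq intro: continuous_on_subset)
  have intf2: "integrable lebesgue (\<lambda>x. f (a + x))" for a
  proof -
    have "f (a + x) = 0" if "x \<notin> cball 0 (R + norm a)" for x
      using that norm_triangle_ineq2[of x "-a"] by (intro supp) (simp add: add.commute)
    moreover have "continuous_on (cball 0 (R + norm a)) (\<lambda>x. f (a + x))"
      by (intro continuous_on_compose2[OF contf] continuous_intros) auto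
    ultimately show ?thesis
      using integrable_continuous_compact_support[of "cball 0 (R + norm a)" "\<lambda>x. f (a + x)" UNIV]
      by (simp add: lebesgue_on_UNIV_eq)
  qed
  have qm: "q n \<in> borel_measurable lebesgue" for n
    unfolding q_def using intf intf2 by (intro borel_measurable_scaleR borel_measurable_diff) auto
  have q0: "(LINT x|lebesgue. q n x) = 0" for n
    unfolding q_def using intf intf2 mf
    by (subst integral_scaleR_right) (auto simp: lebesgue_integral_translation)
  have qlim: "AE x in lebesgue. (\<lambda>n. q n x) \<longlonglongrightarrow> f' x e"
    using der
  proof eventually_elim
    case (elim x)
    have "d n \<noteq> 0" for n using d(1)[of n] by simp
    from difference_quotient_tendsto[OF elim d0 this] show ?case
      by (simp add: q_def add.commute)
  qed
  have bound: "norm (q n x) \<le> w x" for n x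
  proof (cases "x \<in> cball 0 (R + norm e)")
    case True
    have "norm (q n x) = norm (f (d n *\<^sub>R e + x) - f x) / d n"
      using d[of n] by (simp add: q_def divide_inverse mult.commute)
    also have "\<dots> \<le> \<bar>L\<bar> * norm e"
      using lip[of "d n *\<^sub>R e + x" x] d[of n] mult_right_mono[OF abs_ge_self, of "norm (d n *\<^sub>R e)" L]
      by (simp add: divide_le_eq mult_ac)
    finally show ?thesis using True by (simp add: w_def)
  next
    case False
    have "norm (d n *\<^sub>R e) \<le> norm e"
      using d[of n] by (simp add: mult_left_le_one_le)
    then have "R < norm (d n *\<^sub>R e + x)"
      using False norm_triangle_ineq2[of x "- (d n *\<^sub>R e)"] by (simp add: add.commute)
    moreover have "R < norm x"
      using False norm_ge_zero[of e] by (simp del: norm_ge_zero)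
    ultimately show ?thesis by (simp add: q_def w_def supp)
  qed
  have wint: "integrable lebesgue w"
    unfolding w_def using lmeasurable_cball[of 0 "R + norm e"]
    by (intro integrable_mult_right integrable_real_indicator) (auto simp: fmeasurable_def)
  define l where "l = (\<lambda>x. lim (\<lambda>n. q n x))"
  have lm: "l \<in> borel_measurable lebesgue"
    unfolding l_def using qm by (rule borel_measurable_lim_metric)
  have "AE x in lebesgue. l x = f' x e"
    using qlim by eventually_elim (simp add: l_def limI)
  then have f'm: "(\<lambda>x. f' x e) \<in> borel_measurable lebesgue"
    by (rule borel_measurable_AE[OF lm])
  show "integrable lebesgue (\<lambda>x. f' x e)"
    by (rule integrable_dominated_convergence[OF f'm qm wint qlim]) (simp add: bound)
  have "(\<lambda>n. LINT x|lebesgue. q n x) \<longlonglongrightarrow> (LINT x|lebesgue. f' x e)"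
    by (rule integral_dominated_convergence[OF f'm qm wint qlim]) (simp add: bound)
  then show "(LINT x|lebesgue. f' x e) = 0"
    using q0 by (simp add: LIMSEQ_const_iff)
qed

section \<open>Continuously differentiable functions of two variables\<close>

text \<open>The partial derivatives are arguments because they occur in integrands.\<close>
definition C1_on ::
  "(real^2 \<Rightarrow> 'b::real_normed_vector) \<Rightarrow> (real^2 \<Rightarrow> 'b) \<Rightarrow> (real^2 \<Rightarrow> 'b) \<Rightarrow> (real^2) set \<Rightarrow> bool" where
  "C1_on f fx fy U \<longleftrightarrow> open U \<and> continuous_on U fx \<and> continuous_on U fy \<and>
     (\<forall>x\<in>U. (f has_derivative (\<lambda>h. h$1 *\<^sub>R fx x + h$2 *\<^sub>R fy x)) (at x))"

lemma C1_onD: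
  assumes "C1_on f fx fy U"
  shows "open U" "continuous_on U fx" "continuous_on U fy" "continuous_on U f"
    and "x \<in> U \<Longrightarrow> (f has_derivative (\<lambda>h. h$1 *\<^sub>R fx x + h$2 *\<^sub>R fy x)) (at x)"
proof -
  show "x \<in> U \<Longrightarrow> (f has_derivative (\<lambda>h. h$1 *\<^sub>R fx x + h$2 *\<^sub>R fy x)) (at x)" for x
    using assms by (auto simp: C1_on_def)
  then show "continuous_on U f"
    by (intro continuous_at_imp_continuous_on ballI) (blast intro: has_derivative_continuous)
qed (use assms in \<open>auto simp: C1_on_def\<close>)

lemma C1_on_subset: "C1_on f fx fy U \<Longrightarrow> open V \<Longrightarrow> V \<subseteq> U \<Longrightarrow> C1_on f fx fy V"
  unfolding C1_on_def by (blast intro: continuous_on_subset)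

lemma C1_on_cong:
  assumes "C1_on f fx fy U" and "\<And>x. x \<in> U \<Longrightarrow> f x = q x"
    and "\<And>x. x \<in> U \<Longrightarrow> fx x = qx x" and "\<And>x. x \<in> U \<Longrightarrow> fy x = qy x"
  shows "C1_on q qx qy U"
  unfolding C1_on_def
proof (intro conjI ballI)
  show "open U" using assms(1) by (simp add: C1_on_def)
  show "continuous_on U qx" "continuous_on U qy"
    using assms continuous_on_cong[of U U fx qx] continuous_on_cong[of U U fy qy]
    by (auto simp: C1_on_def)
  fix x assume x: "x \<in> U"
  then show "(q has_derivative (\<lambda>h. h$1 *\<^sub>R qx x + h$2 *\<^sub>R qy x)) (at x)"
    using C1_onD(5)[OF assms(1) x] assms(2-) \<open>open U\<close>
    by (auto intro: has_derivative_transform_within_open)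
qed

lemma C1_on_partials_unique:
  assumes "C1_on f fx fy U" and "(f has_derivative (\<lambda>h. h$1 *\<^sub>R a + h$2 *\<^sub>R b)) (at x)" and "x \<in> U"
  shows "fx x = a" and "fy x = b"
proof -
  have "(\<lambda>h::real^2. h$1 *\<^sub>R fx x + h$2 *\<^sub>R fy x) = (\<lambda>h. h$1 *\<^sub>R a + h$2 *\<^sub>R b)"
    using has_derivative_unique[OF C1_onD(5)[OF assms(1,3)] assms(2)] .
  from fun_cong[OF this, of "axis 1 1 :: real^2"] fun_cong[OF this, of "axis 2 1 :: real^2"]
  show "fx x = a" "fy x = b" by (simp_all add: axis_def)
qed

lemma C1_on_const: "open U \<Longrightarrow> C1_on (\<lambda>x. k) (\<lambda>x. 0) (\<lambda>x. 0) U"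
  by (simp add: C1_on_def)

lemma C1_on_coords:
  assumes "open U"
  shows "C1_on (\<lambda>x. x$1) (\<lambda>x. 1) (\<lambda>x. 0::real) U" "C1_on (\<lambda>x. x$2) (\<lambda>x. 0) (\<lambda>x. 1::real) U"
  using assms bounded_linear_imp_has_derivative[OF bounded_linear_vec_nth] by (auto simp: C1_on_def)

lemma C1_on_add:
  assumes "C1_on f fx fy U" "C1_on q qx qy U"
  shows "C1_on (\<lambda>x. f x + q x) (\<lambda>x. fx x + qx x) (\<lambda>x. fy x + qy x) U"
  unfolding C1_on_def
proof (intro conjI ballI)
  fix x assume "x \<in> U"
  from has_derivative_add[OF C1_onD(5)[OF assms(1) this] C1_onD(5)[OF assms(2) this]]
  show "((\<lambda>x. f x + q x) has_derivative (\<lambda>h. h$1 *\<^sub>R (fx x + qx x) + h$2 *\<^sub>R (fy x + qy x))) (at x)"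
    by (simp add: algebra_simps)
qed (use assms in \<open>auto simp: C1_on_def intro!: continuous_on_add\<close>)

lemma C1_on_mult:
  fixes f q :: "real^2 \<Rightarrow> 'b::real_normed_field"
  assumes "C1_on f fx fy U" "C1_on q qx qy U"
  shows "C1_on (\<lambda>x. f x * q x) (\<lambda>x. fx x * q x + f x * qx x) (\<lambda>x. fy x * q x + f x * qy x) U"
  unfolding C1_on_def
proof (intro conjI ballI)
  fix x assume "x \<in> U"
  from has_derivative_mult[OF C1_onD(5)[OF assms(1) this] C1_onD(5)[OF assms(2) this]]
  show "((\<lambda>x. f x * q x) has_derivative
     (\<lambda>h. h$1 *\<^sub>R (fx x * q x + f x * qx x) + h$2 *\<^sub>R (fy x * q x + f x * qy x))) (at x)"
    by (simp add: algebra_simps)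
qed (use assms C1_onD(4)[OF assms(1)] C1_onD(4)[OF assms(2)] in \<open>auto simp: C1_on_def intro!: continuous_intros\<close>)

lemma C1_on_cmult:
  fixes f :: "real^2 \<Rightarrow> 'b::real_normed_field"
  assumes "C1_on f fx fy U"
  shows "C1_on (\<lambda>x. k * f x) (\<lambda>x. k * fx x) (\<lambda>x. k * fy x) U"
  using C1_on_mult[OF C1_on_const[OF C1_onD(1)[OF assms], of k] assms] by simp

lemma C1_on_diff:
  fixes f q :: "real^2 \<Rightarrow> 'b::real_normed_field"
  assumes "C1_on f fx fy U" "C1_on q qx qy U"
  shows "C1_on (\<lambda>x. f x - q x) (\<lambda>x. fx x - qx x) (\<lambda>x. fy x - qy x) U"
  using C1_on_add[OF assms(1) C1_on_cmult[OF assms(2), of "-1"]] by simp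

lemma C1_on_compose:
  fixes f :: "real^2 \<Rightarrow> real" and k :: "real \<Rightarrow> real"
  assumes f: "C1_on f fx fy U" and k: "\<And>x. x \<in> U \<Longrightarrow> (k has_real_derivative k' (f x)) (at (f x))"
    and k': "continuous_on (f ` U) k'"
  shows "C1_on (\<lambda>x. k (f x)) (\<lambda>x. k' (f x) * fx x) (\<lambda>x. k' (f x) * fy x) U"
  unfolding C1_on_def
proof (intro conjI ballI)
  have "continuous_on U (\<lambda>x. k' (f x))"
    using continuous_on_compose2[OF k' C1_onD(4)[OF f]] by auto
  then show "continuous_on U (\<lambda>x. k' (f x) * fx x)" "continuous_on U (\<lambda>x. k' (f x) * fy x)"
    using C1_onD(2,3)[OF f] by (auto intro!: continuous_intros)
  fix x assume x: "x \<in> U"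
  from has_derivative_compose[OF C1_onD(5)[OF f x] k[OF x, unfolded has_field_derivative_def]]
  show "((\<lambda>x. k (f x)) has_derivative
     (\<lambda>h. h$1 *\<^sub>R (k' (f x) * fx x) + h$2 *\<^sub>R (k' (f x) * fy x))) (at x)"
    by (simp add: algebra_simps)
qed (rule C1_onD(1)[OF f])

lemma linear_real2:
  fixes D :: "real^2 \<Rightarrow> 'b::real_normed_vector"
  assumes "linear D"
  shows "D h = h$1 *\<^sub>R D (axis 1 1) + h$2 *\<^sub>R D (axis 2 1)"
proof -
  have "h = h$1 *\<^sub>R axis 1 1 + h$2 *\<^sub>R axis 2 1"
    by (simp add: vec_eq_iff forall_2 axis_def)
  then have "D h = D (h$1 *\<^sub>R axis 1 1 + h$2 *\<^sub>R axis 2 1)" by simp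
  then show ?thesis
    by (simp only: linear_add[OF assms] linear_scale[OF assms])
qed

lemma Ck_on_1_C1_on:
  assumes "Ck_on (Suc k) f U" "open U"
  shows "C1_on f (\<lambda>x. frechet_derivative f (at x) (axis 1 1)) (\<lambda>x. frechet_derivative f (at x) (axis 2 1)) U"
    and "Ck_on k (\<lambda>x. frechet_derivative f (at x) v) U"
proof -
  have cont: "Ck_on k q V \<Longrightarrow> open V \<Longrightarrow> continuous_on V q" for k and q :: "real^2 \<Rightarrow> 'a" and V
    by (cases k) (auto simp: differentiable_imp_continuous_on)
  show *: "Ck_on k (\<lambda>x. frechet_derivative f (at x) v) U" for v
    using assms(1) unfolding Ck_on.simps by blast
  show "C1_on f (\<lambda>x. frechet_derivative f (at x) (axis 1 1)) (\<lambda>x. frechet_derivative f (at x) (axis 2 1)) U"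
    unfolding C1_on_def
  proof (intro conjI ballI)
    fix x assume "x \<in> U"
    then have "(f has_derivative frechet_derivative f (at x)) (at x)"
      using assms unfolding Ck_on.simps
      by (metis differentiable_on_eq_differentiable_at frechet_derivative_works)
    moreover from this have "frechet_derivative f (at x) = (\<lambda>h. h$1 *\<^sub>R frechet_derivative f (at x) (axis 1 1)
        + h$2 *\<^sub>R frechet_derivative f (at x) (axis 2 1))"
      by (intro ext linear_real2 has_derivative_linear)
    ultimately show "(f has_derivative (\<lambda>h. h$1 *\<^sub>R frechet_derivative f (at x) (axis 1 1)
        + h$2 *\<^sub>R frechet_derivative f (at x) (axis 2 1))) (at x)"
      by simp
  qed (intro assms(2) cont[OF * assms(2)])+
qed

lemma C1_on_grad:
  fixes f :: "real^2 \<Rightarrow> real"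
  assumes "C1_on f fx fy U" "x \<in> U"
  shows "grad f x = vector [fx x, fy x]"
  using frechet_derivative_at[OF C1_onD(5)[OF assms], symmetric]
  by (simp add: grad_def vec_eq_iff forall_2) (simp add: axis_def)

section \<open>Test functions and weakly divergence-free fields\<close>

text \<open>One continuous derivative is demanded, not all, since cut-off functions and their products
  with stream functions serve as test functions.\<close>
definition C1_test ::
  "(real^2) set \<Rightarrow> (real^2 \<Rightarrow> real) \<Rightarrow> (real^2 \<Rightarrow> real) \<Rightarrow> (real^2 \<Rightarrow> real) \<Rightarrow> bool" where
  "C1_test U v vx vy \<longleftrightarrow>
     C1_on v vx vy UNIV \<and> (\<exists>K. compact K \<and> K \<subseteq> U \<and> (\<forall>x. x \<notin> K \<longrightarrow> v x = 0))"

lemma C1_test_support: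
  assumes "C1_test U v vx vy"
  obtains K where "compact K" "K \<subseteq> U" "\<And>x. x \<notin> K \<Longrightarrow> v x = 0 \<and> vx x = 0 \<and> vy x = 0"
proof -
  have v: "C1_on v vx vy UNIV" and "\<exists>K. compact K \<and> K \<subseteq> U \<and> (\<forall>x. x \<notin> K \<longrightarrow> v x = 0)"
    using assms unfolding C1_test_def by blast+
  then obtain K where K: "compact K" "K \<subseteq> U" "\<And>x. x \<notin> K \<Longrightarrow> v x = 0"
    by blast
  have "vx x = 0 \<and> vy x = 0" if "x \<notin> K" for x
  proof -
    have "(v has_derivative (\<lambda>h. h$1 *\<^sub>R 0 + h$2 *\<^sub>R 0)) (at x)"
    proof (rule has_derivative_transform_within_open)
      show "((\<lambda>_. 0) has_derivative (\<lambda>h::real^2. h$1 *\<^sub>R 0 + h$2 *\<^sub>R 0::real)) (at x)"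
        by simp
      show "open (- K)" using K(1) compact_imp_closed by blast
    qed (use that K(3) in auto)
    then show ?thesis
      using C1_on_partials_unique[OF v] by blast
  qed
  with K show ?thesis by (intro that[of K]) auto
qed

lemma C1_on_Un:
  assumes "C1_on f fx fy U" "C1_on f fx fy V"
  shows "C1_on f fx fy (U \<union> V)"
  using assms by (auto simp: C1_on_def intro: continuous_on_open_Un)

text \<open>Outside the support of \<open>v\<close> the product is locally zero, so the values of \<open>f\<close> off \<open>U\<close> do
  not enter.\<close>
lemma C1_test_mult:
  assumes f: "C1_on f fx fy U" and v: "C1_test U v vx vy"
  shows "C1_test U (\<lambda>x. f x * v x) (\<lambda>x. fx x * v x + f x * vx x) (\<lambda>x. fy x * v x + f x * vy x)"
proof -
  obtain K where K: "compact K" "K \<subseteq> U" "\<And>x. x \<notin> K \<Longrightarrow> v x = 0 \<and> vx x = 0 \<and> vy x = 0"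
    using C1_test_support[OF v] by metis
  have "C1_on v vx vy UNIV" using v by (simp add: C1_test_def)
  then have v: "C1_on v vx vy U" by (rule C1_on_subset) (use C1_onD(1)[OF f] in auto)
  have "open (- K)" using K compact_imp_closed by auto
  then have "C1_on (\<lambda>x. f x * v x) (\<lambda>x. fx x * v x + f x * vx x) (\<lambda>x. fy x * v x + f x * vy x) (- K)"
    by (rule C1_on_cong[OF C1_on_const[of _ 0]]) (use K in auto)
  note C1_on_Un[OF C1_on_mult[OF f v] this]
  moreover have "U \<union> - K = UNIV" using K by blast
  ultimately have "C1_on (\<lambda>x. f x * v x) (\<lambda>x. fx x * v x + f x * vx x) (\<lambda>x. fy x * v x + f x * vy x) UNIV"
    by simp
  then show ?thesis
    unfolding C1_test_def by (intro conjI exI[of _ K]) (use K in auto)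
qed

lemma C1_test_integrable:
  assumes "C1_test U v vx vy" "open U"
  shows "integrable (lebesgue_on U) v" "integrable (lebesgue_on U) vx" "integrable (lebesgue_on U) vy"
proof -
  obtain K where K: "compact K" "K \<subseteq> U" "\<And>x. x \<notin> K \<Longrightarrow> v x = 0 \<and> vx x = 0 \<and> vy x = 0"
    using C1_test_support[OF assms(1)] by metis
  have v: "C1_on v vx vy UNIV" using assms by (simp add: C1_test_def)
  show "integrable (lebesgue_on U) v" "integrable (lebesgue_on U) vx" "integrable (lebesgue_on U) vy"
    using K C1_onD(2-4)[OF v] assms(2)
    by (auto intro!: integrable_continuous_compact_support[of K] intro: continuous_on_subset)
qed

lemma bounded_of_compact_support:
  fixes f :: "'a::metric_space \<Rightarrow> real"
  assumes "continuous_on K f" "compact K" "\<And>x. x \<notin> K \<Longrightarrow> f x = 0"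
  obtains B where "B \<ge> 0" "\<And>x. \<bar>f x\<bar> \<le> B"
proof -
  have "bounded (f ` K)"
    using assms compact_continuous_image compact_imp_bounded by blast
  then obtain B where "B > 0" "\<And>x. x \<in> K \<Longrightarrow> \<bar>f x\<bar> \<le> B"
    unfolding bounded_pos by auto
  then show ?thesis
    using that[of B] assms(3) by (metis abs_zero less_imp_le)
qed

lemma C1_test_lipschitz:
  assumes "C1_test U v vx vy"
  obtains L where "L \<ge> 0" "\<And>x y. \<bar>v x - v y\<bar> \<le> L * norm (x - y)" "\<And>x. \<bar>vx x\<bar> \<le> L" "\<And>x. \<bar>vy x\<bar> \<le> L"
     "\<And>x. \<bar>v x\<bar> \<le> L"
proof -
  obtain K where K: "compact K" "K \<subseteq> U" "\<And>x. x \<notin> K \<Longrightarrow> v x = 0 \<and> vx x = 0 \<and> vy x = 0"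
    using C1_test_support[OF assms(1)] by metis
  have v: "C1_on v vx vy UNIV" using assms by (simp add: C1_test_def)
  obtain B1 where B1: "B1 \<ge> 0" "\<And>x. \<bar>vx x\<bar> \<le> B1"
    using bounded_of_compact_support[of K vx] K C1_onD(2)[OF v] continuous_on_subset by blast
  obtain B2 where B2: "B2 \<ge> 0" "\<And>x. \<bar>vy x\<bar> \<le> B2"
    using bounded_of_compact_support[of K vy] K C1_onD(3)[OF v] continuous_on_subset by blast
  obtain B3 where B3: "B3 \<ge> 0" "\<And>x. \<bar>v x\<bar> \<le> B3"
    using bounded_of_compact_support[of K v] K C1_onD(4)[OF v] continuous_on_subset by blast
  have "norm (v x - v y) \<le> (B1 + B2) * norm (x - y)" for x y
  proof (rule differentiable_bound[of UNIV v "\<lambda>x h. h$1 *\<^sub>R vx x + h$2 *\<^sub>R vy x"])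
    fix x :: "real^2"
    show "(v has_derivative (\<lambda>h. h$1 *\<^sub>R vx x + h$2 *\<^sub>R vy x)) (at x within UNIV)"
      using C1_onD(5)[OF v] by simp
    show "onorm (\<lambda>h::real^2. h$1 *\<^sub>R vx x + h$2 *\<^sub>R vy x) \<le> B1 + B2"
    proof (rule onorm_le)
      fix h :: "real^2"
      have "\<bar>h$1 * vx x\<bar> \<le> B1 * norm h" "\<bar>h$2 * vy x\<bar> \<le> B2 * norm h"
        using mult_mono[OF component_le_norm_cart[of h 1] B1(2)[of x]]
          mult_mono[OF component_le_norm_cart[of h 2] B2(2)[of x]]
        by (simp_all add: abs_mult mult.commute)
      then show "norm (h$1 *\<^sub>R vx x + h$2 *\<^sub>R vy x) \<le> (B1 + B2) * norm h"
        by (simp add: algebra_simps abs_le_iff)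
    qed
  qed auto
  then have "\<bar>v x - v y\<bar> \<le> (B1 + B2 + B3) * norm (x - y)" for x y
    using order_trans[OF _ mult_right_mono[of "B1 + B2" "B1+B2+B3" "norm (x-y)"]] B3(1) by simp
  then show ?thesis
    using that[of "B1 + B2 + B3"] B1 B2 B3 by (smt (verit))
qed

lemma C1_test_integral:
  assumes v: "C1_test U v vx vy" and U: "open U"
  shows "(LINT x|lebesgue_on U. vx x) = 0" "(LINT x|lebesgue_on U. vy x) = 0"
proof -
  obtain K where K: "compact K" "K \<subseteq> U" "\<And>x. x \<notin> K \<Longrightarrow> v x = 0 \<and> vx x = 0 \<and> vy x = 0"
    using C1_test_support[OF assms(1)] by metis
  obtain L where L: "\<And>x y. \<bar>v x - v y\<bar> \<le> L * norm (x - y)"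
    using C1_test_lipschitz[OF v] by metis
  obtain R where R: "\<And>x. x \<in> K \<Longrightarrow> norm x \<le> R"
    using K(1) compact_imp_bounded by (metis bounded_iff)
  have D: "AE x in lebesgue. (v has_derivative (\<lambda>h. h$1 *\<^sub>R vx x + h$2 *\<^sub>R vy x)) (at x)"
    using C1_onD(5)[of v vx vy UNIV] v by (intro AE_I2) (simp add: C1_test_def)
  have z: "v x = 0" if "R < norm x" for x
    using K R that by (meson not_le)
  have "(LINT x|lebesgue. vx x) = 0" "(LINT x|lebesgue. vy x) = 0"
    using integral_derivative_eq_0(2)[OF _ z D, where L=L and e="axis 1 1"]
      integral_derivative_eq_0(2)[OF _ z D, where L=L and e="axis 2 1"] L
    by (auto simp: axis_def)
  moreover have "(\<lambda>x. indicator U x *\<^sub>R vx x) = vx" "(\<lambda>x. indicator U x *\<^sub>R vy x) = vy"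
    using K by (auto simp: indicator_def fun_eq_iff)
  ultimately show "(LINT x|lebesgue_on U. vx x) = 0" "(LINT x|lebesgue_on U. vy x) = 0"
    using U by (simp_all add: integral_restrict_space)
qed

text \<open>Integration by parts: \<open>P v\<close> and \<open>Q v\<close> are test functions themselves, so their partial
  derivatives integrate to zero.\<close>
lemma divergence_free_weak:
  assumes P: "C1_on P Px Py U" and Q: "C1_on Q Qx Qy U"
    and div: "\<And>x. x \<in> U \<Longrightarrow> Px x + Qy x = 0" and v: "C1_test U v vx vy"
  shows "(LINT x|lebesgue_on U. P x * vx x + Q x * vy x) = 0"
proof -
  have U: "open U" using C1_onD(1)[OF P] .
  note Pv = C1_test_mult[OF P v] and Qv = C1_test_mult[OF Q v]
  have "(LINT x|lebesgue_on U. P x * vx x + Q x * vy x)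
      = (LINT x|lebesgue_on U. (Px x * v x + P x * vx x) + (Qy x * v x + Q x * vy x))"
  proof (rule Bochner_Integration.integral_cong)
    fix x assume "x \<in> space (lebesgue_on U)"
    then have "Px x * v x + Qy x * v x = 0"
      using div by (simp flip: distrib_right)
    then show "P x * vx x + Q x * vy x = (Px x * v x + P x * vx x) + (Qy x * v x + Q x * vy x)"
      by simp
  qed simp
  also have "\<dots> = 0"
    using C1_test_integrable[OF Pv U] C1_test_integrable[OF Qv U] C1_test_integral[OF Pv U] C1_test_integral[OF Qv U]
    by (subst Bochner_Integration.integral_add) auto
  finally show ?thesis .
qed

text \<open>The mean value theorem, applied in direction \<open>a\<close> to a difference in direction \<open>b\<close> and then
  in direction \<open>b\<close> to the derivative. The second difference is symmetric in \<open>a\<close> and \<open>b\<close>, which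
  is the reason for the symmetry of mixed partial derivatives.\<close>
lemma second_difference_mean_value:
  fixes f :: "'a::real_normed_vector \<Rightarrow> real"
  assumes f: "\<And>y. y \<in> ball x0 r \<Longrightarrow> (f has_derivative f' y) (at y)"
    and f': "\<And>y. y \<in> ball x0 r \<Longrightarrow> ((\<lambda>y. f' y a) has_derivative k y) (at y)"
    and h: "0 < h" "h * (norm a + norm b) < r"
  obtains p where "dist x0 p \<le> h * (norm a + norm b)"
    "f (x0 + h *\<^sub>R a + h *\<^sub>R b) - f (x0 + h *\<^sub>R a) - f (x0 + h *\<^sub>R b) + f x0 = h\<^sup>2 * k p b"
proof -
  have d: "dist x0 (x0 + t *\<^sub>R a + s *\<^sub>R b) \<le> h * (norm a + norm b)" if "0 \<le> t" "t \<le> h" "0 \<le> s" "s \<le> h" for t s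
  proof -
    have "dist x0 (x0 + t *\<^sub>R a + s *\<^sub>R b) = norm (t *\<^sub>R a + s *\<^sub>R b)"
      by (metis add.assoc add_diff_cancel_left' dist_commute dist_norm)
    also have "\<dots> \<le> t * norm a + s * norm b"
      using norm_triangle_ineq[of "t *\<^sub>R a" "s *\<^sub>R b"] that by simp
    also have "\<dots> \<le> h * (norm a + norm b)"
      using that by (simp add: distrib_left add_mono mult_right_mono)
    finally show ?thesis .
  qed
  then have in_ball: "x0 + t *\<^sub>R a + s *\<^sub>R b \<in> ball x0 r" if "0 \<le> t" "t \<le> h" "0 \<le> s" "s \<le> h" for t s
    using h(2) that by (meson le_less_trans mem_ball)
  have lin: "linear (f' y)" "linear (k y)" if "y \<in> ball x0 r" for y
    using that f f' has_derivative_linear by blast+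
  have D1: "((\<lambda>t. f (x0 + t *\<^sub>R a + s *\<^sub>R b)) has_real_derivative f' (x0 + t *\<^sub>R a + s *\<^sub>R b) a) (at t)"
    if "0 \<le> t" "t \<le> h" "0 \<le> s" "s \<le> h" for t s
  proof -
    have "((\<lambda>t. x0 + t *\<^sub>R a + s *\<^sub>R b) has_derivative (\<lambda>\<tau>. \<tau> *\<^sub>R a)) (at t)"
      by (auto intro!: derivative_eq_intros)
    from has_derivative_compose[OF this f[OF in_ball[OF that]]] show ?thesis
      unfolding has_field_derivative_def
      by (simp add: linear_scale[OF lin(1)[OF in_ball[OF that]]] mult_commute_abs)
  qed
  have "\<exists>z>0. z < h \<and> (f (x0 + h *\<^sub>R a + h *\<^sub>R b) - f (x0 + h *\<^sub>R a + 0 *\<^sub>R b)) - (f (x0 + 0 *\<^sub>R a + h *\<^sub>R b) - f (x0 + 0 *\<^sub>R a + 0 *\<^sub>R b))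
      = (h - 0) * (f' (x0 + z *\<^sub>R a + h *\<^sub>R b) a - f' (x0 + z *\<^sub>R a + 0 *\<^sub>R b) a)"
    using h(1) by (intro MVT2 DERIV_diff D1) auto
  then obtain z where z: "0 < z" "z < h" and 1: "f (x0 + h *\<^sub>R a + h *\<^sub>R b) - f (x0 + h *\<^sub>R a) - f (x0 + h *\<^sub>R b) + f x0
      = h * (f' (x0 + z *\<^sub>R a + h *\<^sub>R b) a - f' (x0 + z *\<^sub>R a + 0 *\<^sub>R b) a)"
    by (auto simp: algebra_simps)
  have D2: "((\<lambda>s. f' (x0 + z *\<^sub>R a + s *\<^sub>R b) a) has_real_derivative k (x0 + z *\<^sub>R a + s *\<^sub>R b) b) (at s)"
    if "0 \<le> s" "s \<le> h" for s
  proof -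
    have "((\<lambda>s. x0 + z *\<^sub>R a + s *\<^sub>R b) has_derivative (\<lambda>\<tau>. \<tau> *\<^sub>R b)) (at s)"
      by (auto intro!: derivative_eq_intros)
    moreover have m: "x0 + z *\<^sub>R a + s *\<^sub>R b \<in> ball x0 r" using in_ball[of z s] z that by auto
    ultimately show ?thesis
      using has_derivative_compose[of "\<lambda>s. x0 + z *\<^sub>R a + s *\<^sub>R b" "\<lambda>\<tau>. \<tau> *\<^sub>R b" s UNIV "\<lambda>y. f' y a", OF _ f'[OF m]]
      unfolding has_field_derivative_def
      by (simp add: linear_scale[OF lin(2)[OF m]] mult_commute_abs)
  qed
  have "\<exists>w>0. w < h \<and> f' (x0 + z *\<^sub>R a + h *\<^sub>R b) a - f' (x0 + z *\<^sub>R a + 0 *\<^sub>R b) a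
      = (h - 0) * k (x0 + z *\<^sub>R a + w *\<^sub>R b) b"
    using h(1) by (intro MVT2 D2) auto
  then obtain w where w: "0 < w" "w < h" and 2: "f' (x0 + z *\<^sub>R a + h *\<^sub>R b) a - f' (x0 + z *\<^sub>R a + 0 *\<^sub>R b) a
      = h * k (x0 + z *\<^sub>R a + w *\<^sub>R b) b" by auto
  show thesis
    using that[of "x0 + z *\<^sub>R a + w *\<^sub>R b"] d[of z w] z w 1 2 by (simp add: power2_eq_square)
qed

lemma mixed_partials_eq:
  fixes f :: "real^2 \<Rightarrow> real"
  assumes f: "C1_on f fx fy U" and fx: "C1_on fx fxx fxy U" and fy: "C1_on fy fyx fyy U" and x: "x \<in> U"
  shows "fxy x = fyx x"
proof -
  obtain r where r: "0 < r" "ball x r \<subseteq> U"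
    using C1_onD(1)[OF f] x open_contains_ball by blast
  define h where "h = (\<lambda>n. r / 4 * inverse (real (Suc n)))"
  have h: "0 < h n" "h n * (1 + 1) < r" for n
    using r inverse_le_1_iff[of "real (Suc n)"] mult_left_mono[of "inverse (real (Suc n))" 1 "r / 4"]
    by (auto simp: h_def simp del: of_nat_Suc)
  have h0: "h \<longlonglongrightarrow> 0"
    unfolding h_def by (rule tendsto_mult_right_zero[OF LIMSEQ_inverse_real_of_nat])
  have pq: "\<exists>p q. dist x p \<le> h n * 2 \<and> dist x q \<le> h n * 2 \<and> fxy p = fyx q" for n
  proof -
    have nrm: "norm (axis 1 1 :: real^2) = 1" "norm (axis 2 1 :: real^2) = 1" by simp_all
    have 1: "(f has_derivative (\<lambda>h. h$1 *\<^sub>R fx y + h$2 *\<^sub>R fy y)) (at y)" if "y \<in> ball x r" for y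
      using C1_onD(5)[OF f] that r by blast
    have 2: "((\<lambda>y. (axis 1 1 :: real^2)$1 *\<^sub>R fx y + (axis 1 1 :: real^2)$2 *\<^sub>R fy y) has_derivative (\<lambda>h. h$1 *\<^sub>R fxx y + h$2 *\<^sub>R fxy y)) (at y)"
      if "y \<in> ball x r" for y
      using C1_onD(5)[OF fx] that r by (auto simp: axis_def)
    have 3: "((\<lambda>y. (axis 2 1 :: real^2)$1 *\<^sub>R fx y + (axis 2 1 :: real^2)$2 *\<^sub>R fy y) has_derivative (\<lambda>h. h$1 *\<^sub>R fyx y + h$2 *\<^sub>R fyy y)) (at y)"
      if "y \<in> ball x r" for y
      using C1_onD(5)[OF fy] that r by (auto simp: axis_def)
    obtain p where p: "dist x p \<le> h n * 2"
      "f (x + h n *\<^sub>R axis 1 1 + h n *\<^sub>R axis 2 1) - f (x + h n *\<^sub>R axis 1 1) - f (x + h n *\<^sub>R axis 2 1) + f x = (h n)\<^sup>2 * fxy p"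
      by (rule second_difference_mean_value[OF 1 2, where h="h n" and b="axis 2 1"])
         (use h[of n] nrm in \<open>auto simp: axis_def\<close>)
    obtain q where q: "dist x q \<le> h n * 2"
      "f (x + h n *\<^sub>R axis 2 1 + h n *\<^sub>R axis 1 1) - f (x + h n *\<^sub>R axis 2 1) - f (x + h n *\<^sub>R axis 1 1) + f x = (h n)\<^sup>2 * fyx q"
      by (rule second_difference_mean_value[OF 1 3, where h="h n" and b="axis 1 1"])
         (use h[of n] nrm in \<open>auto simp: axis_def\<close>)
    have "(h n)\<^sup>2 * fxy p = (h n)\<^sup>2 * fyx q"
      using p(2) q(2) by (simp add: algebra_simps)
    then show ?thesis using p q h(1)[of n] by auto
  qed
  then obtain p q where p: "\<And>n. dist x (p n) \<le> h n * 2" and q: "\<And>n. dist x (q n) \<le> h n * 2"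
    and eq: "\<And>n. fxy (p n) = fyx (q n)" by metis
  have lim: "z \<longlonglongrightarrow> x" if "\<And>n. dist x (z n) \<le> h n * 2" for z
  proof -
    have "(\<lambda>n. h n * 2) \<longlonglongrightarrow> 0" using tendsto_mult_left_zero[OF h0] by simp
    then have "(\<lambda>n. dist (z n) x) \<longlonglongrightarrow> 0"
      by (rule Lim_null_comparison[rotated]) (use that in \<open>simp add: dist_commute\<close>)
    then show ?thesis by (simp add: tendsto_dist_iff[of z])
  qed
  have "isCont fxy x" "isCont fyx x"
    using C1_onD(1,3)[OF fx] C1_onD(2)[OF fy] x continuous_on_eq_continuous_at by blast+
  then have "(\<lambda>n. fxy (p n)) \<longlonglongrightarrow> fxy x" "(\<lambda>n. fyx (q n)) \<longlonglongrightarrow> fyx x"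
    using lim[OF p] lim[OF q] isCont_tendsto_compose by blast+
  then show ?thesis using eq LIMSEQ_unique by auto
qed

section \<open>The mass flux as a function of the velocity\<close>

text \<open>Bernoulli's law solved for \<open>\<rho>\<^bsup>\<gamma> - 1\<^esup>\<close> at squared speed \<open>s\<close>.\<close>
definition bern :: "real \<Rightarrow> real \<Rightarrow> real" where
  "bern \<gamma> s = (\<gamma> + 1 - (\<gamma> - 1) * s) / 2"

lemma bern_ge_1:
  assumes "\<gamma> > 1" "s \<le> 1"
  shows "bern \<gamma> s \<ge> 1"
proof -
  have "(\<gamma> - 1) * s \<le> (\<gamma> - 1) * 1" using assms by (intro mult_left_mono) auto
  moreover obtain p where "(\<gamma> - 1) * s = p" by blast
  ultimately show ?thesis unfolding bern_def by simp
qed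

lemma g_bern: "g \<gamma> s = bern \<gamma> s powr (1 / (\<gamma> - 1))"
  by (simp add: g_def bern_def)

lemma g_ge_1: "\<gamma> > 1 \<Longrightarrow> s \<le> 1 \<Longrightarrow> g \<gamma> s \<ge> 1"
  using bern_ge_1 by (simp add: g_bern ge_one_powr_ge_zero)

lemma bernoulli_iff_g:
  assumes "\<gamma> > 1" "s \<le> 1" "\<rho> > 0"
  shows "bernoulli \<gamma> s \<rho> \<longleftrightarrow> \<rho> = g \<gamma> s"
proof -
  have b: "bern \<gamma> s > 0" using bern_ge_1[of \<gamma> s] assms by simp
  have "bernoulli \<gamma> s \<rho> \<longleftrightarrow> \<rho> powr (\<gamma> - 1) = bern \<gamma> s"
    using assms(1) by (auto simp: bernoulli_def bern_def field_simps)
  also have "\<dots> \<longleftrightarrow> \<rho> = g \<gamma> s"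
  proof
    have "\<rho> = (\<rho> powr (\<gamma> - 1)) powr (1 / (\<gamma> - 1))"
      using assms by (simp add: powr_powr)
    then show "\<rho> powr (\<gamma> - 1) = bern \<gamma> s \<Longrightarrow> \<rho> = g \<gamma> s"
      by (simp add: g_bern)
  qed (use b assms in \<open>simp add: g_bern powr_powr\<close>)
  finally show ?thesis .
qed

lemma rho0_eq_g:
  assumes "\<gamma> > 1" "\<kappa>1\<^sup>2 + \<kappa>2\<^sup>2 \<le> 1"
  shows "rho0 \<gamma> \<kappa>1 \<kappa>2 = g \<gamma> (\<kappa>1\<^sup>2 + \<kappa>2\<^sup>2)"
  unfolding rho0_def
  using bernoulli_iff_g[OF assms] g_ge_1[OF assms] by (intro the_equality) (auto simp: less_le_trans[OF zero_less_one])

lemma bern_has_derivative: "(bern \<gamma> has_real_derivative - ((\<gamma> - 1) / 2)) (at s)"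
  unfolding bern_def[abs_def] by (auto intro!: derivative_eq_intros simp: field_simps)

lemma bern_powr_has_derivative:
  assumes "\<gamma> > 1" "s \<le> 1"
  shows "((\<lambda>s. bern \<gamma> s powr a) has_real_derivative - ((\<gamma> - 1) / 2) * a * bern \<gamma> s powr (a - 1)) (at s)"
proof -
  have "bern \<gamma> s > 0" using bern_ge_1[OF assms] by simp
  from DERIV_chain2[OF has_real_derivative_powr[OF this, of a] bern_has_derivative] show ?thesis
    by (rule DERIV_cong) simp
qed

lemma g_has_derivative:
  assumes "\<gamma> > 1" "s \<le> 1"
  shows "(g \<gamma> has_real_derivative - (bern \<gamma> s powr (1 / (\<gamma> - 1) - 1) / 2)) (at s)"
  unfolding g_bern[abs_def]
  by (rule DERIV_cong[OF bern_powr_has_derivative[OF assms]]) (use assms(1) in \<open>simp add: field_simps\<close>)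

text \<open>This is \<open>dp = - \<rho> d(q\<^sup>2 / 2)\<close>. It makes the momentum equations follow from conservation of
  mass and irrotationality.\<close>
lemma pressure_has_derivative:
  assumes "\<gamma> > 1" "s \<le> 1"
  shows "((\<lambda>s. g \<gamma> s powr \<gamma> / \<gamma>) has_real_derivative - (g \<gamma> s / 2)) (at s)"
proof -
  have a: "\<gamma> / (\<gamma> - 1) - 1 = 1 / (\<gamma> - 1)" using assms(1) by (simp add: field_simps)
  have eq: "(\<lambda>s. g \<gamma> s powr \<gamma> / \<gamma>) = (\<lambda>s. bern \<gamma> s powr (\<gamma> / (\<gamma> - 1)) / \<gamma>)"
    by (simp add: g_bern powr_powr)
  have "- ((\<gamma> - 1) / 2) * (\<gamma> / (\<gamma> - 1)) * bern \<gamma> s powr (\<gamma> / (\<gamma> - 1) - 1) / \<gamma> = - (g \<gamma> s / 2)"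
    unfolding a using assms(1) by (simp add: g_bern field_simps)
  then show ?thesis
    unfolding eq by (rule DERIV_cong[OF DERIV_cdivide[OF bern_powr_has_derivative[OF assms]]])
qed

lemma continuous_on_g: "\<gamma> > 1 \<Longrightarrow> continuous_on {..1} (g \<gamma>)"
  using DERIV_isCont[OF g_has_derivative] by (intro continuous_at_imp_continuous_on) auto

text \<open>The derivative of \<open>t g(t\<^sup>2)\<close> has the sign of \<open>bern \<gamma> (t\<^sup>2) - t\<^sup>2 = (\<gamma> + 1) (1 - t\<^sup>2) / 2\<close>,
  so it is positive at subsonic speeds; the sonic speed is reached as an end point.\<close>
lemma mass_flux_strict_mono:
  assumes "\<gamma> > 1" "0 \<le> a" "a < b" "b \<le> 1"
  shows "a * g \<gamma> (a\<^sup>2) < b * g \<gamma> (b\<^sup>2)"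
proof (rule DERIV_pos_imp_increasing_open[OF assms(3)])
  have sq: "t\<^sup>2 \<le> 1" if "a \<le> t" "t \<le> b" for t
    using that assms power_mono[of t 1 2] by simp
  have D: "((\<lambda>t. t * g \<gamma> (t\<^sup>2)) has_real_derivative
      g \<gamma> (t\<^sup>2) - t\<^sup>2 * bern \<gamma> (t\<^sup>2) powr (1 / (\<gamma> - 1) - 1)) (at t)" if t: "a \<le> t" "t \<le> b" for t
  proof -
    have "((\<lambda>t. g \<gamma> (t\<^sup>2)) has_real_derivative - (bern \<gamma> (t\<^sup>2) powr (1 / (\<gamma> - 1) - 1) / 2) * (2 * t)) (at t)"
      by (rule DERIV_chain2[where g="\<lambda>t. t\<^sup>2", OF g_has_derivative[OF assms(1) sq[OF t]]]) (auto intro!: derivative_eq_intros)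
    from DERIV_mult[OF DERIV_ident this] show ?thesis by (simp add: power2_eq_square algebra_simps)
  qed
  show "\<exists>y. ((\<lambda>t. t * g \<gamma> (t\<^sup>2)) has_real_derivative y) (at t) \<and> 0 < y" if t: "a < t" "t < b" for t
  proof (rule exI, rule conjI, rule D)
    have "t\<^sup>2 < 1" using t assms by (simp add: abs_square_less_1)
    moreover have B: "bern \<gamma> (t\<^sup>2) \<ge> 1" using bern_ge_1 assms(1) sq t by simp
    moreover have "bern \<gamma> (t\<^sup>2) powr (1 / (\<gamma> - 1)) = bern \<gamma> (t\<^sup>2) * bern \<gamma> (t\<^sup>2) powr (1 / (\<gamma> - 1) - 1)"
      using B by (simp add: powr_diff)
    ultimately show "0 < g \<gamma> (t\<^sup>2) - t\<^sup>2 * bern \<gamma> (t\<^sup>2) powr (1 / (\<gamma> - 1) - 1)"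
      by (simp add: g_bern flip: left_diff_distrib)
  qed (use t in auto)
  show "continuous_on {a..b} (\<lambda>t. t * g \<gamma> (t\<^sup>2))"
    using DERIV_isCont[OF D] by (intro continuous_at_imp_continuous_on) auto
qed

definition mass_flux :: "real \<Rightarrow> real^2 \<Rightarrow> real^2" where
  "mass_flux \<gamma> v = g \<gamma> ((norm v)\<^sup>2) *\<^sub>R v"

lemma sq_le_1: "norm (v::real^2) \<le> 1 \<Longrightarrow> (norm v)\<^sup>2 \<le> 1"
  by (simp add: power_le_one)

text \<open>With \<open>a = \<bar>v\<bar>\<close>, \<open>b = \<bar>w\<bar>\<close> and densities \<open>A\<close>, \<open>B\<close>, the product is the sum of
  \<open>(A a - B b) (a - b)\<close>, which is positive for \<open>a \<noteq> b\<close> by the scalar case, and of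
  \<open>(A + B) (a b - v \<bullet> w)\<close>, which is nonnegative by Cauchy-Schwarz and positive if \<open>a = b\<close> but
  \<open>v \<noteq> w\<close>.\<close>
lemma mass_flux_strictly_monotone:
  assumes "\<gamma> > 1" "norm v \<le> 1" "norm w \<le> 1" "v \<noteq> w"
  shows "(mass_flux \<gamma> v - mass_flux \<gamma> w) \<bullet> (v - w) > 0"
proof -
  define a b where "a = norm v" and "b = norm w"
  define A B where "A = g \<gamma> (a\<^sup>2)" and "B = g \<gamma> (b\<^sup>2)"
  have AB: "A \<ge> 1" "B \<ge> 1"
    using g_ge_1[OF assms(1)] sq_le_1 assms(2,3) by (simp_all add: A_def B_def a_def b_def)
  have "(mass_flux \<gamma> v - mass_flux \<gamma> w) \<bullet> (v - w) = A * a\<^sup>2 + B * b\<^sup>2 - (A + B) * (v \<bullet> w)"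
    by (simp add: mass_flux_def A_def B_def a_def b_def inner_diff_left inner_diff_right
        power2_norm_eq_inner inner_commute algebra_simps)
  also have "\<dots> = (A * a - B * b) * (a - b) + (A + B) * (a * b - v \<bullet> w)"
    by (simp add: algebra_simps power2_eq_square)
  also have "\<dots> > 0"
  proof (cases "a = b")
    case True
    have "(norm (v - w))\<^sup>2 = a\<^sup>2 + b\<^sup>2 - 2 * (v \<bullet> w)"
      by (simp add: power2_norm_eq_inner a_def b_def inner_diff_left inner_diff_right inner_commute)
    moreover have "0 < (norm (v - w))\<^sup>2" using assms(4) by simp
    ultimately have "a * b - v \<bullet> w > 0" using True by (simp add: power2_eq_square)
    then show ?thesis using True AB by (simp add: A_def B_def)
  next
    case False
    have "a * b - v \<bullet> w \<ge> 0"
      using norm_cauchy_schwarz[of v w] by (simp add: a_def b_def)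
    moreover have "(A * a - B * b) * (a - b) > 0"
      using mass_flux_strict_mono[OF assms(1), of a b] mass_flux_strict_mono[OF assms(1), of b a] False assms(2,3)
      by (cases "a < b") (auto simp: A_def B_def a_def b_def mult.commute intro: mult_pos_pos mult_neg_neg)
    ultimately show ?thesis using AB by (simp add: add_pos_nonneg)
  qed
  finally show ?thesis .
qed

lemma continuous_on_density:
  assumes "\<gamma> > 1"
  shows "continuous_on (cball 0 1) (\<lambda>w::real^2. g \<gamma> ((norm w)\<^sup>2))"
  by (rule continuous_on_compose2[OF continuous_on_g[OF assms]]) (auto intro!: continuous_intros sq_le_1)

lemma continuous_on_pressure:
  assumes "\<gamma> > 1"
  shows "continuous_on (cball 0 1) (\<lambda>w::real^2. g \<gamma> ((norm w)\<^sup>2) powr \<gamma> / \<gamma>)"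
proof -
  have "g \<gamma> ((norm w)\<^sup>2) \<noteq> 0" if "w \<in> cball 0 1" for w :: "real^2"
    using g_ge_1[OF assms, of "(norm w)\<^sup>2"] sq_le_1[of w] that by auto
  then show ?thesis
    using assms by (intro continuous_intros continuous_on_density) auto
qed

lemma continuous_on_mass_flux:
  assumes "\<gamma> > 1"
  shows "continuous_on (cball 0 1) (mass_flux \<gamma>)"
  unfolding mass_flux_def[abs_def] by (intro continuous_intros continuous_on_density[OF assms])

text \<open>Ellipticity degenerates at sonic speed, so no multiple of \<open>\<bar>v - w\<bar>\<^sup>2\<close> is a lower bound; a
  modulus exists because the pairs at distance at least \<open>\<delta>\<close> form a compact set.\<close>
lemma mass_flux_uniformly_monotone:
  assumes "\<gamma> > 1" "\<delta> > 0"
  obtains \<mu> where "\<mu> > 0"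
    "\<And>v w. norm v \<le> 1 \<Longrightarrow> norm w \<le> 1 \<Longrightarrow> norm (v - w) \<ge> \<delta> \<Longrightarrow>
       (mass_flux \<gamma> v - mass_flux \<gamma> w) \<bullet> (v - w) \<ge> \<mu>"
proof -
  define S where "S = (cball 0 1 \<times> cball 0 1) \<inter> {p::(real^2)\<times>(real^2). norm (fst p - snd p) \<ge> \<delta>}"
  have "closed {p::(real^2)\<times>(real^2). norm (fst p - snd p) \<ge> \<delta>}"
    by (intro closed_Collect_le continuous_intros)
  then have S: "compact S"
    unfolding S_def by (intro compact_Int_closed compact_Times) auto
  define k where "k = (\<lambda>p. (mass_flux \<gamma> (fst p) - mass_flux \<gamma> (snd p)) \<bullet> (fst p - snd p))"
  have k: "continuous_on S k"
    unfolding k_def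
    by (intro continuous_intros continuous_on_compose2[OF continuous_on_mass_flux[OF assms(1)]])
       (auto simp: S_def)
  have pos: "k p > 0" if "p \<in> S" for p
  proof -
    have "fst p \<noteq> snd p" using that assms(2) by (auto simp: S_def)
    then show ?thesis
      using that mass_flux_strictly_monotone[OF assms(1), of "fst p" "snd p"]
      by (auto simp: S_def k_def)
  qed
  show ?thesis
  proof (cases "S = {}")
    case True
    then show ?thesis using that[of 1] unfolding S_def by fastforce
  next
    case False
    obtain p where "p \<in> S" "\<And>q. q \<in> S \<Longrightarrow> k p \<le> k q"
      using continuous_attains_inf[OF S False k] by blast
    then show ?thesis
      using pos by (intro that[of "k p"]) (auto simp: S_def k_def)
  qed
qed

section \<open>The density as a function of the momentum\<close>

text \<open>The squared momentum \<open>\<rho>\<^sup>2 q\<^sup>2\<close> that Bernoulli's law assigns to the density \<open>\<rho>\<close>. It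
  decreases on \<open>\<rho> \<ge> 1\<close>, the range of sonic and subsonic states, and \<open>H\<close> is its inverse there.\<close>
definition momentum_sq :: "real \<Rightarrow> real \<Rightarrow> real" where
  "momentum_sq \<gamma> \<rho> = \<rho>\<^sup>2 * ((\<gamma> + 1) / (\<gamma> - 1)) - 2 / (\<gamma> - 1) * \<rho> powr (\<gamma> + 1)"

lemma bernoulli_iff_momentum_sq:
  assumes "\<gamma> > 1" "\<rho> > 0"
  shows "bernoulli \<gamma> (s / \<rho>\<^sup>2) \<rho> \<longleftrightarrow> s = momentum_sq \<gamma> \<rho>"
proof -
  have "\<rho> powr (\<gamma> + 1) = \<rho> powr (\<gamma> - 1) * \<rho>\<^sup>2"
    using assms(2) powr_add[of \<rho> "\<gamma> - 1" 2] by (simp add: add.commute[of \<gamma> 1])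
  then have m: "momentum_sq \<gamma> \<rho> = \<rho>\<^sup>2 * ((\<gamma> + 1) / (\<gamma> - 1) - 2 / (\<gamma> - 1) * \<rho> powr (\<gamma> - 1))"
    by (simp add: momentum_sq_def algebra_simps)
  have "bernoulli \<gamma> (s / \<rho>\<^sup>2) \<rho> \<longleftrightarrow> s / \<rho>\<^sup>2 = (\<gamma> + 1) / (\<gamma> - 1) - 2 / (\<gamma> - 1) * \<rho> powr (\<gamma> - 1)"
  proof -
    have e: "(\<gamma> + 1) / (2 * (\<gamma> - 1)) = (\<gamma> + 1) / (\<gamma> - 1) / 2"
      "2 / (\<gamma> - 1) * \<rho> powr (\<gamma> - 1) = 2 * (\<rho> powr (\<gamma> - 1) / (\<gamma> - 1))" by simp_all
    have "a / 2 + b = c / 2 \<longleftrightarrow> a = c - 2 * b" for a b c :: real by auto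
    then show ?thesis unfolding bernoulli_def e by this
  qed
  also have "\<dots> \<longleftrightarrow> s = momentum_sq \<gamma> \<rho>"
    unfolding m using assms by (simp add: divide_eq_eq mult.commute)
  finally show ?thesis .
qed

definition momentum_sq' :: "real \<Rightarrow> real \<Rightarrow> real" where
  "momentum_sq' \<gamma> \<rho> = 2 * ((\<gamma> + 1) / (\<gamma> - 1)) * (\<rho> - \<rho> powr \<gamma>)"

lemma momentum_sq_has_derivative:
  assumes "\<rho> > 0"
  shows "(momentum_sq \<gamma> has_real_derivative momentum_sq' \<gamma> \<rho>) (at \<rho>)"
proof -
  have "((\<lambda>\<rho>. \<rho>\<^sup>2 * c - d * \<rho> powr a) has_real_derivative 2 * \<rho> * c - d * (a * \<rho> powr (a - 1))) (at \<rho>)" for a c d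
    using has_real_derivative_powr[OF assms, of a] assms by (auto intro!: derivative_eq_intros)
  then show ?thesis
    unfolding momentum_sq_def[abs_def] momentum_sq'_def by (rule DERIV_cong) (simp add: right_diff_distrib, simp add: algebra_simps)
qed

lemma momentum_sq'_neg:
  assumes "\<gamma> > 1" "\<rho> > 1"
  shows "momentum_sq' \<gamma> \<rho> < 0"
  using assms powr_less_mono[of 1 \<gamma> \<rho>] unfolding momentum_sq'_def
  by (intro mult_pos_neg) auto

lemma momentum_sq_1: "\<gamma> > 1 \<Longrightarrow> momentum_sq \<gamma> 1 = 1"
  by (simp add: momentum_sq_def diff_divide_distrib[symmetric])

lemma momentum_sq_strict_antimono:
  assumes "\<gamma> > 1" "1 \<le> a" "a < b"
  shows "momentum_sq \<gamma> b < momentum_sq \<gamma> a"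
proof (rule DERIV_neg_imp_decreasing_open[OF assms(3)])
  show "\<exists>y. (momentum_sq \<gamma> has_real_derivative y) (at x) \<and> y < 0" if "a < x" "x < b" for x
    using that assms momentum_sq_has_derivative[of x \<gamma>] momentum_sq'_neg[of \<gamma> x] by force
  show "continuous_on {a..b} (momentum_sq \<gamma>)"
    using DERIV_isCont[OF momentum_sq_has_derivative] assms by (intro continuous_at_imp_continuous_on) auto
qed

text \<open>The squared momentum tends to minus infinity with the density, which gives the far end of
  the interval in the intermediate value argument for \<open>H\<close>.\<close>
lemma momentum_sq_le:
  assumes "\<gamma> > 1" "\<rho> \<ge> 1" "\<rho> powr (\<gamma> - 1) \<ge> \<gamma>"
  shows "momentum_sq \<gamma> \<rho> \<le> - \<rho>"
proof -
  have "\<rho> powr (\<gamma> + 1) = \<rho> powr (\<gamma> - 1) * \<rho>\<^sup>2"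
    using assms(2) powr_add[of \<rho> "\<gamma> - 1" 2] by (simp add: add.commute[of \<gamma> 1])
  then have "momentum_sq \<gamma> \<rho> = \<rho>\<^sup>2 * ((\<gamma> + 1 - 2 * \<rho> powr (\<gamma> - 1)) / (\<gamma> - 1))"
    by (simp add: momentum_sq_def algebra_simps diff_divide_distrib add_divide_distrib)
  also have "\<dots> \<le> \<rho>\<^sup>2 * (-1)"
    using assms by (intro mult_left_mono) (auto simp: divide_le_eq)
  also have "\<dots> \<le> - \<rho>" using assms(2) by (simp add: power2_eq_square)
  finally show ?thesis .
qed

lemma H_properties:
  assumes "\<gamma> > 1" "s \<le> 1"
  shows "H \<gamma> s \<ge> 1" "momentum_sq \<gamma> (H \<gamma> s) = s"
proof -
  \<comment> \<open>At this density the squared momentum is at most \<open>- b\<close>, hence at most \<open>s\<close>.\<close>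
  define b where "b = Max {2, \<bar>s\<bar>, \<gamma> powr (1 / (\<gamma> - 1))}"
  have b: "b \<ge> 2" "b \<ge> \<bar>s\<bar>" "b \<ge> \<gamma> powr (1 / (\<gamma> - 1))" by (auto simp: b_def)
  have "b powr (\<gamma> - 1) \<ge> (\<gamma> powr (1 / (\<gamma> - 1))) powr (\<gamma> - 1)"
    using b assms by (intro powr_mono2) auto
  then have "b powr (\<gamma> - 1) \<ge> \<gamma>" using assms by (simp add: powr_powr)
  then have "momentum_sq \<gamma> b \<le> s" using momentum_sq_le[OF assms(1), of b] b by auto
  moreover have "s \<le> momentum_sq \<gamma> 1" using assms momentum_sq_1 by simp
  ultimately obtain \<rho> where \<rho>: "\<rho> \<ge> 1" "momentum_sq \<gamma> \<rho> = s"
    using IVT2[of "momentum_sq \<gamma>" b s 1] DERIV_isCont[OF momentum_sq_has_derivative] b by force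
  have "H \<gamma> s = \<rho>"
    unfolding H_def
  proof (rule the_equality)
    show "1 \<le> \<rho> \<and> bernoulli \<gamma> (s / \<rho>\<^sup>2) \<rho>"
      using \<rho> bernoulli_iff_momentum_sq[OF assms(1), of \<rho> s] by simp
    fix \<sigma> assume "1 \<le> \<sigma> \<and> bernoulli \<gamma> (s / \<sigma>\<^sup>2) \<sigma>"
    then have "1 \<le> \<sigma>" "momentum_sq \<gamma> \<sigma> = momentum_sq \<gamma> \<rho>"
      using \<rho> bernoulli_iff_momentum_sq[OF assms(1), of \<sigma> s] by auto
    then show "\<sigma> = \<rho>"
      using momentum_sq_strict_antimono[OF assms(1), of \<rho> \<sigma>] momentum_sq_strict_antimono[OF assms(1), of \<sigma> \<rho>] \<rho>(1)
      by (cases \<rho> \<sigma> rule: linorder_cases) auto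
  qed
  with \<rho> show "H \<gamma> s \<ge> 1" "momentum_sq \<gamma> (H \<gamma> s) = s" by auto
qed

lemma H_momentum_sq:
  assumes "\<gamma> > 1" "\<rho> \<ge> 1"
  shows "H \<gamma> (momentum_sq \<gamma> \<rho>) = \<rho>"
proof -
  have "momentum_sq \<gamma> \<rho> \<le> 1"
    using momentum_sq_strict_antimono[OF assms(1), of 1 \<rho>] momentum_sq_1[OF assms(1)] assms(2) by (cases "\<rho> = 1") auto
  from H_properties[OF assms(1) this] show ?thesis
    using momentum_sq_strict_antimono[OF assms(1), of \<rho> "H \<gamma> (momentum_sq \<gamma> \<rho>)"]
      momentum_sq_strict_antimono[OF assms(1), of "H \<gamma> (momentum_sq \<gamma> \<rho>)" \<rho>] assms(2)
    by (cases \<rho> "H \<gamma> (momentum_sq \<gamma> \<rho>)" rule: linorder_cases) auto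
qed

lemma H_gt_1:
  assumes "\<gamma> > 1" "s < 1"
  shows "H \<gamma> s > 1"
  using H_properties[of \<gamma> s] assms momentum_sq_1[OF assms(1)] by (cases "H \<gamma> s = 1") auto

lemma H_eq_g:
  assumes "\<gamma> > 1" "s \<le> 1"
  shows "H \<gamma> s = g \<gamma> (s / (H \<gamma> s)\<^sup>2)"
proof -
  note h = H_properties[OF assms]
  have "1 \<le> (H \<gamma> s)\<^sup>2" using h(1) by (simp add: one_le_power)
  then have "s \<le> (H \<gamma> s)\<^sup>2" using assms(2) by linarith
  then have "s / (H \<gamma> s)\<^sup>2 \<le> 1" using assms(2) h(1) by (auto simp: divide_le_eq)
  then show ?thesis
    using bernoulli_iff_g[OF assms(1), of "s / (H \<gamma> s)\<^sup>2" "H \<gamma> s"] bernoulli_iff_momentum_sq[OF assms(1), of "H \<gamma> s" s] h by auto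
qed

text \<open>The derivative of the squared momentum vanishes at density 1, the sonic state, which
  accounts for the strict inequality.\<close>
lemma H_has_derivative:
  assumes "\<gamma> > 1" "s < 1"
  shows "(H \<gamma> has_real_derivative inverse (momentum_sq' \<gamma> (H \<gamma> s))) (at s)" "isCont (H \<gamma>) s"
proof -
  define r where "r = H \<gamma> s"
  have r: "r > 1" "momentum_sq \<gamma> r = s" using H_gt_1[OF assms] H_properties[of \<gamma> s] assms by (simp_all add: r_def)
  have "isCont (H \<gamma>) (momentum_sq \<gamma> r)"
  proof (rule isCont_inverse_function[where d = "(r - 1) / 2" and f = "momentum_sq \<gamma>" and x = r])
    fix z assume "\<bar>z - r\<bar> \<le> (r - 1) / 2"
    then have "r - z \<le> (r - 1) / 2" by (simp only: abs_le_iff minus_diff_eq)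
    then have "z \<ge> 1" using r(1) by (simp add: field_simps)
    then show "H \<gamma> (momentum_sq \<gamma> z) = z" "isCont (momentum_sq \<gamma>) z"
      using H_momentum_sq[OF assms(1)] DERIV_isCont[OF momentum_sq_has_derivative] by auto
  qed (use r in auto)
  then show c: "isCont (H \<gamma>) s" using r by simp
  show "(H \<gamma> has_real_derivative inverse (momentum_sq' \<gamma> (H \<gamma> s))) (at s)"
  proof (rule DERIV_inverse_function[where a = "s - 1" and b = 1])
    show "(momentum_sq \<gamma> has_real_derivative momentum_sq' \<gamma> (H \<gamma> s)) (at (H \<gamma> s))"
      using H_gt_1[OF assms] by (intro momentum_sq_has_derivative) auto
    show "momentum_sq' \<gamma> (H \<gamma> s) \<noteq> 0" using momentum_sq'_neg[OF assms(1) H_gt_1[OF assms]] by auto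
    show "\<And>y. s - 1 < y \<Longrightarrow> y < 1 \<Longrightarrow> momentum_sq \<gamma> (H \<gamma> y) = y"
      using H_properties(2)[OF assms(1)] by simp
  qed (use assms c in auto)
qed

lemma continuous_on_H_deriv:
  assumes "\<gamma> > 1"
  shows "continuous_on {..<1} (\<lambda>s. inverse (momentum_sq' \<gamma> (H \<gamma> s)))"
proof -
  have "continuous_on {..<1} (H \<gamma>)"
    using H_has_derivative(2)[OF assms] by (intro continuous_at_imp_continuous_on) auto
  moreover have "momentum_sq' \<gamma> (H \<gamma> s) \<noteq> 0" "H \<gamma> s \<noteq> 0" if "s < 1" for s
    using momentum_sq'_neg[OF assms H_gt_1[OF assms that]] H_gt_1[OF assms that] by auto
  ultimately show ?thesis
    by (intro continuous_intros) (auto simp: momentum_sq'_def intro!: continuous_intros)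
qed

section \<open>Radial fields, and Lipschitz bounds across a zero set\<close>

lemma norm_vec2: "norm (x::real^2) = sqrt ((x$1)\<^sup>2 + (x$2)\<^sup>2)"
  by (simp add: norm_vec_def L2_set_def sum_2)

lemma C1_on_norm: "C1_on (norm :: real^2 \<Rightarrow> real) (\<lambda>x. x$1 / norm x) (\<lambda>x. x$2 / norm x) (- {0})"
proof -
  have U: "open (- {0::real^2})" by auto
  note sq = C1_on_add[OF C1_on_mult[OF C1_on_coords(1)[OF U] C1_on_coords(1)[OF U]]
      C1_on_mult[OF C1_on_coords(2)[OF U] C1_on_coords(2)[OF U]]]
  have pos: "0 < x$1 * x$1 + x$2 * x$2" if "x \<in> - {0}" for x :: "real^2"
    using that by (auto simp: vec_eq_iff forall_2 sum_squares_gt_zero_iff)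
  have "C1_on (\<lambda>x. sqrt (x$1 * x$1 + x$2 * x$2)) (\<lambda>x. inverse (sqrt (x$1 * x$1 + x$2 * x$2)) / 2 * (1 * x$1 + x$1 * 1 + (0 * x$2 + x$2 * 0)))
      (\<lambda>x. inverse (sqrt (x$1 * x$1 + x$2 * x$2)) / 2 * (0 * x$1 + x$1 * 0 + (1 * x$2 + x$2 * 1))) (- {0::real^2})"
  proof (rule C1_on_compose[OF sq, of sqrt "\<lambda>y. inverse (sqrt y) / 2"])
    show "(sqrt has_real_derivative inverse (sqrt (x$1 * x$1 + x$2 * x$2)) / 2) (at (x$1 * x$1 + x$2 * x$2))"
      if "x \<in> - {0}" for x :: "real^2"
      using DERIV_real_sqrt[OF pos[OF that]] .
    show "continuous_on ((\<lambda>x::real^2. x$1 * x$1 + x$2 * x$2) ` (- {0})) (\<lambda>y. inverse (sqrt y) / 2)"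
      using pos by (intro continuous_intros) (fastforce, simp)
  qed
  moreover have n: "sqrt (x$1 * x$1 + x$2 * x$2) = norm x" for x :: "real^2"
    by (simp add: norm_vec2 power2_eq_square)
  ultimately have "C1_on norm (\<lambda>x. inverse (norm x) / 2 * (1 * x$1 + x$1 * 1 + (0 * x$2 + x$2 * 0)))
      (\<lambda>x. inverse (norm x) / 2 * (0 * x$1 + x$1 * 0 + (1 * x$2 + x$2 * 1))) (- {0::real^2})"
    by (simp only: n)
  moreover have "inverse (norm x) / 2 * (1 * x$1 + x$1 * 1 + (0 * x$2 + x$2 * 0)) = x$1 / norm x"
    "inverse (norm x) / 2 * (0 * x$1 + x$1 * 0 + (1 * x$2 + x$2 * 1)) = x$2 / norm x" for x :: "real^2"
    by (simp_all add: inverse_eq_divide)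
  ultimately show ?thesis by (simp only:)
qed

lemma C1_on_radial:
  assumes k: "\<And>r. r > 1 \<Longrightarrow> (k has_real_derivative k' r) (at r)" and k': "continuous_on {1<..} k'"
  shows "C1_on (\<lambda>x::real^2. k (norm x)) (\<lambda>x. k' (norm x) * (x$1 / norm x)) (\<lambda>x. k' (norm x) * (x$2 / norm x)) {x. 1 < norm x}"
proof -
  have "open {x::real^2. 1 < norm x}" by (intro open_Collect_less continuous_intros)
  then have N: "C1_on (norm :: real^2 \<Rightarrow> real) (\<lambda>x. x$1 / norm x) (\<lambda>x. x$2 / norm x) {x. 1 < norm x}"
    by (rule C1_on_subset[OF C1_on_norm]) auto
  show ?thesis
    by (rule C1_on_compose[OF N]) (use k in \<open>auto intro: continuous_on_subset[OF k']\<close>)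
qed

lemma C1_on_inverse:
  fixes f :: "real^2 \<Rightarrow> real"
  assumes "C1_on f fx fy U" "\<And>x. x \<in> U \<Longrightarrow> f x \<noteq> 0"
  shows "C1_on (\<lambda>x. inverse (f x)) (\<lambda>x. - (inverse (f x) * inverse (f x)) * fx x) (\<lambda>x. - (inverse (f x) * inverse (f x)) * fy x) U"
proof (rule C1_on_compose[OF assms(1), of inverse "\<lambda>y. - (inverse y * inverse y)"])
  show "(inverse has_real_derivative - (inverse (f x) * inverse (f x))) (at (f x))" if "x \<in> U" for x
    using DERIV_inverse[OF assms(2)[OF that], of UNIV] by (simp add: power2_eq_square)
  show "continuous_on (f ` U) (\<lambda>y. - (inverse y * inverse y))"
    using assms(2) by (intro continuous_intros) auto
qed

text \<open>The velocity field of a point source in an incompressible fluid, up to a factor; it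
  carries the flux that leaves the obstacle.\<close>
lemma C1_on_radial_field:
  fixes U :: "(real^2) set"
  assumes "open U" "0 \<notin> U"
  obtains ax ay bx by' where "C1_on (\<lambda>x. x$1 / (norm x)\<^sup>2) ax ay U" "C1_on (\<lambda>x. x$2 / (norm x)\<^sup>2) bx by' U"
    "\<And>x. x \<in> U \<Longrightarrow> ax x + by' x = 0"
proof -
  note X = C1_on_coords(1)[OF assms(1)] and Y = C1_on_coords(2)[OF assms(1)]
  note S = C1_on_add[OF C1_on_mult[OF X X] C1_on_mult[OF Y Y]]
  have nz: "x$1 * x$1 + x$2 * x$2 \<noteq> 0" if "x \<in> U" for x :: "real^2"
  proof -
    have "x \<noteq> 0" using that assms(2) by auto
    then show ?thesis by (simp add: vec_eq_iff forall_2 sum_squares_eq_zero_iff)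
  qed
  note I = C1_on_inverse[OF S nz]
  note A = C1_on_mult[OF X I] and B = C1_on_mult[OF Y I]
  have n: "(norm x)\<^sup>2 = x$1 * x$1 + x$2 * x$2" for x :: "real^2"
    by (simp add: norm_vec2 power2_eq_square)
  show ?thesis
  proof (rule that)
    show "C1_on (\<lambda>x. x$1 / (norm x)\<^sup>2) (\<lambda>x. 1 * inverse (x$1 * x$1 + x$2 * x$2) + x$1 * (- (inverse (x$1 * x$1 + x$2 * x$2) * inverse (x$1 * x$1 + x$2 * x$2)) * (1 * x$1 + x$1 * 1 + (0 * x$2 + x$2 * 0))))
     (\<lambda>x. 0 * inverse (x$1 * x$1 + x$2 * x$2) + x$1 * (- (inverse (x$1 * x$1 + x$2 * x$2) * inverse (x$1 * x$1 + x$2 * x$2)) * (0 * x$1 + x$1 * 0 + (1 * x$2 + x$2 * 1)))) U"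
      unfolding n divide_inverse by (rule A)
    show "C1_on (\<lambda>x. x$2 / (norm x)\<^sup>2) (\<lambda>x. 0 * inverse (x$1 * x$1 + x$2 * x$2) + x$2 * (- (inverse (x$1 * x$1 + x$2 * x$2) * inverse (x$1 * x$1 + x$2 * x$2)) * (1 * x$1 + x$1 * 1 + (0 * x$2 + x$2 * 0))))
     (\<lambda>x. 1 * inverse (x$1 * x$1 + x$2 * x$2) + x$2 * (- (inverse (x$1 * x$1 + x$2 * x$2) * inverse (x$1 * x$1 + x$2 * x$2)) * (0 * x$1 + x$1 * 0 + (1 * x$2 + x$2 * 1)))) U"
      unfolding n divide_inverse by (rule B)
    fix x :: "real^2" assume "x \<in> U"
    define d where "d = inverse (x$1 * x$1 + x$2 * x$2)"
    have "d * (x$1 * x$1 + x$2 * x$2) = 1" using nz[OF \<open>x \<in> U\<close>] by (simp add: d_def)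
    then have "d + x$1 * (- (d * d) * (2 * x$1)) + (d + x$2 * (- (d * d) * (2 * x$2))) = 0" by algebra
    then show "1 * inverse (x$1 * x$1 + x$2 * x$2) + x$1 * (- (inverse (x$1 * x$1 + x$2 * x$2) * inverse (x$1 * x$1 + x$2 * x$2)) * (1 * x$1 + x$1 * 1 + (0 * x$2 + x$2 * 0)))
      + (1 * inverse (x$1 * x$1 + x$2 * x$2) + x$2 * (- (inverse (x$1 * x$1 + x$2 * x$2) * inverse (x$1 * x$1 + x$2 * x$2)) * (0 * x$1 + x$1 * 0 + (1 * x$2 + x$2 * 1)))) = 0"
      by (simp add: d_def algebra_simps)
  qed
qed

text \<open>If the segment from \<open>x\<close> to \<open>y\<close> avoids \<open>C\<close>, the mean value theorem applies to all of it.
  Otherwise it contains a zero \<open>p\<close> of \<open>f\<close> in \<open>C\<close>, and the two halves are estimated separately,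
  each from its end point off \<open>C\<close> to the first point of \<open>C\<close> on the way to \<open>p\<close>.\<close>
lemma lipschitz_of_zero_set:
  fixes f :: "'a::real_normed_vector \<Rightarrow> real"
  assumes L: "0 \<le> L" and cont: "continuous_on UNIV f" and C: "closed C" and zero: "\<And>x. x \<in> C \<Longrightarrow> f x = 0"
    and der: "\<And>x. x \<notin> C \<Longrightarrow> (f has_derivative f' x) (at x)" and bd: "\<And>x h. x \<notin> C \<Longrightarrow> \<bar>f' x h\<bar> \<le> L * norm h"
  shows "\<bar>f x - f y\<bar> \<le> L * norm (x - y)"
proof -
  have seg: "\<bar>f (x + T *\<^sub>R (y - x)) - f x\<bar> \<le> L * norm (x - y) * T"
    if T: "0 < T" and off: "\<And>t. 0 < t \<Longrightarrow> t < T \<Longrightarrow> x + t *\<^sub>R (y - x) \<notin> C" for x y T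
  proof -
    define k where "k = (\<lambda>t. f (x + t *\<^sub>R (y - x)))"
    have "continuous_on {0..T} k"
      unfolding k_def by (intro continuous_on_compose2[OF cont] continuous_intros) auto
    moreover have "(k has_derivative (\<lambda>\<tau>. f' (x + t *\<^sub>R (y - x)) (\<tau> *\<^sub>R (y - x)))) (at t)" if "0 < t" "t < T" for t
    proof -
      have "((\<lambda>t. x + t *\<^sub>R (y - x)) has_derivative (\<lambda>\<tau>. \<tau> *\<^sub>R (y - x))) (at t)"
        by (auto intro!: derivative_eq_intros)
      from has_derivative_compose[OF this der[OF off[OF that]]] show ?thesis unfolding k_def .
    qed
    ultimately obtain \<xi> where \<xi>: "0 < \<xi>" "\<xi> < T" "k T - k 0 = f' (x + \<xi> *\<^sub>R (y - x)) ((T - 0) *\<^sub>R (y - x))"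
      using mvt[OF T, of k "\<lambda>t \<tau>. f' (x + t *\<^sub>R (y - x)) (\<tau> *\<^sub>R (y - x))"] by blast
    then have "\<bar>k T - k 0\<bar> \<le> L * norm ((T - 0) *\<^sub>R (y - x))"
      unfolding \<xi>(3) by (intro bd off \<xi>(1,2))
    then show ?thesis using T by (simp add: k_def norm_minus_commute mult_ac)
  qed
  have to_zero: "\<bar>f x\<bar> \<le> L * norm (x - p)" if "p \<in> C" "x \<notin> C" for x p
  proof -
    \<comment> \<open>The least element of \<open>Z\<close> is the first time at which the segment enters \<open>C\<close>.\<close>
    define Z where "Z = {t \<in> {0..1}. x + t *\<^sub>R (p - x) \<in> C}"
    have "closed Z"
    proof -
      have "Z = {0..1} \<inter> (\<lambda>t. x + t *\<^sub>R (p - x)) -` C" by (auto simp: Z_def)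
      moreover have "closed ((\<lambda>t. x + t *\<^sub>R (p - x)) -` C)"
        using C by (intro closed_vimage continuous_intros)
      ultimately show ?thesis by auto
    qed
    moreover have "1 \<in> Z" "bdd_below Z" using that(1) by (auto simp: Z_def bdd_below_def)
    ultimately have InfZ: "Inf Z \<in> Z" by (intro closed_contains_Inf) auto
    define T where "T = Inf Z"
    have T: "0 \<le> T" "T \<le> 1" "x + T *\<^sub>R (p - x) \<in> C" using InfZ by (auto simp: Z_def T_def)
    have "T \<noteq> 0" using T(3) that(2) by auto
    then have "0 < T" using T by simp
    moreover have "x + t *\<^sub>R (p - x) \<notin> C" if "0 < t" "t < T" for t
    proof
      assume "x + t *\<^sub>R (p - x) \<in> C"
      then have "t \<in> Z" using that T by (auto simp: Z_def)
      then show False using cInf_lower[OF _ \<open>bdd_below Z\<close>] that by (force simp: T_def)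
    qed
    ultimately have 1: "\<bar>f x\<bar> \<le> L * norm (x - p) * T"
      using seg[of T x p] zero[OF T(3)] by simp
    have "0 \<le> L * norm (x - p)" using L by simp
    then show ?thesis using 1 T mult_left_le[of T "L * norm (x - p)"] by linarith
  qed
  have to_zero': "\<bar>f x\<bar> \<le> L * norm (x - p)" if "p \<in> C" for x p
    using to_zero[OF that, of x] zero[of x] L by (cases "x \<in> C") auto
  show ?thesis
  proof (cases "\<exists>t\<in>{0..1}. x + t *\<^sub>R (y - x) \<in> C")
    case True
    then obtain t where t: "0 \<le> t" "t \<le> 1" "x + t *\<^sub>R (y - x) \<in> C" by auto
    define p where "p = x + t *\<^sub>R (y - x)"
    have "x - p = - (t *\<^sub>R (y - x))" "y - p = (1 - t) *\<^sub>R (y - x)" by (simp_all add: p_def algebra_simps)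
    then have "norm (x - p) = t * norm (x - y)" "norm (y - p) = (1 - t) * norm (x - y)"
      using t by (simp_all add: norm_minus_commute)
    then have "norm (x - p) + norm (y - p) = norm (x - y)" by (simp add: algebra_simps)
    then have "L * norm (x - p) + L * norm (y - p) = L * norm (x - y)"
      by (simp flip: distrib_left)
    moreover have "\<bar>f x\<bar> \<le> L * norm (x - p)" "\<bar>f y\<bar> \<le> L * norm (y - p)"
      using to_zero' t(3) unfolding p_def by blast+
    ultimately show ?thesis by linarith
  next
    case False
    then show ?thesis using seg[of 1 x y] by (auto simp: abs_minus_commute)
  qed
qed

section \<open>Stream functions of spiral flows\<close>

definition C1 :: "(real^2 \<Rightarrow> real) \<Rightarrow> (real^2) set \<Rightarrow> bool" where
  "C1 f U \<longleftrightarrow> (\<exists>fx fy. C1_on f fx fy U)"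

lemma C1I: "C1_on f fx fy U \<Longrightarrow> C1 f U" by (auto simp: C1_def)

lemma C1_cong: "C1 f U \<Longrightarrow> (\<And>x. x \<in> U \<Longrightarrow> f x = k x) \<Longrightarrow> C1 k U"
  unfolding C1_def by (blast intro: C1_on_cong)

lemma C1_add: "C1 f U \<Longrightarrow> C1 k U \<Longrightarrow> C1 (\<lambda>x. f x + k x) U"
  unfolding C1_def by (blast intro: C1_on_add)

lemma C1_diff: "C1 f U \<Longrightarrow> C1 k U \<Longrightarrow> C1 (\<lambda>x. f x - k x) U"
  unfolding C1_def by (blast intro: C1_on_diff)

lemma C1_mult: "C1 f U \<Longrightarrow> C1 k U \<Longrightarrow> C1 (\<lambda>x. f x * k x) U"
  unfolding C1_def by (blast intro: C1_on_mult)

lemma C1_cmult: "C1 f U \<Longrightarrow> C1 (\<lambda>x. a * f x) U"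
  unfolding C1_def by (blast intro: C1_on_cmult)

lemma C1_uminus: "C1 f U \<Longrightarrow> C1 (\<lambda>x. - f x) U"
  using C1_cmult[of f U "-1"] by simp

lemma C1_inverse: "C1 f U \<Longrightarrow> (\<And>x. x \<in> U \<Longrightarrow> f x \<noteq> 0) \<Longrightarrow> C1 (\<lambda>x. inverse (f x)) U"
  unfolding C1_def by (blast intro: C1_on_inverse)

text \<open>What the compactness argument uses about a flow. The mass flux is the rotated gradient of
  \<open>\<Phi>\<close> plus the flux of a point source of strength \<open>2 \<pi> c\<close>; the bound for \<open>\<Phi>\<close> holds on the whole
  plane, with \<open>\<Phi>\<close> extended by zero over the obstacle; the last clause is irrotationality.\<close>
definition spiral_stream ::
  "real \<Rightarrow> (real^2) set \<Rightarrow> real \<Rightarrow> (real^2 \<Rightarrow> real) \<Rightarrow> (real^2 \<Rightarrow> real) \<Rightarrow> (real^2 \<Rightarrow> real) \<Rightarrow> (real^2 \<Rightarrow> real^2) \<Rightarrow> bool" where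
  "spiral_stream \<gamma> D c \<Phi> \<Phi>x \<Phi>y u \<longleftrightarrow>
     0 \<le> c \<and> C1_on \<Phi> \<Phi>x \<Phi>y (- closure D) \<and> C1 \<Phi>x (- closure D) \<and> C1 \<Phi>y (- closure D) \<and>
     (\<forall>x y. \<bar>\<Phi> x - \<Phi> y\<bar> \<le> (1 + c) * norm (x - y)) \<and> (\<forall>x\<in>closure D. \<Phi> x = 0) \<and>
     (\<forall>x\<in>- closure D. norm (u x) < 1 \<and>
        mass_flux \<gamma> (u x) = vector [\<Phi>y x + c * (x$1 / (norm x)\<^sup>2), - \<Phi>x x + c * (x$2 / (norm x)\<^sup>2)]) \<and>
     (\<exists>u1x u1y u2x u2y. C1_on (\<lambda>x. u x$1) u1x u1y (- closure D) \<and>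
        C1_on (\<lambda>x. u x$2) u2x u2y (- closure D) \<and> (\<forall>x\<in>- closure D. u1y x = u2x x))"

lemma psi20_has_derivative:
  assumes c: "continuous_on {1..} \<rho>b" and r: "r > 1"
  shows "(psi20 \<kappa>2 \<rho>b has_real_derivative - \<kappa>2 * (\<rho>b r / r)) (at r)"
proof -
  have "continuous_on {1..r + 1} (\<lambda>s. \<rho>b s / s)"
    using continuous_on_subset[OF c, of "{1..r + 1}"] by (intro continuous_intros) auto
  from integral_has_real_derivative[OF this, of r]
  have "((\<lambda>r. integral {1..r} (\<lambda>s. \<rho>b s / s)) has_real_derivative \<rho>b r / r) (at r within {1..r + 1})"
    using r by simp
  then have "((\<lambda>r. integral {1..r} (\<lambda>s. \<rho>b s / s)) has_real_derivative \<rho>b r / r) (at r)"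
    using r at_within_Icc_at[of 1 r "r + 1"] by simp
  from DERIV_cmult[OF this, of "- \<kappa>2"] show ?thesis by (simp add: psi20_def[abs_def])
qed

text \<open>Continuity at \<open>r = 1\<close> matters, as the boundary curve may touch the unit circle.\<close>
lemma continuous_on_psi20:
  assumes c: "continuous_on {1..} \<rho>b"
  shows "continuous_on {1..} (psi20 \<kappa>2 \<rho>b)"
proof -
  have "continuous_on {2..} (psi20 \<kappa>2 \<rho>b)"
    using DERIV_isCont[OF psi20_has_derivative[OF c]] by (intro continuous_at_imp_continuous_on) auto
  moreover have "continuous_on {1..2} (psi20 \<kappa>2 \<rho>b)"
  proof -
    have "continuous_on {1..2} (\<lambda>s. \<rho>b s / s)"
      using continuous_on_subset[OF c, of "{1..2}"] by (intro continuous_intros) auto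
    from indefinite_integral_continuous_1[OF integrable_continuous_real[OF this]] show ?thesis
      unfolding psi20_def[abs_def] by (intro continuous_intros)
  qed
  ultimately have "continuous_on ({1..2} \<union> {2..}) (psi20 \<kappa>2 \<rho>b)"
    by (intro continuous_on_closed_Un) auto
  moreover have "{1..2} \<union> {2..} = {1::real..}" by auto
  ultimately show ?thesis by simp
qed

lemma norm_grad_angle: "norm (grad_angle x) = inverse (norm x)"
proof -
  have "norm (vector [- x$2, x$1] :: real^2) = norm x" by (simp add: norm_vec2 add.commute)
  then show ?thesis by (cases "x = 0") (simp_all add: grad_angle_def power2_eq_square)
qed

lemma smooth_real_derivative:
  fixes f :: "real \<Rightarrow> real"
  assumes "smooth_on f {1<..}"
  obtains f' where "\<And>r. r > 1 \<Longrightarrow> (f has_real_derivative f' r) (at r)" "continuous_on {1<..} f'"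
proof -
  have "Ck_on (Suc 0) f {1<..}" using assms unfolding smooth_on_def by blast
  then have d: "f differentiable_on {1<..}" and c: "continuous_on {1<..} (\<lambda>x. frechet_derivative f (at x) 1)"
    by simp_all
  show ?thesis
  proof (rule that[OF _ c])
    fix r :: real assume "r > 1"
    then have *: "(f has_derivative frechet_derivative f (at r)) (at r)"
      using d differentiable_on_eq_differentiable_at[of "{1<..}" f] frechet_derivative_works by auto
    have "frechet_derivative f (at r) h = frechet_derivative f (at r) 1 * h" for h
      using linear_scale[OF has_derivative_linear[OF *], of h 1] by simp
    then have "frechet_derivative f (at r) = (*) (frechet_derivative f (at r) 1)" by (rule ext)
    with * show "(f has_real_derivative frechet_derivative f (at r) 1) (at r)"
      by (simp add: has_field_derivative_def)
  qed
qed

text \<open>The function \<open>\<Phi>\<close> is \<open>\<phi> + \<psi>\<^sub>2\<^sub>0(\<bar>x\<bar>)\<close>, extended by zero. The boundary condition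
  \<open>\<phi> = - \<psi>\<^sub>2\<^sub>0\<close> makes the extension continuous. Its gradient is \<open>\<nabla>\<psi> - c \<nabla>\<theta>\<close>, bounded by \<open>1 + c\<close>
  since \<open>\<bar>\<nabla>\<psi>\<bar> < 1\<close> and \<open>\<bar>\<nabla>\<theta>\<bar> = 1 / \<bar>x\<bar>\<close>. As \<open>u\<close> is \<open>\<nabla>\<psi> / H\<close> turned by a right angle, the
  equation for \<open>\<psi>\<close> says that \<open>u\<close> is curl-free.\<close>
lemma spiral_stream_of_flow:
  assumes ob: "obstacle D cv" and \<gamma>: "\<gamma> > 1" and fl: "uniformly_subsonic_spiral_flow D \<gamma> \<kappa>1 \<kappa>2 u"
  obtains \<Phi> \<Phi>x \<Phi>y where "\<kappa>1 > 0" "\<kappa>1\<^sup>2 + \<kappa>2\<^sup>2 < 1" "spiral_stream \<gamma> D (rho0 \<gamma> \<kappa>1 \<kappa>2 * \<kappa>1) \<Phi> \<Phi>x \<Phi>y u"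
proof -
  define c where "c = rho0 \<gamma> \<kappa>1 \<kappa>2 * \<kappa>1"
  define U where "U = - closure D"
  obtain \<rho>b U1 U2 \<phi> where bf: "background_flow \<gamma> \<kappa>1 \<kappa>2 \<rho>b U1 U2"
    and sol: "solves_problem D \<gamma> (H \<gamma>) \<kappa>1 \<kappa>2 \<rho>b \<phi>" and sm: "smooth_near \<phi> (- D)"
    and bdd: "bdd_above ((\<lambda>x. norm (grad_psi \<gamma> \<kappa>1 \<kappa>2 \<rho>b \<phi> x)) ` (- D))"
    and sup: "(SUP x\<in>- D. norm (grad_psi \<gamma> \<kappa>1 \<kappa>2 \<rho>b \<phi> x)) < 1"
    and u: "\<And>x. x \<in> - D \<Longrightarrow> u x = vector [grad_psi \<gamma> \<kappa>1 \<kappa>2 \<rho>b \<phi> x $ 2, - (grad_psi \<gamma> \<kappa>1 \<kappa>2 \<rho>b \<phi> x $ 1)]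
              /\<^sub>R H \<gamma> ((norm (grad_psi \<gamma> \<kappa>1 \<kappa>2 \<rho>b \<phi> x))\<^sup>2)"
    using fl unfolding uniformly_subsonic_spiral_flow_def Let_def by metis
  define G where "G = grad_psi \<gamma> \<kappa>1 \<kappa>2 \<rho>b \<phi>"
  define F where "F = (\<lambda>x. G x /\<^sub>R H \<gamma> ((norm (G x))\<^sup>2))"
  have k: "\<kappa>1 > 0" "\<kappa>1\<^sup>2 + \<kappa>2\<^sup>2 < 1" and \<rho>c: "continuous_on {1..} \<rho>b" and \<rho>s: "smooth_on \<rho>b {1<..}"
    using bf by (auto simp: background_flow_def)
  have c0: "0 \<le> c" using rho0_eq_g[OF \<gamma>, of \<kappa>1 \<kappa>2] g_ge_1[OF \<gamma>, of "\<kappa>1\<^sup>2 + \<kappa>2\<^sup>2"] k by (simp add: c_def)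
  have divF: "F differentiable at x" "divergence F x = 0" if "x \<in> U" for x
    using sol that by (auto simp: solves_problem_def Let_def G_def F_def U_def interior_complement)
  have bdry: "\<phi> x = - psi20 \<kappa>2 \<rho>b (norm x)" if "x \<in> frontier D" for x
    using sol that by (auto simp: solves_problem_def Let_def)
  have D: "open D" "ball 0 1 \<subseteq> D" using ob by (auto simp: obstacle_def)
  have U: "open U" "U \<subseteq> - D" using closure_subset[of D] by (auto simp: U_def)
  have nU: "1 < norm x" if "x \<in> U" for x
  proof -
    have "cball 0 1 \<subseteq> closure D" using closure_mono[OF D(2)] by simp
    then show ?thesis using that by (force simp: U_def)
  qed
  have nD: "1 \<le> norm x" if "x \<in> - D" for x using that D(2) by force
  obtain V where V: "open V" "- D \<subseteq> V" "smooth_on \<phi> V" using sm by (auto simp: smooth_near_def)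
  define px py where "px = (\<lambda>x. frechet_derivative \<phi> (at x) (axis 1 1))" and "py = (\<lambda>x. frechet_derivative \<phi> (at x) (axis 2 1))"
  have "Ck_on (Suc (Suc 0)) \<phi> V" using V(3) unfolding smooth_on_def by blast
  note P = Ck_on_1_C1_on[OF this V(1)]
  have \<phi>V: "C1_on \<phi> px py V" using P(1) by (simp add: px_def py_def)
  have UV: "U \<subseteq> V" using U V by blast
  have \<phi>U: "C1_on \<phi> px py U" by (rule C1_on_subset[OF \<phi>V U(1) UV])
  have pC: "C1 px U" "C1 py U"
    using C1_on_subset[OF Ck_on_1_C1_on(1)[OF P(2) V(1)] U(1) UV] unfolding px_def py_def by (auto intro: C1I)
  obtain \<rho>b' where \<rho>b': "\<And>r. r > 1 \<Longrightarrow> (\<rho>b has_real_derivative \<rho>b' r) (at r)" "continuous_on {1<..} \<rho>b'"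
    using smooth_real_derivative[OF \<rho>s] by metis
  define q where "q = (\<lambda>r. - \<kappa>2 * (\<rho>b r / r))"
  have "{1<..} \<subseteq> {1::real..}" by auto
  then have \<rho>c1: "continuous_on {1<..} \<rho>b" by (rule continuous_on_subset[OF \<rho>c])
  have qc: "continuous_on {1<..} q" unfolding q_def by (intro continuous_intros \<rho>c1) auto
  have sub1: "U \<subseteq> {x. 1 < norm x}" using nU by auto
  have Psi: "C1_on (\<lambda>x. psi20 \<kappa>2 \<rho>b (norm x)) (\<lambda>x. q (norm x) * (x$1 / norm x)) (\<lambda>x. q (norm x) * (x$2 / norm x)) U"
  proof (rule C1_on_subset[OF C1_on_radial[OF _ qc] U(1) sub1])
    show "(psi20 \<kappa>2 \<rho>b has_real_derivative q r) (at r)" if "r > 1" for r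
      using psi20_has_derivative[OF \<rho>c that] by (simp add: q_def)
  qed
  have qC: "C1 (\<lambda>x. q (norm x)) U"
  proof -
    have d1: "(q has_real_derivative - \<kappa>2 * ((\<rho>b' r * r - \<rho>b r) / (r * r))) (at r)" if "r > 1" for r
      unfolding q_def using DERIV_cmult[OF DERIV_divide[OF \<rho>b'(1)[OF that] DERIV_ident], of "- \<kappa>2"] that by simp
    have d2: "continuous_on {1<..} (\<lambda>r. - \<kappa>2 * ((\<rho>b' r * r - \<rho>b r) / (r * r)))"
      by (intro continuous_intros \<rho>c1 \<rho>b'(2)) auto
    show ?thesis by (rule C1I[OF C1_on_subset[OF C1_on_radial[OF d1 d2] U(1) sub1]])
  qed
  have U0: "U \<subseteq> - {0}" using nU by force
  have coordC: "C1 (\<lambda>x. x$1) U" "C1 (\<lambda>x. x$2) U" using C1_on_coords[OF U(1)] C1I by blast+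
  have nC: "C1 norm U" using C1_on_subset[OF C1_on_norm U(1) U0] C1I by blast
  have dirC: "C1 (\<lambda>x. x$i / norm x) U" for i
  proof -
    have "C1 (\<lambda>x. x$i * inverse (norm x)) U"
      using coordC U0 exhaust_2[of i] by (intro C1_mult C1_inverse nC) auto
    then show ?thesis by (simp add: divide_inverse)
  qed
  define \<Phi>0 where "\<Phi>0 = (\<lambda>x. \<phi> x + psi20 \<kappa>2 \<rho>b (norm x))"
  define \<Phi>x where "\<Phi>x = (\<lambda>x. px x + q (norm x) * (x$1 / norm x))"
  define \<Phi>y where "\<Phi>y = (\<lambda>x. py x + q (norm x) * (x$2 / norm x))"
  define \<Phi> where "\<Phi> = (\<lambda>x. if x \<in> closure D then 0 else \<Phi>0 x)"
  have \<Phi>0C: "C1_on \<Phi>0 \<Phi>x \<Phi>y U" unfolding \<Phi>0_def \<Phi>x_def \<Phi>y_def by (rule C1_on_add[OF \<phi>U Psi])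
  then have \<Phi>C: "C1_on \<Phi> \<Phi>x \<Phi>y U" by (rule C1_on_cong) (auto simp: \<Phi>_def U_def)
  have \<Phi>xC: "C1 \<Phi>x U" "C1 \<Phi>y U" unfolding \<Phi>x_def \<Phi>y_def by (intro C1_add pC C1_mult qC dirC)+
  have G_eq: "G x $ 1 = \<Phi>x x - c * (x$2 / (norm x)\<^sup>2)" "G x $ 2 = \<Phi>y x + c * (x$1 / (norm x)\<^sup>2)" if "x \<in> U" for x
    using C1_on_grad[OF \<phi>U that] nU[OF that]
    by (simp_all add: G_def grad_psi_def grad_psi0_def grad_angle_def e_r_def \<Phi>x_def \<Phi>y_def q_def c_def divide_inverse mult_ac)
  have Gn: "norm (G x) < 1" if "x \<in> - D" for x
    using cSUP_upper[OF that bdd] sup by (simp add: G_def)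
  define s where "s = (\<lambda>x. (norm (G x))\<^sup>2)"
  have s1: "s x < 1" if "x \<in> - D" for x using Gn[OF that] by (simp add: s_def abs_square_less_1)
  have H1: "H \<gamma> (s x) > 1" if "x \<in> - D" for x using H_gt_1[OF \<gamma> s1[OF that]] .
  have radC: "C1 (\<lambda>x. x$1 / (norm x)\<^sup>2) U" "C1 (\<lambda>x. x$2 / (norm x)\<^sup>2) U"
  proof -
    have "0 \<notin> U" using U0 by blast
    note R = C1_on_radial_field[OF U(1) this]
    show "C1 (\<lambda>x. x$1 / (norm x)\<^sup>2) U" by (rule R) (rule C1I)
    show "C1 (\<lambda>x. x$2 / (norm x)\<^sup>2) U" by (rule R) (rule C1I)
  qed
  have GC: "C1 (\<lambda>x. G x $ 1) U" "C1 (\<lambda>x. G x $ 2) U"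
    by (rule C1_cong[OF C1_diff[OF \<Phi>xC(1) C1_cmult[OF radC(2), of c]]], simp add: G_eq,
        rule C1_cong[OF C1_add[OF \<Phi>xC(2) C1_cmult[OF radC(1), of c]]], simp add: G_eq)
  have sC: "C1 s U"
    by (rule C1_cong[OF C1_add[OF C1_mult[OF GC(1) GC(1)] C1_mult[OF GC(2) GC(2)]]])
       (simp add: s_def norm_vec2 power2_eq_square)
  have HC: "C1 (\<lambda>x. H \<gamma> (s x)) U"
  proof -
    obtain sx sy where sxy: "C1_on s sx sy U" using sC by (auto simp: C1_def)
    show ?thesis
    proof (rule C1I[OF C1_on_compose[OF sxy H_has_derivative(1)[OF \<gamma>]]])
      show "s x < 1" if "x \<in> U" for x using s1 that U by blast
      show "continuous_on (s ` U) (\<lambda>y. inverse (momentum_sq' \<gamma> (H \<gamma> y)))"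
        by (rule continuous_on_subset[OF continuous_on_H_deriv[OF \<gamma>]]) (use s1 U in auto)
    qed
  qed
  have ueq: "u x = vector [G x $ 2, - (G x $ 1)] /\<^sub>R H \<gamma> (s x)" if "x \<in> - D" for x
    using u[OF that] by (simp add: G_def s_def)
  have IC: "C1 (\<lambda>x. inverse (H \<gamma> (s x))) U" using H1 U by (intro C1_inverse HC) fastforce
  have u1C: "C1 (\<lambda>x. u x $ 1) U" by (rule C1_cong[OF C1_mult[OF GC(2) IC]]) (use ueq U in auto)
  have u2C: "C1 (\<lambda>x. u x $ 2) U" by (rule C1_cong[OF C1_uminus[OF C1_mult[OF GC(1) IC]]]) (use ueq U in auto)
  obtain u1x u1y where u1: "C1_on (\<lambda>x. u x $ 1) u1x u1y U" using u1C by (auto simp: C1_def)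
  obtain u2x u2y where u2: "C1_on (\<lambda>x. u x $ 2) u2x u2y U" using u2C by (auto simp: C1_def)
  \<comment> \<open>The field \<open>F = \<nabla>\<psi> / H\<close> equals \<open>(- u\<^sub>2, u\<^sub>1)\<close>, so its divergence is the curl of \<open>u\<close> up to
    sign.\<close>
  have curl: "u1y x = u2x x" if x: "x \<in> U" for x
  proof -
    define F' where "F' = frechet_derivative F (at x)"
    have F': "(F has_derivative F') (at x)" using divF(1)[OF x] frechet_derivative_works unfolding F'_def by blast
    have Fi: "((\<lambda>x. F x $ i) has_derivative (\<lambda>h. h$1 *\<^sub>R (F' (axis 1 1) $ i) + h$2 *\<^sub>R (F' (axis 2 1) $ i))) (at x)" for i
    proof -
      have "F' h $ i = h$1 *\<^sub>R (F' (axis 1 1) $ i) + h$2 *\<^sub>R (F' (axis 2 1) $ i)" for h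
        using linear_real2[OF has_derivative_linear[OF F'], of h] by (metis vector_add_component vector_scaleR_component)
      then have eq: "(\<lambda>h. F' h $ i) = (\<lambda>h. h$1 *\<^sub>R (F' (axis 1 1) $ i) + h$2 *\<^sub>R (F' (axis 2 1) $ i))"
        by (rule ext)
      show ?thesis using bounded_linear.has_derivative[OF bounded_linear_vec_nth F', of i] unfolding eq .
    qed
    have Fu: "F z $ 1 = - (u z $ 2)" "F z $ 2 = u z $ 1" if "z \<in> U" for z
      using ueq[of z] that U by (auto simp: F_def s_def)
    have A: "C1_on (\<lambda>x. F x $ 1) (\<lambda>x. -1 * u2x x) (\<lambda>x. -1 * u2y x) U"
      by (rule C1_on_cong[OF C1_on_cmult[OF u2, of "-1"]]) (use Fu in auto)
    have B: "C1_on (\<lambda>x. F x $ 2) u1x u1y U"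
      by (rule C1_on_cong[OF u1]) (use Fu in auto)
    have "- u2x x = F' (axis 1 1) $ 1" using C1_on_partials_unique(1)[OF A Fi x] by simp
    moreover have "u1y x = F' (axis 2 1) $ 2" using C1_on_partials_unique(2)[OF B Fi x] .
    moreover have "F' (axis 1 1) $ 1 + F' (axis 2 1) $ 2 = 0"
      using divF(2)[OF x] by (simp add: divergence_def sum_2 F'_def)
    ultimately show ?thesis by simp
  qed
  have flux: "norm (u x) < 1 \<and> mass_flux \<gamma> (u x) = vector [\<Phi>y x + c * (x$1 / (norm x)\<^sup>2), - \<Phi>x x + c * (x$2 / (norm x)\<^sup>2)]"
    if x: "x \<in> U" for x
  proof -
    have xD: "x \<in> - D" using x U by blast
    have "norm (vector [G x $ 2, - (G x $ 1)] :: real^2) = norm (G x)" by (simp add: norm_vec2 add.commute)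
    then have nu: "norm (u x) = norm (G x) / H \<gamma> (s x)"
      using H1[OF xD] by (simp add: ueq[OF xD] divide_inverse mult.commute)
    have 1: "norm (u x) < 1" unfolding nu using H1[OF xD] Gn[OF xD] by simp
    have "(norm (u x))\<^sup>2 = s x / (H \<gamma> (s x))\<^sup>2" unfolding nu by (simp add: s_def power_divide)
    then have "g \<gamma> ((norm (u x))\<^sup>2) = H \<gamma> (s x)" using H_eq_g[OF \<gamma>, of "s x"] s1[OF xD] by simp
    then have "mass_flux \<gamma> (u x) = vector [G x $ 2, - (G x $ 1)]"
      unfolding mass_flux_def using H1[OF xD] by (simp add: ueq[OF xD])
    then show ?thesis using 1 G_eq[OF x] by simp
  qed
  have frz: "\<Phi>0 x = 0" if "x \<in> closure D" "x \<in> - D" for x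
  proof -
    have "x \<in> frontier D" using that D(1) by (simp add: frontier_def interior_open)
    then show ?thesis using bdry by (simp add: \<Phi>0_def)
  qed
  have cont0: "continuous_on (- D) \<Phi>0"
    unfolding \<Phi>0_def using nD
    by (intro continuous_on_add continuous_on_subset[OF C1_onD(4)[OF \<phi>V] V(2)] continuous_on_compose2[OF continuous_on_psi20[OF \<rho>c]] continuous_intros) auto
  have "continuous_on (closure D \<union> - D) \<Phi>"
    unfolding \<Phi>_def by (rule continuous_on_cases) (use D(1) cont0 frz in auto)
  moreover have "closure D \<union> - D = UNIV" using closure_subset[of D] by auto
  ultimately have cont: "continuous_on UNIV \<Phi>" by simp
  have bound: "\<bar>h$1 *\<^sub>R \<Phi>x x + h$2 *\<^sub>R \<Phi>y x\<bar> \<le> (1 + c) * norm h" if x: "x \<notin> closure D" for x and h :: "real^2"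
  proof -
    have xU: "x \<in> U" using x by (simp add: U_def)
    define w :: "real^2" where "w = vector [\<Phi>x x, \<Phi>y x]"
    \<comment> \<open>\<open>w\<close> is the gradient of \<open>\<Phi>\<close>; the point lies outside the unit disc, where the angle has
      gradient at most 1.\<close>
    have "w = G x - c *\<^sub>R grad_angle x"
      using G_eq[OF xU] by (simp add: w_def vec_eq_iff forall_2 grad_angle_def divide_inverse mult_ac)
    then have "norm w \<le> norm (G x) + norm (c *\<^sub>R grad_angle x)" by (metis norm_triangle_ineq4)
    also have "\<dots> \<le> 1 + c * 1"
    proof -
      have "inverse (norm x) \<le> 1" using nU[OF xU] by (simp add: inverse_le_1_iff)
      then have "c * inverse (norm x) \<le> c * 1" using c0 by (rule mult_left_mono)
      then show ?thesis using Gn[of x] xU U c0 by (auto simp: norm_grad_angle)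
    qed
    finally have w: "norm w \<le> 1 + c" by simp
    have "h$1 *\<^sub>R \<Phi>x x + h$2 *\<^sub>R \<Phi>y x = h \<bullet> w" by (simp add: w_def inner_vec_def sum_2)
    also have "\<bar>\<dots>\<bar> \<le> norm h * norm w" by (rule Cauchy_Schwarz_ineq2)
    also have "\<dots> \<le> norm h * (1 + c)" using w by (intro mult_left_mono) auto
    finally show ?thesis by (simp add: mult.commute)
  qed
  have lip: "\<bar>\<Phi> x - \<Phi> y\<bar> \<le> (1 + c) * norm (x - y)" for x y
  proof (rule lipschitz_of_zero_set[OF _ cont closed_closure, of "1 + c" D "\<lambda>x h. h$1 *\<^sub>R \<Phi>x x + h$2 *\<^sub>R \<Phi>y x"])
    show "(\<Phi> has_derivative (\<lambda>h. h$1 *\<^sub>R \<Phi>x x + h$2 *\<^sub>R \<Phi>y x)) (at x)" if "x \<notin> closure D" for x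
      using C1_onD(5)[OF \<Phi>C, of x] that by (simp add: U_def)
  qed (use c0 bound in \<open>auto simp: \<Phi>_def\<close>)
  have ex: "\<exists>u1x u1y u2x u2y. C1_on (\<lambda>x. u x$1) u1x u1y U \<and> C1_on (\<lambda>x. u x$2) u2x u2y U \<and> (\<forall>x\<in>U. u1y x = u2x x)"
    using u1 u2 curl by blast
  have z: "\<forall>x\<in>closure D. \<Phi> x = 0" by (simp add: \<Phi>_def)
  have "spiral_stream \<gamma> D c \<Phi> \<Phi>x \<Phi>y u"
    unfolding spiral_stream_def U_def[symmetric]
    using c0 \<Phi>C \<Phi>xC lip flux z ex by blast
  then show thesis using that k by (simp add: c_def)
qed

section \<open>Weak form of the flow equations\<close>

lemma test_function_C1:
  assumes "test_function U v"
  obtains vx vy vxx vxy vyx vyy where "C1_test U v vx vy" "\<And>x. grad v x = vector [vx x, vy x]"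
    "C1_test U vx vxx vxy" "C1_test U vy vyx vyy"
proof -
  define vx vy where "vx = (\<lambda>x. frechet_derivative v (at x) (axis 1 1))" and "vy = (\<lambda>x. frechet_derivative v (at x) (axis 2 1))"
  have "Ck_on (Suc (Suc 0)) v UNIV" using assms unfolding test_function_def smooth_on_def by blast
  note P = Ck_on_1_C1_on[OF this open_UNIV]
  have v: "C1_on v vx vy UNIV" using P(1) by (simp add: vx_def vy_def)
  have vx: "C1_on vx (\<lambda>x. frechet_derivative vx (at x) (axis 1 1)) (\<lambda>x. frechet_derivative vx (at x) (axis 2 1)) UNIV"
    using Ck_on_1_C1_on(1)[OF P(2)[of "axis 1 1"] open_UNIV] by (simp add: vx_def)
  have vy: "C1_on vy (\<lambda>x. frechet_derivative vy (at x) (axis 1 1)) (\<lambda>x. frechet_derivative vy (at x) (axis 2 1)) UNIV"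
    using Ck_on_1_C1_on(1)[OF P(2)[of "axis 2 1"] open_UNIV] by (simp add: vy_def)
  define K where "K = closure {x. v x \<noteq> 0}"
  have K: "compact K" "K \<subseteq> U" using assms by (auto simp: test_function_def K_def)
  have z: "v x = 0" if "x \<notin> K" for x using that closure_subset by (force simp: K_def)
  have "C1_test K v vx vy" using v K z by (auto simp: C1_test_def)
  from C1_test_support[OF this] obtain K' where "K' \<subseteq> K" "\<And>x. x \<notin> K' \<Longrightarrow> v x = 0 \<and> vx x = 0 \<and> vy x = 0" by metis
  then have "vx x = 0" "vy x = 0" if "x \<notin> K" for x using that by blast+
  then show thesis
    using that[of vx vy, OF _ _ _ _] v vx vy K z C1_on_grad[OF v] unfolding C1_test_def by (metis UNIV_I)
qed

lemma pressure_C1_on: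
  assumes \<gamma>: "\<gamma> > 1" and u1: "C1_on (\<lambda>x. u x $ 1) u1x u1y U" and u2: "C1_on (\<lambda>x. u x $ 2) u2x u2y U"
    and sub: "\<And>x. x \<in> U \<Longrightarrow> norm (u x :: real^2) < 1"
  shows "C1_on (\<lambda>x. g \<gamma> ((norm (u x))\<^sup>2) powr \<gamma> / \<gamma>)
    (\<lambda>x. - g \<gamma> ((norm (u x))\<^sup>2) * (u x $ 1 * u1x x + u x $ 2 * u2x x))
    (\<lambda>x. - g \<gamma> ((norm (u x))\<^sup>2) * (u x $ 1 * u1y x + u x $ 2 * u2y x)) U"
proof -
  note S = C1_on_add[OF C1_on_mult[OF u1 u1] C1_on_mult[OF u2 u2]]
  have n: "(norm (u x))\<^sup>2 = u x $ 1 * u x $ 1 + u x $ 2 * u x $ 2" for x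
    by (simp add: norm_vec2 power2_eq_square)
  have le: "u x $ 1 * u x $ 1 + u x $ 2 * u x $ 2 \<le> 1" if "x \<in> U" for x
    using sq_le_1[of "u x"] sub[OF that] unfolding n by simp
  have "C1_on (\<lambda>x. g \<gamma> ((norm (u x))\<^sup>2) powr \<gamma> / \<gamma>)
     (\<lambda>x. - (g \<gamma> ((norm (u x))\<^sup>2) / 2) * (u1x x * u x $ 1 + u x $ 1 * u1x x + (u2x x * u x $ 2 + u x $ 2 * u2x x)))
     (\<lambda>x. - (g \<gamma> ((norm (u x))\<^sup>2) / 2) * (u1y x * u x $ 1 + u x $ 1 * u1y x + (u2y x * u x $ 2 + u x $ 2 * u2y x))) U"
    unfolding n
  proof (rule C1_on_compose[OF S pressure_has_derivative[OF \<gamma> le]])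
    have "continuous_on {..1} (\<lambda>s. - (g \<gamma> s / 2))" using continuous_on_g[OF \<gamma>] by (intro continuous_intros) auto
    then show "continuous_on ((\<lambda>x. u x $ 1 * u x $ 1 + u x $ 2 * u x $ 2) ` U) (\<lambda>s. - (g \<gamma> s / 2))"
      by (rule continuous_on_subset) (use le in auto)
  qed
  then show ?thesis by (rule C1_on_cong) (simp_all add: algebra_simps)
qed

text \<open>Mass is conserved because rotated gradients are divergence-free by symmetry of the mixed
  partial derivatives, and so is the radial field. The momentum equations combine this with
  irrotationality and \<open>dp = - \<rho> d(q\<^sup>2 / 2)\<close>.\<close>
lemma spiral_stream_weak_equations:
  assumes st: "spiral_stream \<gamma> D c \<Phi> \<Phi>x \<Phi>y u" and \<gamma>: "\<gamma> > 1" and D: "0 \<in> D" and v: "C1_test (- closure D) v vx vy"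
  shows "(LINT x|lebesgue_on (- closure D). mass_flux \<gamma> (u x) $ 1 * vx x + mass_flux \<gamma> (u x) $ 2 * vy x) = 0"
    and "(LINT x|lebesgue_on (- closure D). (mass_flux \<gamma> (u x) $ 1 * u x $ 1 + g \<gamma> ((norm (u x))\<^sup>2) powr \<gamma> / \<gamma>) * vx x
        + (mass_flux \<gamma> (u x) $ 2 * u x $ 1) * vy x) = 0"
    and "(LINT x|lebesgue_on (- closure D). (mass_flux \<gamma> (u x) $ 1 * u x $ 2) * vx x
        + (mass_flux \<gamma> (u x) $ 2 * u x $ 2 + g \<gamma> ((norm (u x))\<^sup>2) powr \<gamma> / \<gamma>) * vy x) = 0"
    and "(LINT x|lebesgue_on (- closure D). - (u x $ 2) * vx x + u x $ 1 * vy x) = 0"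
proof -
  define U where "U = - closure D"
  note st' = st[unfolded spiral_stream_def U_def[symmetric]]
  have U: "open U" "0 \<notin> U" using D closure_subset[of D] by (auto simp: U_def)
  have \<Phi>: "C1_on \<Phi> \<Phi>x \<Phi>y U" using st' by blast
  obtain \<Phi>xx \<Phi>xy where \<Phi>x: "C1_on \<Phi>x \<Phi>xx \<Phi>xy U" using st' by (auto simp: C1_def)
  obtain \<Phi>yx \<Phi>yy where \<Phi>y: "C1_on \<Phi>y \<Phi>yx \<Phi>yy U" using st' by (auto simp: C1_def)
  obtain u1x u1y u2x u2y where u1: "C1_on (\<lambda>x. u x$1) u1x u1y U" and u2: "C1_on (\<lambda>x. u x$2) u2x u2y U"
    and curl: "\<And>x. x \<in> U \<Longrightarrow> u1y x = u2x x" using st' by blast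
  have sub: "norm (u x) < 1" if "x \<in> U" for x using st' that by blast
  have flux: "mass_flux \<gamma> (u x) = vector [\<Phi>y x + c * (x$1 / (norm x)\<^sup>2), - \<Phi>x x + c * (x$2 / (norm x)\<^sup>2)]" if "x \<in> U" for x
    using st' that by blast
  have "\<exists>ax ay bx b'. C1_on (\<lambda>x. x$1 / (norm x)\<^sup>2) ax ay U \<and> C1_on (\<lambda>x. x$2 / (norm x)\<^sup>2) bx b' U
      \<and> (\<forall>x\<in>U. ax x + b' x = 0)"
    by (rule C1_on_radial_field[OF U]) (intro exI conjI ballI)
  then obtain ax ay bx b' where a: "C1_on (\<lambda>x. x$1 / (norm x)\<^sup>2) ax ay U" and b: "C1_on (\<lambda>x. x$2 / (norm x)\<^sup>2) bx b' U"
    and ab: "\<And>x. x \<in> U \<Longrightarrow> ax x + b' x = 0"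
    by blast
  have m1: "C1_on (\<lambda>x. mass_flux \<gamma> (u x) $ 1) (\<lambda>x. \<Phi>yx x + c * ax x) (\<lambda>x. \<Phi>yy x + c * ay x) U"
    by (rule C1_on_cong[OF C1_on_add[OF \<Phi>y C1_on_cmult[OF a, of c]]]) (simp_all add: flux)
  have m2: "C1_on (\<lambda>x. mass_flux \<gamma> (u x) $ 2) (\<lambda>x. -1 * \<Phi>xx x + c * bx x) (\<lambda>x. -1 * \<Phi>xy x + c * b' x) U"
    by (rule C1_on_cong[OF C1_on_add[OF C1_on_cmult[OF \<Phi>x, of "-1"] C1_on_cmult[OF b, of c]]]) (simp_all add: flux)
  have div: "(\<Phi>yx x + c * ax x) + (-1 * \<Phi>xy x + c * b' x) = 0" if "x \<in> U" for x
  proof -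
    have "c * ax x + c * b' x = 0" using ab[OF that] by (simp flip: distrib_left)
    then show ?thesis using mixed_partials_eq[OF \<Phi> \<Phi>x \<Phi>y that] by simp
  qed
  have mu: "mass_flux \<gamma> (u x) $ i = g \<gamma> ((norm (u x))\<^sup>2) * u x $ i" for x i by (simp add: mass_flux_def)
  note p = pressure_C1_on[OF \<gamma> u1 u2 sub]
  note v' = v[folded U_def]
  show "(LINT x|lebesgue_on (- closure D). mass_flux \<gamma> (u x) $ 1 * vx x + mass_flux \<gamma> (u x) $ 2 * vy x) = 0"
    using divergence_free_weak[OF m1 m2 div v'] by (simp only: U_def)
  have "(LINT x|lebesgue_on U. (mass_flux \<gamma> (u x) $ 1 * u x $ 1 + g \<gamma> ((norm (u x))\<^sup>2) powr \<gamma> / \<gamma>) * vx x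
        + (mass_flux \<gamma> (u x) $ 2 * u x $ 1) * vy x) = 0"
  proof (rule divergence_free_weak[OF C1_on_add[OF C1_on_mult[OF m1 u1] p] C1_on_mult[OF m2 u1] _ v'])
    fix x assume x: "x \<in> U"
    define A B C E w1 w2 where "A = \<Phi>yx x + c * ax x" and "B = -1 * \<Phi>xy x + c * b' x" and "C = u1x x" and "E = u2x x"
      and "w1 = u x $ 1" and "w2 = u x $ 2"
    have "A + B = 0" using div[OF x] by (simp add: A_def B_def)
    then have "A * w1 + B * w1 = 0" by (simp flip: distrib_right)
    then show "(\<Phi>yx x + c * ax x) * u x $ 1 + mass_flux \<gamma> (u x) $ 1 * u1x x + - g \<gamma> ((norm (u x))\<^sup>2) * (u x $ 1 * u1x x + u x $ 2 * u2x x)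
      + ((-1 * \<Phi>xy x + c * b' x) * u x $ 1 + mass_flux \<gamma> (u x) $ 2 * u1y x) = 0"
      unfolding curl[OF x] mu A_def[symmetric] B_def[symmetric] C_def[symmetric] E_def[symmetric] w1_def[symmetric] w2_def[symmetric]
      by (simp add: algebra_simps)
  qed
  then show "(LINT x|lebesgue_on (- closure D). (mass_flux \<gamma> (u x) $ 1 * u x $ 1 + g \<gamma> ((norm (u x))\<^sup>2) powr \<gamma> / \<gamma>) * vx x
        + (mass_flux \<gamma> (u x) $ 2 * u x $ 1) * vy x) = 0" by (simp only: U_def)
  have "(LINT x|lebesgue_on U. (mass_flux \<gamma> (u x) $ 1 * u x $ 2) * vx x
        + (mass_flux \<gamma> (u x) $ 2 * u x $ 2 + g \<gamma> ((norm (u x))\<^sup>2) powr \<gamma> / \<gamma>) * vy x) = 0"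
  proof (rule divergence_free_weak[OF C1_on_mult[OF m1 u2] C1_on_add[OF C1_on_mult[OF m2 u2] p] _ v'])
    fix x assume x: "x \<in> U"
    define A B C E w1 w2 where "A = \<Phi>yx x + c * ax x" and "B = -1 * \<Phi>xy x + c * b' x" and "C = u2x x" and "E = u2y x"
      and "w1 = u x $ 1" and "w2 = u x $ 2"
    have "A + B = 0" using div[OF x] by (simp add: A_def B_def)
    then have "A * w2 + B * w2 = 0" by (simp flip: distrib_right)
    then show "(\<Phi>yx x + c * ax x) * u x $ 2 + mass_flux \<gamma> (u x) $ 1 * u2x x
      + ((-1 * \<Phi>xy x + c * b' x) * u x $ 2 + mass_flux \<gamma> (u x) $ 2 * u2y x
      + - g \<gamma> ((norm (u x))\<^sup>2) * (u x $ 1 * u1y x + u x $ 2 * u2y x)) = 0"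
      unfolding curl[OF x] mu A_def[symmetric] B_def[symmetric] C_def[symmetric] E_def[symmetric] w1_def[symmetric] w2_def[symmetric]
      by (simp add: algebra_simps)
  qed
  then show "(LINT x|lebesgue_on (- closure D). (mass_flux \<gamma> (u x) $ 1 * u x $ 2) * vx x
        + (mass_flux \<gamma> (u x) $ 2 * u x $ 2 + g \<gamma> ((norm (u x))\<^sup>2) powr \<gamma> / \<gamma>) * vy x) = 0" by (simp only: U_def)
  have m2u: "C1_on (\<lambda>x. - (u x $ 2)) (\<lambda>x. -1 * u2x x) (\<lambda>x. -1 * u2y x) U"
    by (rule C1_on_cong[OF C1_on_cmult[OF u2, of "-1"]]) auto
  have "(LINT x|lebesgue_on U. - (u x $ 2) * vx x + u x $ 1 * vy x) = 0"
    by (rule divergence_free_weak[OF m2u u1 _ v']) (simp add: curl)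
  then show "(LINT x|lebesgue_on (- closure D). - (u x $ 2) * vx x + u x $ 1 * vy x) = 0" by (simp only: U_def)
qed

text \<open>Lebesgue measure is complete, so two functions that agree almost everywhere are both
  measurable or both not; in the second case both integrals are 0 by convention.\<close>
lemma integral_lebesgue_cong_AE:
  fixes f k :: "'a::euclidean_space \<Rightarrow> 'b::euclidean_space"
  assumes "AE x in lebesgue. f x = k x"
  shows "(LINT x|lebesgue. f x) = (LINT x|lebesgue. k x)"
proof (cases "f \<in> borel_measurable lebesgue")
  case True
  then show ?thesis using borel_measurable_AE[OF True assms] assms by (intro integral_cong_AE)
next
  case False
  moreover have "k \<notin> borel_measurable lebesgue"
  proof
    assume "k \<in> borel_measurable lebesgue"
    moreover have "AE x in lebesgue. k x = f x" using assms by eventually_elim simp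
    ultimately show False using borel_measurable_AE False by blast
  qed
  ultimately show ?thesis
    by (metis borel_measurable_integrable not_integrable_integral_eq)
qed

text \<open>The factor \<open>f\<close> may grow linearly; it is bounded where \<open>k\<close> lives.\<close>
lemma lipschitz_mult_compact_support:
  fixes f k :: "'a::real_normed_vector \<Rightarrow> real"
  assumes f: "\<And>x y. \<bar>f x - f y\<bar> \<le> A * norm (x - y)" and k: "\<And>x y. \<bar>k x - k y\<bar> \<le> B * norm (x - y)"
    and kb: "\<And>x. \<bar>k x\<bar> \<le> M" and supp: "\<And>x. R < norm x \<Longrightarrow> k x = 0" and pos: "0 \<le> A" "0 \<le> B" "0 \<le> R"
  shows "\<bar>f x * k x - f y * k y\<bar> \<le> (A * M + (\<bar>f 0\<bar> + A * R) * B) * norm (x - y)"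
proof -
  have fb: "\<bar>f x\<bar> \<le> \<bar>f 0\<bar> + A * R" if "norm x \<le> R" for x
    using f[of x 0] mult_left_mono[OF that pos(1)] by simp
  have main: "\<bar>f x * k x - f y * k y\<bar> \<le> (A * M + (\<bar>f 0\<bar> + A * R) * B) * norm (x - y)" if "norm y \<le> R" for x y
  proof -
    have "f x * k x - f y * k y = (f x - f y) * k x + f y * (k x - k y)" by (simp add: algebra_simps)
    also have "\<bar>\<dots>\<bar> \<le> \<bar>f x - f y\<bar> * \<bar>k x\<bar> + \<bar>f y\<bar> * \<bar>k x - k y\<bar>"
      by (rule order_trans[OF abs_triangle_ineq]) (simp add: abs_mult)
    also have "\<dots> \<le> (A * norm (x - y)) * M + (\<bar>f 0\<bar> + A * R) * (B * norm (x - y))"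
      using fb[OF that] pos by (intro add_mono mult_mono f k kb) auto
    finally show ?thesis by (simp add: algebra_simps)
  qed
  show ?thesis
  proof (cases "norm y \<le> R")
    case True then show ?thesis by (rule main)
  next
    case False
    show ?thesis
    proof (cases "norm x \<le> R")
      case True
      then show ?thesis using main[of x y] by (simp add: abs_minus_commute norm_minus_commute)
    next
      case False
      have "0 \<le> M" using kb[of x] by linarith
      then show ?thesis using False \<open>\<not> norm y \<le> R\<close> supp pos by simp
    qed
  qed
qed

text \<open>The product of \<open>\<Phi>\<close> with a derivative of \<open>v\<close> is Lipschitz with compact support, and
  differentiable off the boundary curve, which is a null set. So its derivatives integrate to
  zero, and as the mixed derivatives of \<open>v\<close> cancel, the rotated gradient of \<open>\<Phi>\<close> drops out.\<close>
lemma spiral_stream_normal_trace: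
  assumes st: "spiral_stream \<gamma> D c \<Phi> \<Phi>x \<Phi>y u" and D: "open D" "0 \<in> D" and null: "frontier D \<in> null_sets lebesgue"
    and v: "C1_test UNIV v vx vy" and vx: "C1_test UNIV vx vxx vxy" and vy: "C1_test UNIV vy vyx vyy"
  shows "(LINT x|lebesgue_on (- closure D). mass_flux \<gamma> (u x) $ 1 * vx x + mass_flux \<gamma> (u x) $ 2 * vy x)
    = c * (LINT x|lebesgue_on (- D). (x$1 * vx x + x$2 * vy x) / (norm x)\<^sup>2)"
proof -
  define U where "U = - closure D"
  note st' = st[unfolded spiral_stream_def U_def[symmetric]]
  have U: "open U" unfolding U_def by (rule open_Compl) simp
  have c: "0 \<le> c" and \<Phi>: "C1_on \<Phi> \<Phi>x \<Phi>y U" and lip: "\<And>x y. \<bar>\<Phi> x - \<Phi> y\<bar> \<le> (1 + c) * norm (x - y)"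
    and \<Phi>0: "\<And>x. x \<in> closure D \<Longrightarrow> \<Phi> x = 0"
    and flux: "\<And>x. x \<in> U \<Longrightarrow> mass_flux \<gamma> (u x) = vector [\<Phi>y x + c * (x$1 / (norm x)\<^sup>2), - \<Phi>x x + c * (x$2 / (norm x)\<^sup>2)]"
    using st' by blast+
  have frontier: "x \<in> D \<or> x \<in> U" if "x \<notin> frontier D" for x
    using that closure_Un_frontier[of D] by (auto simp: U_def)
  have derAE: "AE x in lebesgue. (\<Phi> has_derivative (\<lambda>h. h$1 *\<^sub>R (indicator U x * \<Phi>x x) + h$2 *\<^sub>R (indicator U x * \<Phi>y x))) (at x)"
    using AE_not_in[OF null]
  proof eventually_elim
    case (elim x)
    then consider "x \<in> D" | "x \<in> U" using frontier by blast
    then show ?case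
    proof cases
      case 1
      have "((\<lambda>_. 0::real) has_derivative (\<lambda>h. 0)) (at x)" by simp
      then have "(\<Phi> has_derivative (\<lambda>h. 0)) (at x)"
        by (rule has_derivative_transform_within_open[OF _ D(1) 1]) (use \<Phi>0 closure_subset[of D] in auto)
      moreover have "x \<notin> U" using 1 closure_subset[of D] by (auto simp: U_def)
      ultimately show ?thesis by simp
    next
      case 2
      then show ?thesis using C1_onD(5)[OF \<Phi> 2] by simp
    qed
  qed
  have prod: "integrable lebesgue (\<lambda>x. indicator U x * \<Phi>x x * k x + \<Phi> x * kx x)"
    "integrable lebesgue (\<lambda>x. indicator U x * \<Phi>y x * k x + \<Phi> x * ky x)"
    "(LINT x|lebesgue. indicator U x * \<Phi>x x * k x + \<Phi> x * kx x) = 0"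
    "(LINT x|lebesgue. indicator U x * \<Phi>y x * k x + \<Phi> x * ky x) = 0"
    if k: "C1_test UNIV k kx ky" for k kx ky
  proof -
    obtain S where S: "compact S" "\<And>x. x \<notin> S \<Longrightarrow> k x = 0 \<and> kx x = 0 \<and> ky x = 0"
      using C1_test_support[OF k] by metis
    obtain R where R: "R > 0" "\<And>x. x \<in> S \<Longrightarrow> norm x \<le> R"
      using S(1) compact_imp_bounded by (metis bounded_pos)
    have supp: "k x = 0" if "R < norm x" for x using S(2)[of x] R(2)[of x] that by (cases "x \<in> S") auto
    obtain L where L: "L \<ge> 0" "\<And>x y. \<bar>k x - k y\<bar> \<le> L * norm (x - y)" "\<And>x. \<bar>k x\<bar> \<le> L"
      using C1_test_lipschitz[OF k] by metis
    have lp: "norm (\<Phi> x * k x - \<Phi> y * k y) \<le> ((1 + c) * L + (\<bar>\<Phi> 0\<bar> + (1 + c) * R) * L) * norm (x - y)" for x y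
      unfolding real_norm_def using c L(1) R(1)
      by (intro lipschitz_mult_compact_support[OF lip L(2,3) supp]) auto
    have z: "\<Phi> x * k x = 0" if "R < norm x" for x using supp[OF that] by simp
    define f' where "f' = (\<lambda>x (h::real^2). \<Phi> x * (h$1 *\<^sub>R kx x + h$2 *\<^sub>R ky x)
        + (h$1 *\<^sub>R (indicator U x * \<Phi>x x) + h$2 *\<^sub>R (indicator U x * \<Phi>y x)) * k x)"
    have "AE x in lebesgue. ((\<lambda>x. \<Phi> x * k x) has_derivative f' x) (at x)"
      using derAE
    proof eventually_elim
      case (elim x)
      have "C1_on k kx ky UNIV" using k by (simp add: C1_test_def)
      from has_derivative_mult[OF elim C1_onD(5)[OF this, of x]] show ?case by (simp add: f'_def)
    qed
    note I = integral_derivative_eq_0[OF lp z this]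
    have "f' x (axis 1 1) = indicator U x * \<Phi>x x * k x + \<Phi> x * kx x"
      "f' x (axis 2 1) = indicator U x * \<Phi>y x * k x + \<Phi> x * ky x" for x
      by (simp_all add: f'_def axis_def)
    with I[where e="axis 1 1"] I[where e="axis 2 1"] show
      "integrable lebesgue (\<lambda>x. indicator U x * \<Phi>x x * k x + \<Phi> x * kx x)"
      "integrable lebesgue (\<lambda>x. indicator U x * \<Phi>y x * k x + \<Phi> x * ky x)"
      "(LINT x|lebesgue. indicator U x * \<Phi>x x * k x + \<Phi> x * kx x) = 0"
      "(LINT x|lebesgue. indicator U x * \<Phi>y x * k x + \<Phi> x * ky x) = 0" by simp_all
  qed
  have mixed: "vxy x = vyx x" for x
    using mixed_partials_eq[of v vx vy UNIV vxx vxy vyx vyy x] v vx vy by (simp add: C1_test_def)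
  \<comment> \<open>The terms with second derivatives of \<open>v\<close> cancel when the two identities are subtracted.\<close>
  have eq: "indicator U x * (\<Phi>y x * vx x - \<Phi>x x * vy x)
      = (indicator U x * \<Phi>y x * vx x + \<Phi> x * vxy x) - (indicator U x * \<Phi>x x * vy x + \<Phi> x * vyx x)" for x
    by (simp add: mixed algebra_simps)
  have stream: "(LINT x|lebesgue. indicator U x * (\<Phi>y x * vx x - \<Phi>x x * vy x)) = 0"
    and stream_int: "integrable lebesgue (\<lambda>x. indicator U x * (\<Phi>y x * vx x - \<Phi>x x * vy x))"
    unfolding eq using prod[OF vx] prod[OF vy] by (simp_all add: Bochner_Integration.integral_diff)
  define r where "r = (\<lambda>x::real^2. (x$1 * vx x + x$2 * vy x) / (norm x)\<^sup>2)"
  have r_int: "integrable (lebesgue_on (- D)) r"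
  proof -
    obtain S where S: "compact S" "\<And>x. x \<notin> S \<Longrightarrow> v x = 0 \<and> vx x = 0 \<and> vy x = 0"
      using C1_test_support[OF v] by metis
    have "C1_on v vx vy UNIV" using v by (simp add: C1_test_def)
    then have vc: "continuous_on T vx" "continuous_on T vy" for T
      using C1_onD(2,3) continuous_on_subset by blast+
    have "continuous_on (S \<inter> - D) r"
      unfolding r_def using D(2) by (intro continuous_intros vc) auto
    moreover have "compact (S \<inter> - D)" using S(1) D(1) by (intro compact_Int_closed) auto
    moreover have "- D \<in> sets lebesgue" using D(1) by auto
    ultimately show ?thesis
      using S(2) by (intro integrable_continuous_compact_support[of "S \<inter> - D"]) (auto simp: r_def)
  qed
  have UD: "AE x in lebesgue. indicat_real U x = indicator (- D) x"
    using AE_not_in[OF null]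
  proof eventually_elim
    case (elim x)
    then show ?case using frontier[OF elim] closure_subset[of D] by (auto simp: U_def indicator_def)
  qed
  have rU: "integrable lebesgue (\<lambda>x. indicator (- D) x * r x)"
    using r_int D(1) by (subst (asm) integrable_restrict_space) auto
  have "(LINT x|lebesgue_on U. mass_flux \<gamma> (u x) $ 1 * vx x + mass_flux \<gamma> (u x) $ 2 * vy x)
      = (LINT x|lebesgue. indicator U x * (mass_flux \<gamma> (u x) $ 1 * vx x + mass_flux \<gamma> (u x) $ 2 * vy x))"
    using U by (subst integral_restrict_space) auto
  also have "\<dots> = (LINT x|lebesgue. indicator U x * (\<Phi>y x * vx x - \<Phi>x x * vy x) + c * (indicator (- D) x * r x))"
  proof (rule integral_lebesgue_cong_AE)
    show "AE x in lebesgue. indicator U x * (mass_flux \<gamma> (u x) $ 1 * vx x + mass_flux \<gamma> (u x) $ 2 * vy x)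
      = indicator U x * (\<Phi>y x * vx x - \<Phi>x x * vy x) + c * (indicator (- D) x * r x)"
      using UD
    proof eventually_elim
      case (elim x)
      show ?case
        unfolding elim[symmetric]
        by (cases "x \<in> U") (simp_all add: flux r_def algebra_simps add_divide_distrib)
    qed
  qed
  also have "\<dots> = c * (LINT x|lebesgue. indicator (- D) x * r x)"
    using stream stream_int rU by (subst Bochner_Integration.integral_add) auto
  also have "(LINT x|lebesgue. indicator (- D) x * r x) = (LINT x|lebesgue_on (- D). r x)"
    using D(1) by (subst integral_restrict_space) auto
  finally show ?thesis by (simp add: U_def r_def)
qed

section \<open>The Cauchy-Pompeiu formula\<close>

text \<open>Points of the plane as complex numbers, for which winding numbers are defined.\<close>
definition zc :: "real^2 \<Rightarrow> complex" where "zc x = Complex (x$1) (x$2)"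

lemma zc_simps [simp]: "Re (zc x) = x$1" "Im (zc x) = x$2" "zc 0 = 0"
  "zc (x + y) = zc x + zc y" "zc (x - y) = zc x - zc y" "zc (- x) = - zc x" "zc (r *\<^sub>R x) = r *\<^sub>R zc x"
  by (simp_all add: zc_def complex_eq_iff)

lemma norm_zc [simp]: "norm (zc x) = norm x"
  by (simp add: cmod_def norm_vec_def L2_set_def sum_2)

lemma inj_zc: "inj zc"
  by (rule injI) (simp add: zc_def vec_eq_iff forall_2)

lemma surj_zc: "surj zc"
  by (rule surjI[of _ "\<lambda>z. vector [Re z, Im z]"]) (simp add: zc_def)

lemma zc_eq_iff [simp]: "zc x = zc y \<longleftrightarrow> x = y"
  using inj_zc by (simp add: inj_eq)

lemma zc_eq_0_iff [simp]: "zc x = 0 \<longleftrightarrow> x = 0"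
  using zc_eq_iff[of x 0] by (simp del: zc_eq_iff)

lemma bounded_linear_zc: "bounded_linear zc"
  by (rule bounded_linear_intro[of _ 1]) auto

lemma continuous_on_zc [continuous_intros]:
  "continuous_on S f \<Longrightarrow> continuous_on S (\<lambda>x. zc (f x))"
  by (rule bounded_linear.continuous_on[OF bounded_linear_zc])

lemma zc_measurable [measurable]: "zc \<in> borel_measurable borel"
  by (intro borel_measurable_continuous_onI continuous_intros)

text \<open>Dyadic decomposition: the integrand is at most \<open>2 \<cdot> 2\<^sup>k\<close> where \<open>2\<^sup>-\<^sup>k\<^sup>-\<^sup>1 \<le> \<bar>w\<bar> < 2\<^sup>-\<^sup>k\<close>,
  and the disc of radius \<open>2\<^sup>-\<^sup>k\<close> has area \<open>\<pi> 4\<^sup>-\<^sup>k\<close>.\<close>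
lemma nn_integral_inverse_norm_finite:
  "(\<integral>\<^sup>+w. ennreal (indicator (ball 0 1) w / norm (w::real^2)) \<partial>lborel) < \<infinity>"
proof -
  have le: "ennreal (indicator (ball 0 1) w / norm w)
      \<le> (\<Sum>k. ennreal (2 * 2 ^ k) * indicator (ball 0 ((1/2) ^ k)) w)" for w :: "real^2"
  proof (cases "w = 0 \<or> norm w \<ge> 1")
    case True
    then have "indicator (ball 0 1) w / norm w = (0::real)" by (auto simp: indicator_def)
    then show ?thesis by (simp only: ennreal_0 zero_le)
  next
    case False
    have "0 < norm w" using False by simp
    from real_arch_pow_inv[OF this, of "1/2"] obtain n where "(1/2) ^ n < norm w" by auto
    then have n: "(1/2) ^ n \<le> norm w" by (rule less_imp_le)
    \<comment> \<open>The point lies in the dyadic annulus between the radii \<open>2\<^sup>-\<^sup>k\<close> and \<open>2\<^sup>-\<^sup>k\<^sup>+\<^sup>1\<close>.\<close>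
    define k where "k = (LEAST n. (1/2) ^ n \<le> norm w)"
    have k: "(1/2) ^ k \<le> norm w"
      unfolding k_def using n by (rule LeastI)
    have "k \<noteq> 0" using k False by (intro notI) simp
    then obtain j where j: "k = Suc j" using not0_implies_Suc by blast
    have j2: "norm w < (1/2) ^ j"
      using not_less_Least[of j "\<lambda>n. (1/2) ^ n \<le> norm w"] j by (auto simp: k_def)
    have "1 / norm w \<le> 2 * 2 ^ j"
      using k False by (simp add: j field_simps power_one_over)
    then have "ennreal (indicator (ball 0 1) w / norm w) \<le> ennreal (2 * 2 ^ j) * indicator (ball 0 ((1/2) ^ j)) w"
      using j2 False by (simp add: ennreal_leI)
    also have "\<dots> \<le> (\<Sum>k. ennreal (2 * 2 ^ k) * indicator (ball 0 ((1/2) ^ k)) w)"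
    proof -
      have "F j \<le> suminf F" for F :: "nat \<Rightarrow> ennreal"
        using sum_le_suminf[OF summableI, of "{j}" F] by simp
      then show ?thesis .
    qed
    finally show ?thesis .
  qed
  have "(\<integral>\<^sup>+w. ennreal (indicator (ball 0 1) w / norm (w::real^2)) \<partial>lborel)
      \<le> (\<integral>\<^sup>+w. (\<Sum>k. ennreal (2 * 2 ^ k) * indicator (ball 0 ((1/2) ^ k)) (w::real^2)) \<partial>lborel)"
    by (intro nn_integral_mono le)
  also have "\<dots> = (\<Sum>k. \<integral>\<^sup>+w. ennreal (2 * 2 ^ k) * indicator (ball 0 ((1/2) ^ k)) (w::real^2) \<partial>lborel)"
    by (rule nn_integral_suminf) (intro borel_measurable_times_ennreal borel_measurable_const borel_measurable_indicator, simp)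
  also have "\<dots> = (\<Sum>k. ennreal (2 * pi * (1/2) ^ k))"
  proof (rule suminf_cong)
    fix k
    have "(\<integral>\<^sup>+w. ennreal (2 * 2 ^ k) * indicator (ball 0 ((1/2) ^ k)) (w::real^2) \<partial>lborel)
        = ennreal (2 * 2 ^ k) * ennreal (pi * ((1/2) ^ k)\<^sup>2)"
      by (subst nn_integral_cmult_indicator) (auto simp: emeasure_ball unit_ball_vol_2)
    also have "\<dots> = ennreal (2 * pi * (1/2) ^ k)"
      by (simp add: ennreal_mult[symmetric] power2_eq_square power_one_over)
    finally show "(\<integral>\<^sup>+w. ennreal (2 * 2 ^ k) * indicator (ball 0 ((1/2) ^ k)) (w::real^2) \<partial>lborel)
        = ennreal (2 * pi * (1/2) ^ k)" .
  qed
  also have "\<dots> < \<infinity>"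
  proof -
    have "summable (\<lambda>k. 2 * pi * (1/2) ^ k :: real)" by (intro summable_mult summable_geometric) simp
    then have "(\<Sum>k. ennreal (2 * pi * (1/2) ^ k)) \<noteq> top" by (rule ennreal_suminf_neq_top) simp
    then show ?thesis by (simp only: less_top infinity_ennreal_def)
  qed
  finally show ?thesis .
qed

text \<open>The singularity contributes the same amount wherever it sits. Uniformity in \<open>z\<close> makes the
  Cauchy kernel integrable on the product of a curve with a disc.\<close>
lemma nn_integral_inverse_dist_bounded:
  obtains C :: real where "C \<ge> 0"
    "\<And>z. (\<integral>\<^sup>+w. ennreal (indicator (cball 0 R) w / norm (w - z :: real^2)) \<partial>lborel) \<le> ennreal C"
proof -
  have m: "(\<lambda>w::real^2. indicat_real (ball 0 1) w / norm w) \<in> borel_measurable borel"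
    by (intro borel_measurable_divide borel_measurable_indicator) auto
  let ?J = "\<integral>\<^sup>+w. ennreal (indicator (ball 0 1) w / norm (w::real^2)) \<partial>lborel"
  have fin: "emeasure lborel (cball 0 R :: (real^2) set) + ?J < \<infinity>"
    using nn_integral_inverse_norm_finite emeasure_lborel_cball_finite[of "0::real^2" R] by (simp only: ennreal_add_less_top infinity_ennreal_def)
  have "(\<integral>\<^sup>+w. ennreal (indicator (cball 0 R) w / norm (w - z)) \<partial>lborel) \<le> emeasure lborel (cball 0 R :: (real^2) set) + ?J"
    for z :: "real^2"
  proof -
    have "ennreal (indicator (cball 0 R) w / norm (w - z))
        \<le> indicator (cball 0 R) w + ennreal (indicator (ball 0 1) (- z + w) / norm (- z + w))" for w
      by (cases "norm (w - z) < 1")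
         (auto simp: indicator_def ennreal_leI divide_le_eq simp flip: ennreal_1)
    then have "(\<integral>\<^sup>+w. ennreal (indicator (cball 0 R) w / norm (w - z)) \<partial>lborel)
        \<le> (\<integral>\<^sup>+w. indicator (cball 0 R) w + ennreal (indicator (ball 0 1) (- z + w) / norm (- z + w)) \<partial>lborel)"
      by (intro nn_integral_mono)
    also have "\<dots> = emeasure lborel (cball 0 R :: (real^2) set)
        + (\<integral>\<^sup>+w. ennreal (indicator (ball 0 1) (- z + w) / norm (- z + w)) \<partial>lborel)"
      using measurable_compose[OF _ m, of "(+) (- z)" borel]
      by (subst nn_integral_add) (auto intro: borel_measurable_indicator)
    also have "(\<integral>\<^sup>+w. ennreal (indicator (ball 0 1) (- z + w) / norm (- z + w)) \<partial>lborel)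
        = (\<integral>\<^sup>+w. ennreal (indicator (ball 0 1) w / norm w) \<partial>distr lborel borel ((+) (- z)))"
      using m by (subst nn_integral_distr) auto
    also have "\<dots> = ?J" by (simp only: lborel_distr_plus)
    finally show ?thesis .
  qed
  then show ?thesis
    using that[of "enn2real (emeasure lborel (cball 0 R :: (real^2) set) + ?J)"] fin
    by (simp only: ennreal_enn2real infinity_ennreal_def enn2real_nonneg)
qed

text \<open>The Cauchy kernel \<open>1 / z\<close>, continued into the disc of radius \<open>\<epsilon>\<close> with a frozen
  denominator, so that it becomes Lipschitz.\<close>
definition cauchy_reg :: "real \<Rightarrow> complex \<Rightarrow> complex" where
  "cauchy_reg \<epsilon> z = cnj z /\<^sub>R (max (norm z) \<epsilon>)\<^sup>2"

lemma cauchy_reg_outside: "\<epsilon> \<le> norm z \<Longrightarrow> cauchy_reg \<epsilon> z = inverse z"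
  by (simp add: cauchy_reg_def max_absorb1 complex_eq_iff cmod_power2 divide_inverse)

lemma cauchy_reg_inside: "norm z \<le> \<epsilon> \<Longrightarrow> cauchy_reg \<epsilon> z = cnj z /\<^sub>R \<epsilon>\<^sup>2"
  by (simp add: cauchy_reg_def max_absorb2)

lemma norm_cauchy_reg: "\<epsilon> > 0 \<Longrightarrow> norm (cauchy_reg \<epsilon> z) \<le> inverse (norm z)" "\<epsilon> > 0 \<Longrightarrow> norm (cauchy_reg \<epsilon> z) \<le> inverse \<epsilon>"
proof -
  assume e: "\<epsilon> > 0"
  define m where "m = max (norm z) \<epsilon>"
  have m: "m \<ge> norm z" "m \<ge> \<epsilon>" "m > 0" using e by (auto simp: m_def)
  have n: "norm (cauchy_reg \<epsilon> z) = norm z / m\<^sup>2"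
    by (simp add: cauchy_reg_def m_def divide_inverse mult.commute)
  have "norm z / m\<^sup>2 \<le> m / m\<^sup>2" using m by (intro divide_right_mono) auto
  also have "\<dots> = inverse m" using m by (simp add: power2_eq_square divide_inverse)
  finally have 1: "norm z / m\<^sup>2 \<le> inverse m" .
  show "norm (cauchy_reg \<epsilon> z) \<le> inverse \<epsilon>"
    unfolding n using 1 m e le_imp_inverse_le[of \<epsilon> m] by linarith
  show "norm (cauchy_reg \<epsilon> z) \<le> inverse (norm z)"
  proof (cases "z = 0")
    case False
    then have "inverse m \<le> inverse (norm z)" using m by (intro le_imp_inverse_le) auto
    then show ?thesis unfolding n using 1 by linarith
  qed (simp add: cauchy_reg_def)
qed

lemma cauchy_reg_lipschitz:
  assumes "\<epsilon> > 0"
  shows "norm (cauchy_reg \<epsilon> z - cauchy_reg \<epsilon> w) \<le> 3 / \<epsilon>\<^sup>2 * norm (z - w)"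
proof -
  have mixed: "norm (cauchy_reg \<epsilon> z - cauchy_reg \<epsilon> w) \<le> 3 / \<epsilon>\<^sup>2 * norm (z - w)"
    if "norm z \<le> \<epsilon>" "\<epsilon> \<le> norm w" for z w
  proof -
    define b where "b = norm w"
    have b: "b \<ge> \<epsilon>" "b > 0" using that assms by (auto simp: b_def)
    have w: "cauchy_reg \<epsilon> w = cnj w /\<^sub>R b\<^sup>2" using that by (simp add: cauchy_reg_def b_def max_absorb1)
    have "cauchy_reg \<epsilon> z - cauchy_reg \<epsilon> w = cnj (z - w) /\<^sub>R \<epsilon>\<^sup>2 + (inverse (\<epsilon>\<^sup>2) - inverse (b\<^sup>2)) *\<^sub>R cnj w"
      using that by (simp add: cauchy_reg_inside w algebra_simps)
    also have "norm \<dots> \<le> norm (z - w) / \<epsilon>\<^sup>2 + \<bar>inverse (\<epsilon>\<^sup>2) - inverse (b\<^sup>2)\<bar> * b"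
      by (rule order_trans[OF norm_triangle_ineq]) (simp add: b_def divide_inverse norm_minus_commute mult.commute flip: complex_cnj_diff)
    also have "\<bar>inverse (\<epsilon>\<^sup>2) - inverse (b\<^sup>2)\<bar> * b = (b - \<epsilon>) * (b + \<epsilon>) / (\<epsilon>\<^sup>2 * b)"
    proof -
      have "inverse (b\<^sup>2) \<le> inverse (\<epsilon>\<^sup>2)" using b assms by (intro le_imp_inverse_le power_mono) auto
      then show ?thesis using b assms by (simp add: field_simps power2_eq_square)
    qed
    also have "\<dots> \<le> 2 / \<epsilon>\<^sup>2 * (b - \<epsilon>)"
    proof -
      have "(b - \<epsilon>) * (b + \<epsilon>) / (\<epsilon>\<^sup>2 * b) \<le> (b - \<epsilon>) * (2 * b) / (\<epsilon>\<^sup>2 * b)"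
        using b assms by (intro divide_right_mono mult_left_mono) auto
      also have "\<dots> = 2 / \<epsilon>\<^sup>2 * (b - \<epsilon>)" using b assms by (simp add: field_simps)
      finally show ?thesis .
    qed
    also have "b - \<epsilon> \<le> norm (z - w)"
      using that norm_triangle_ineq2[of w z] by (simp add: b_def norm_minus_commute)
    finally show ?thesis
      using assms by (simp add: field_simps)
  qed
  consider "norm z \<le> \<epsilon>" "\<epsilon> \<le> norm w" | "norm w \<le> \<epsilon>" "\<epsilon> \<le> norm z"
    | "norm z \<le> \<epsilon>" "norm w \<le> \<epsilon>" | "\<epsilon> \<le> norm z" "\<epsilon> \<le> norm w" by linarith
  then show ?thesis
  proof cases
    case 1 then show ?thesis by (rule mixed)
  next
    case 2 then show ?thesis using mixed[of w z] by (simp add: norm_minus_commute)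
  next
    case 3
    then have "norm (cauchy_reg \<epsilon> z - cauchy_reg \<epsilon> w) = norm (z - w) / \<epsilon>\<^sup>2"
      by (simp add: cauchy_reg_inside divide_inverse mult.commute flip: scaleR_diff_right complex_cnj_diff)
    also have "\<dots> \<le> 3 / \<epsilon>\<^sup>2 * norm (z - w)" by (simp add: divide_right_mono)
    finally show ?thesis .
  next
    case 4
    then have nz: "z \<noteq> 0" "w \<noteq> 0" using assms by auto
    have "norm (cauchy_reg \<epsilon> z - cauchy_reg \<epsilon> w) = norm (z - w) / (norm z * norm w)"
      using 4 nz by (simp add: cauchy_reg_outside inverse_diff_inverse norm_mult norm_inverse norm_minus_commute divide_inverse mult_ac)
    also have "\<dots> \<le> norm (z - w) / (\<epsilon> * \<epsilon>)"
      using 4 assms nz by (intro divide_left_mono mult_mono) auto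
    also have "\<dots> \<le> 3 / \<epsilon>\<^sup>2 * norm (z - w)" by (simp add: divide_right_mono power2_eq_square)
    finally show ?thesis .
  qed
qed

lemma measure_ball2: "r \<ge> 0 \<Longrightarrow> measure lebesgue (ball (z::real^2) r) = pi * r\<^sup>2"
  by (simp add: measure_completion content_ball unit_ball_vol_2)

text \<open>The operator \<open>\<partial>\<^sub>x + \<i> \<partial>\<^sub>y\<close> maps the product of \<open>v\<close> and the kernel to a function with
  integral zero. It annihilates the holomorphic kernel outside the disc, and inside it maps the
  kernel to the constant \<open>2 / \<epsilon>\<^sup>2\<close>.\<close>
lemma cauchy_pompeiu_regularised:
  assumes v: "C1_test UNIV v vx vy" and e: "\<epsilon> > 0"
  shows "(LINT w|lebesgue. (of_real (vx w) + \<i> * of_real (vy w)) * cauchy_reg \<epsilon> (zc (w - z)))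
    = - (2 / \<epsilon>\<^sup>2) * of_real (LINT w|lebesgue. indicator (ball z \<epsilon>) w * v w)"
proof -
  define K where "K = (\<lambda>w. cauchy_reg \<epsilon> (zc (w - z)))"
  define Kd where "Kd = (\<lambda>w h. if norm (w - z) < \<epsilon> then cnj (zc h) /\<^sub>R \<epsilon>\<^sup>2
    else - (inverse (zc (w - z)) * zc h * inverse (zc (w - z))))"
  have vC: "C1_on v vx vy UNIV" using v by (simp add: C1_test_def)
  obtain S where S: "compact S" "\<And>x. x \<notin> S \<Longrightarrow> v x = 0 \<and> vx x = 0 \<and> vy x = 0"
    using C1_test_support[OF v] by metis
  obtain R where R: "\<And>x. x \<in> S \<Longrightarrow> norm x \<le> R"
    using S(1) compact_imp_bounded by (metis bounded_iff)
  obtain L where L: "L \<ge> 0" "\<And>x y. \<bar>v x - v y\<bar> \<le> L * norm (x - y)" "\<And>x. \<bar>v x\<bar> \<le> L"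
    using C1_test_lipschitz[OF v] by metis
  have Kder: "(K has_derivative Kd w) (at w)" if w: "w \<notin> sphere z \<epsilon>" for w
  proof (cases "norm (w - z) < \<epsilon>")
    case True
    show ?thesis
    proof (rule has_derivative_transform_within_open)
      show "((\<lambda>w. cnj (zc (w - z)) /\<^sub>R \<epsilon>\<^sup>2) has_derivative Kd w) (at w)"
        using True unfolding Kd_def
        by (auto intro!: derivative_eq_intros bounded_linear.has_derivative[OF bounded_linear_cnj]
            bounded_linear.has_derivative[OF bounded_linear_zc] simp del: zc_simps)
      show "w \<in> ball z \<epsilon>" using True by (simp add: dist_norm norm_minus_commute)
      show "cnj (zc (x - z)) /\<^sub>R \<epsilon>\<^sup>2 = K x" if "x \<in> ball z \<epsilon>" for x
        using that unfolding K_def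
        by (subst cauchy_reg_inside) (simp_all del: zc_simps add: dist_norm norm_minus_commute)
    qed simp
  next
    case False
    then have F: "norm (w - z) > \<epsilon>" using w by (simp add: dist_norm norm_minus_commute)
    show ?thesis
    proof (rule has_derivative_transform_within_open)
      have "((\<lambda>w. zc (w - z)) has_derivative zc) (at w)"
        by (auto intro!: derivative_eq_intros bounded_linear.has_derivative[OF bounded_linear_zc] simp del: zc_simps)
      moreover have "zc (w - z) \<noteq> 0" using F e by (auto simp del: zc_simps)
      ultimately have "((\<lambda>w. inverse (zc (w - z))) has_derivative
          (\<lambda>h. - (inverse (zc (w - z)) * zc h * inverse (zc (w - z))))) (at w)"
        by (rule Deriv.has_derivative_inverse[rotated])
      then show "((\<lambda>w. inverse (zc (w - z))) has_derivative Kd w) (at w)"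
        using F unfolding Kd_def by (simp del: zc_simps)
      show "w \<in> - cball z \<epsilon>" using F by (simp add: dist_norm norm_minus_commute)
      show "inverse (zc (x - z)) = K x" if "x \<in> - cball z \<epsilon>" for x
        using that unfolding K_def
        by (subst cauchy_reg_outside) (simp_all del: zc_simps add: dist_norm norm_minus_commute)
    qed auto
  qed
  have Klip: "norm (K x - K y) \<le> 3 / \<epsilon>\<^sup>2 * norm (x - y)" for x y
  proof -
    have "norm (zc (x - z) - zc (y - z)) = norm (x - y)"
      by (simp del: zc_simps(5) add: zc_simps(5)[symmetric])
    then show ?thesis
      using cauchy_reg_lipschitz[OF e, of "zc (x - z)" "zc (y - z)"] by (simp add: K_def del: zc_simps)
  qed
  have Kb: "norm (K x) \<le> inverse \<epsilon>" for x
    unfolding K_def by (rule norm_cauchy_reg(2)[OF e])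
  have lip: "norm (v x *\<^sub>R K x - v y *\<^sub>R K y) \<le> (L * inverse \<epsilon> + L * (3 / \<epsilon>\<^sup>2)) * norm (x - y)" for x y
  proof -
    have "v x *\<^sub>R K x - v y *\<^sub>R K y = (v x - v y) *\<^sub>R K x + v y *\<^sub>R (K x - K y)"
      by (simp add: algebra_simps)
    also have "norm \<dots> \<le> \<bar>v x - v y\<bar> * norm (K x) + \<bar>v y\<bar> * norm (K x - K y)"
      by (rule order_trans[OF norm_triangle_ineq]) simp
    also have "\<dots> \<le> (L * norm (x - y)) * inverse \<epsilon> + L * (3 / \<epsilon>\<^sup>2 * norm (x - y))"
      using L Kb Klip by (intro add_mono mult_mono) auto
    finally show ?thesis by (simp add: algebra_simps)
  qed
  define f' where "f' = (\<lambda>w h. v w *\<^sub>R Kd w h + (h$1 *\<^sub>R vx w + h$2 *\<^sub>R vy w) *\<^sub>R K w)"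
  have der: "AE w in lebesgue. ((\<lambda>w. v w *\<^sub>R K w) has_derivative f' w) (at w)"
  proof -
    have "sphere z \<epsilon> \<in> null_sets lebesgue"
      using negligible_sphere[of z \<epsilon>] negligible_iff_null_sets by blast
    from AE_not_in[OF this] show ?thesis
    proof eventually_elim
      case (elim w)
      show ?case
        unfolding f'_def using C1_onD(5)[OF vC, of w]
        by (intro has_derivative_scaleR Kder[OF elim]) auto
    qed
  qed
  have z0: "v x *\<^sub>R K x = 0" if "R < norm x" for x
    using R[of x] S(2)[of x] that by (cases "x \<in> S") auto
  note D = integral_derivative_eq_0[OF lip z0 der]
  have sum: "f' w (axis 1 1) + \<i> * f' w (axis 2 1)
      = (of_real (vx w) + \<i> * of_real (vy w)) * K w + of_real (2 / \<epsilon>\<^sup>2 * (indicator (ball z \<epsilon>) w * v w))" for w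
  proof -
    have ax: "zc (axis 1 1) = 1" "zc (axis 2 1) = \<i>" by (auto simp: complex_eq_iff axis_def)
    have "Kd w (axis 1 1) + \<i> * Kd w (axis 2 1) = of_real (2 / \<epsilon>\<^sup>2 * indicator (ball z \<epsilon>) w)"
      unfolding Kd_def ax
      by (auto simp: dist_norm norm_minus_commute scaleR_conv_of_real algebra_simps divide_inverse simp del: zc_simps)
    moreover have "f' w (axis 1 1) + \<i> * f' w (axis 2 1) = of_real (v w) * (Kd w (axis 1 1) + \<i> * Kd w (axis 2 1))
        + (of_real (vx w) + \<i> * of_real (vy w)) * K w"
      unfolding f'_def by (simp add: axis_def scaleR_conv_of_real algebra_simps)
    ultimately show ?thesis by (simp add: algebra_simps)
  qed
  have ib: "integrable lebesgue (\<lambda>w. indicator (ball z \<epsilon>) w * v w)"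
    using integrable_mult_indicator[of "ball z \<epsilon>" lebesgue v] C1_test_integrable(1)[OF v]
    by (simp add: lebesgue_on_UNIV_eq)
  have "(LINT w|lebesgue. f' w (axis 1 1) + \<i> * f' w (axis 2 1)) = 0"
    using D by (subst Bochner_Integration.integral_add) auto
  moreover have "integrable lebesgue (\<lambda>w. f' w (axis 1 1) + \<i> * f' w (axis 2 1))"
    using D(1) by (intro Bochner_Integration.integrable_add integrable_mult_right) auto
  ultimately have 1: "integrable lebesgue (\<lambda>w. (of_real (vx w) + \<i> * of_real (vy w)) * K w + of_real (2 / \<epsilon>\<^sup>2 * (indicator (ball z \<epsilon>) w * v w)))"
    and 2: "(LINT w|lebesgue. (of_real (vx w) + \<i> * of_real (vy w)) * K w + of_real (2 / \<epsilon>\<^sup>2 * (indicator (ball z \<epsilon>) w * v w))) = 0"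
    unfolding sum by auto
  have i2: "integrable lebesgue (\<lambda>w. of_real (2 / \<epsilon>\<^sup>2 * (indicator (ball z \<epsilon>) w * v w)) :: complex)"
    by (intro integrable_of_real integrable_mult_right ib)
  have "integrable lebesgue (\<lambda>w. (of_real (vx w) + \<i> * of_real (vy w)) * K w)"
    using Bochner_Integration.integrable_diff[OF 1 i2] by simp
  from 2[unfolded Bochner_Integration.integral_add[OF this i2]]
  have "(LINT w|lebesgue. (of_real (vx w) + \<i> * of_real (vy w)) * K w)
      = - of_real (LINT w|lebesgue. 2 / \<epsilon>\<^sup>2 * (indicator (ball z \<epsilon>) w * v w))"
    by (simp add: eq_neg_iff_add_eq_0 del: of_real_mult)
  also have "(LINT w|lebesgue. 2 / \<epsilon>\<^sup>2 * (indicator (ball z \<epsilon>) w * v w)) = 2 / \<epsilon>\<^sup>2 * (LINT w|lebesgue. indicator (ball z \<epsilon>) w * v w)"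
    by (rule integral_mult_right_zero)
  finally show ?thesis by (simp add: K_def)
qed

text \<open>The limit \<open>\<epsilon> \<rightarrow> 0\<close> of the regularised formula: dominated convergence on the left, with a
  multiple of \<open>1 / \<bar>w - z\<bar>\<close> as majorant, and averages of \<open>v\<close> over shrinking discs on the right.\<close>
lemma cauchy_pompeiu:
  assumes v: "C1_test UNIV v vx vy"
  shows "integrable lebesgue (\<lambda>w. (of_real (vx w) + \<i> * of_real (vy w)) / zc (w - z))" (is "integrable _ ?G")
    and "(LINT w|lebesgue. (of_real (vx w) + \<i> * of_real (vy w)) / zc (w - z)) = - (2 * pi) * v z"
proof -
  define F where "F = (\<lambda>w. of_real (vx w) + \<i> * of_real (vy w) :: complex)"
  have vC: "C1_on v vx vy UNIV" using v by (simp add: C1_test_def)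
  obtain S where S: "compact S" "\<And>x. x \<notin> S \<Longrightarrow> v x = 0 \<and> vx x = 0 \<and> vy x = 0"
    using C1_test_support[OF v] by metis
  obtain R where R: "\<And>x. x \<in> S \<Longrightarrow> norm x \<le> R"
    using S(1) compact_imp_bounded by (metis bounded_iff)
  obtain L where L: "L \<ge> 0" "\<And>x y. \<bar>v x - v y\<bar> \<le> L * norm (x - y)" "\<And>x. \<bar>vx x\<bar> \<le> L" "\<And>x. \<bar>vy x\<bar> \<le> L"
    using C1_test_lipschitz[OF v] by metis
  have Fm: "F \<in> borel_measurable borel"
    unfolding F_def using C1_onD(2,3)[OF vC]
    by (intro borel_measurable_continuous_onI continuous_intros) auto
  have Fb: "norm (F w) \<le> 2 * L * indicator (cball 0 R) w" for w
  proof (cases "w \<in> S")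
    case True
    have "norm (F w) \<le> \<bar>vx w\<bar> + \<bar>vy w\<bar>"
      unfolding F_def by (rule order_trans[OF norm_triangle_ineq]) (simp add: norm_mult)
    then show ?thesis using L(3,4)[of w] R[OF True] by simp
  next
    case False
    then show ?thesis using S(2)[of w] L(1) by (simp add: F_def)
  qed
  obtain C where C: "(\<integral>\<^sup>+w. ennreal (indicator (cball 0 R) w / norm (w - z)) \<partial>lborel) \<le> ennreal C"
    using nn_integral_inverse_dist_bounded[of R] by metis
  define d where "d = (\<lambda>w. 2 * L * (indicator (cball 0 R) w / norm (w - z)))"
  have dm: "(\<lambda>w. indicator (cball 0 R) w / norm (w - z) :: real) \<in> borel_measurable borel"
    by (intro borel_measurable_divide borel_measurable_indicator borel_measurable_continuous_onI continuous_intros) auto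
  have "integrable lborel (\<lambda>w. indicator (cball 0 R) w / norm (w - z) :: real)"
    using C dm by (intro integrableI_bounded) (auto simp: top.not_eq_extremum order_le_less_trans ennreal_less_top)
  then have dint: "integrable lebesgue d"
    unfolding d_def by (intro integrable_mult_right) (simp add: integrable_completion)
  define \<epsilon> where "\<epsilon> = (\<lambda>n. inverse (real (Suc n)))"
  have e: "\<epsilon> n > 0" for n by (simp add: \<epsilon>_def)
  have e0: "\<epsilon> \<longlonglongrightarrow> 0" unfolding \<epsilon>_def by (rule LIMSEQ_inverse_real_of_nat)
  define k where "k = (\<lambda>n w. F w * cauchy_reg (\<epsilon> n) (zc (w - z)))"
  have crm: "continuous_on UNIV (cauchy_reg (\<epsilon> n))" for n
    using cauchy_reg_lipschitz[OF e[of n]]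
    by (intro lipschitz_on_continuous_on[of "3 / (\<epsilon> n)\<^sup>2"] lipschitz_onI) (auto simp: dist_norm)
  have km: "k n \<in> borel_measurable lebesgue" for n
  proof -
    have "continuous_on UNIV (\<lambda>w. cauchy_reg (\<epsilon> n) (zc (w - z)))"
      by (rule continuous_on_compose2[OF crm]) (auto intro!: continuous_intros simp del: zc_simps)
    then have "k n \<in> borel_measurable borel"
      unfolding k_def by (intro borel_measurable_times[OF Fm] borel_measurable_continuous_onI)
    then show ?thesis by (simp add: measurable_completion)
  qed
  have Gm: "(\<lambda>w. F w / zc (w - z)) \<in> borel_measurable lebesgue"
  proof -
    have "(\<lambda>w. F w / zc (w - z)) \<in> borel_measurable borel"
      by (intro borel_measurable_divide[OF Fm] borel_measurable_continuous_onI continuous_intros)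
    then show ?thesis by (simp add: measurable_completion)
  qed
  have kb: "AE w in lebesgue. norm (k n w) \<le> d w" for n
  proof (rule AE_I2)
    fix w
    have "norm (k n w) \<le> (2 * L * indicator (cball 0 R) w) * inverse (norm (zc (w - z)))"
      unfolding k_def norm_mult using L(1)
      by (intro mult_mono Fb norm_cauchy_reg e) auto
    then show "norm (k n w) \<le> d w" by (simp add: d_def divide_inverse del: zc_simps)
  qed
  have kl: "AE w in lebesgue. (\<lambda>n. k n w) \<longlonglongrightarrow> F w / zc (w - z)"
  proof -
    have "AE w in lebesgue. w \<noteq> z"
      by (intro AE_completion AE_lborel_singleton)
    then show ?thesis
    proof eventually_elim
      case (elim w)
      have "eventually (\<lambda>n. \<epsilon> n < norm (w - z)) sequentially"
        using e0 elim by (intro order_tendstoD) auto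
      then have "eventually (\<lambda>n. F w / zc (w - z) = k n w) sequentially"
        unfolding k_def
        by eventually_elim (subst cauchy_reg_outside, simp_all add: divide_inverse del: zc_simps)
      then show ?case
        by (rule Lim_transform_eventually[OF tendsto_const])
    qed
  qed
  show "integrable lebesgue ?G"
    using integrable_dominated_convergence[OF Gm km dint kl kb] by (simp add: F_def)
  have lim1: "(\<lambda>n. LINT w|lebesgue. k n w) \<longlonglongrightarrow> (LINT w|lebesgue. F w / zc (w - z))"
    by (rule integral_dominated_convergence[OF Gm km dint kl kb])
  have "norm ((LINT w|lebesgue. k n w) - (- (2 * pi) * v z)) \<le> 2 * pi * L * \<epsilon> n" for n
  proof -
    have lb: "ball z (\<epsilon> n) \<in> lmeasurable" by simp
    have i1: "integrable lebesgue (\<lambda>w. indicator (ball z (\<epsilon> n)) w * v w)"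
      using integrable_mult_indicator[of "ball z (\<epsilon> n)" lebesgue v] C1_test_integrable(1)[OF v]
      by (simp add: lebesgue_on_UNIV_eq)
    have i3: "integrable lebesgue (indicat_real (ball z (\<epsilon> n)))"
      using lb by (intro integrable_real_indicator) (auto simp: fmeasurable_def)
    have m: "(LINT w|lebesgue. indicat_real (ball z (\<epsilon> n)) w) = pi * (\<epsilon> n)\<^sup>2"
      using measure_ball2[of "\<epsilon> n" z] less_imp_le[OF e[of n]] by simp
    have "(LINT w|lebesgue. indicator (ball z (\<epsilon> n)) w * v w) - v z * (pi * (\<epsilon> n)\<^sup>2)
        = (LINT w|lebesgue. indicator (ball z (\<epsilon> n)) w * v w - v z * indicator (ball z (\<epsilon> n)) w)"
      using i1 i3 m by (subst Bochner_Integration.integral_diff) auto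
    also have "\<bar>\<dots>\<bar> \<le> (LINT w|lebesgue. (L * \<epsilon> n) * indicator (ball z (\<epsilon> n)) w)"
    proof (rule integral_abs_bound_integral)
      show "\<bar>indicator (ball z (\<epsilon> n)) w * v w - v z * indicator (ball z (\<epsilon> n)) w\<bar> \<le> (L * \<epsilon> n) * indicator (ball z (\<epsilon> n)) w" for w
      proof (cases "w \<in> ball z (\<epsilon> n)")
        case True
        then have "norm (w - z) \<le> \<epsilon> n" by (simp add: dist_norm norm_minus_commute)
        then have "L * norm (w - z) \<le> L * \<epsilon> n" using L(1) by (rule mult_left_mono)
        then show ?thesis using L(2)[of w z] True by simp
      qed simp
    qed (use i1 i3 in auto)
    also have "\<dots> = L * \<epsilon> n * (pi * (\<epsilon> n)\<^sup>2)" using m by simp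
    finally have "\<bar>(LINT w|lebesgue. indicator (ball z (\<epsilon> n)) w * v w) - v z * (pi * (\<epsilon> n)\<^sup>2)\<bar> \<le> L * \<epsilon> n * (pi * (\<epsilon> n)\<^sup>2)" .
    from mult_left_mono[OF this, of "2 / (\<epsilon> n)\<^sup>2"]
    have A: "2 / (\<epsilon> n)\<^sup>2 * \<bar>(LINT w|lebesgue. indicator (ball z (\<epsilon> n)) w * v w) - v z * (pi * (\<epsilon> n)\<^sup>2)\<bar> \<le> 2 * pi * L * \<epsilon> n"
      using e[of n] by (simp add: field_simps)
    have eq: "(LINT w|lebesgue. k n w) - (- (2 * pi) * v z)
        = - of_real (2 / (\<epsilon> n)\<^sup>2 * ((LINT w|lebesgue. indicator (ball z (\<epsilon> n)) w * v w) - v z * (pi * (\<epsilon> n)\<^sup>2)))"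
      using e[of n] unfolding k_def F_def cauchy_pompeiu_regularised[OF v e]
      by (simp add: field_simps)
    show ?thesis
      unfolding eq norm_minus_cancel norm_of_real abs_mult using A by simp
  qed
  then have "eventually (\<lambda>n. norm ((LINT w|lebesgue. k n w) - (- (2 * pi) * v z)) \<le> 2 * pi * L * \<epsilon> n) sequentially"
    by (intro always_eventually allI)
  from Lim_null_comparison[OF this tendsto_mult_right_zero[OF e0]]
  have "(\<lambda>n. (LINT w|lebesgue. k n w) - (- (2 * pi) * v z)) \<longlonglongrightarrow> 0" .
  then have "(\<lambda>n. LINT w|lebesgue. k n w) \<longlonglongrightarrow> - (2 * pi) * v z"
    by (rule LIM_zero_cancel)
  from LIMSEQ_unique[OF lim1 this]
  show "(LINT w|lebesgue. (of_real (vx w) + \<i> * of_real (vy w)) / zc (w - z)) = - (2 * pi) * v z"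
    by (simp add: F_def)
qed

section \<open>Winding numbers of the boundary curve\<close>

locale smooth_loop =
  fixes c :: "real \<Rightarrow> real^2"
  assumes smooth_loop: "smooth_closed_curve c"
begin

definition c' :: "real \<Rightarrow> real^2" where "c' t = vector_derivative c (at t)"
definition loop :: "real \<Rightarrow> complex" where "loop t = zc (c t)"
definition loop' :: "real \<Rightarrow> complex" where "loop' t = zc (c' t)"

lemma Ck1: "Ck_on (Suc 0) c UNIV"
  using smooth_loop unfolding smooth_closed_curve_def smooth_on_def by blast

lemma c_has_vector_derivative: "(c has_vector_derivative c' t) (at t)"
  using Ck1 unfolding c'_def by (simp add: differentiable_on_def vector_derivative_works[symmetric])

lemma continuous_c: "continuous_on S c"
  using c_has_vector_derivative has_vector_derivative_continuous
  by (intro continuous_at_imp_continuous_on) blast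

lemma continuous_c': "continuous_on S c'"
proof -
  have "frechet_derivative c (at t) 1 = c' t" for t
    using c_has_vector_derivative[of t] frechet_derivative_at[of c _ t]
    unfolding has_vector_derivative_def by (metis scaleR_one)
  moreover have "continuous_on UNIV (\<lambda>x. frechet_derivative c (at x) 1)"
    using Ck1 by simp
  ultimately have "continuous_on UNIV c'" by simp
  then show ?thesis by (rule continuous_on_subset) simp
qed

lemma c'_nonzero: "c' t \<noteq> 0"
  using smooth_loop by (simp add: smooth_closed_curve_def c'_def)

lemma c_periodic: "c (t + of_int n) = c t"
proof -
  have 1: "c (t + 1) = c t" for t using smooth_loop by (simp add: smooth_closed_curve_def)
  have 2: "c (t + of_nat k) = c t" for t and k :: nat
  proof (induction k)
    case (Suc k)
    then show ?case using 1[of "t + of_nat k"] by (simp add: algebra_simps)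
  qed simp
  show ?thesis
  proof (cases "n \<ge> 0")
    case True then show ?thesis using 2[of t "nat n"] by simp
  next
    case False then show ?thesis using 2[of "t + of_int n" "nat (- n)"] by simp
  qed
qed

lemma c_frac: "c (frac t) = c t"
  using c_periodic[of t "- \<lfloor>t\<rfloor>"] by (simp add: frac_def)

lemma c_eq_imp: "c s = c t \<Longrightarrow> s - t \<in> \<int>"
proof -
  assume "c s = c t"
  then have "c (frac s) = c (frac t)" by (simp add: c_frac)
  moreover have "inj_on c {0..<1}" using smooth_loop by (simp add: smooth_closed_curve_def)
  ultimately have "frac s = frac t"
    by (metis atLeastLessThan_iff frac_ge_0 frac_lt_1 inj_onD)
  then have "s - t = of_int (\<lfloor>s\<rfloor> - \<lfloor>t\<rfloor>)" by (simp add: frac_def)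
  then show ?thesis by (metis Ints_of_int)
qed

lemma range_c: "range c = c ` {0..1}"
proof -
  have "c t \<in> c ` {0..1}" for t
    using c_frac[of t] frac_ge_0[of t] frac_lt_1[of t] by (metis atLeastAtMost_iff imageI less_imp_le)
  then show ?thesis by auto
qed

lemma c_smooth_path: "c differentiable_on S"
  using c_has_vector_derivative
  by (meson differentiableI_vector differentiable_at_imp_differentiable_on)

lemma range_c_null: "range c \<in> null_sets lebesgue"
  using negligible_differentiable_image_lowdim[where S=UNIV and f=c] c_smooth_path negligible_iff_null_sets by auto

lemma loop_has_vector_derivative: "(loop has_vector_derivative loop' t) (at t)"
  unfolding loop_def[abs_def] loop'_def
  by (rule bounded_linear.has_vector_derivative[OF bounded_linear_zc c_has_vector_derivative])

lemma continuous_loop: "continuous_on S loop" "continuous_on S loop'"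
  unfolding loop_def[abs_def] loop'_def[abs_def] by (intro continuous_intros continuous_c continuous_c')+

lemma path_image_loop: "path_image loop = zc ` range c"
  unfolding path_image_def range_c by (simp add: loop_def[abs_def] image_image)

lemma in_path_image_loop [simp]: "zc x \<in> path_image loop \<longleftrightarrow> x \<in> range c"
  unfolding path_image_loop using inj_zc by (meson inj_image_mem_iff)

lemma simple_path_loop: "simple_path loop"
proof -
  have "s = t \<or> s = 0 \<and> t = 1 \<or> s = 1 \<and> t = 0" if "s \<in> {0..1}" "t \<in> {0..1}" "loop s = loop t" for s t
  proof -
    have "c s = c t" using that(3) by (simp add: loop_def)
    then obtain n where "s - t = of_int n" using c_eq_imp Ints_cases by metis
    moreover from this that have "n = 0 \<or> n = 1 \<or> n = -1"
      by auto
    ultimately show ?thesis using that by auto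
  qed
  then show ?thesis
    using continuous_loop unfolding simple_path_def loop_free_def path_def by blast
qed

lemma closed_loop: "pathfinish loop = pathstart loop"
  using c_periodic[of 0 1] by (simp add: pathfinish_def pathstart_def loop_def)

lemma valid_path_loop: "valid_path loop"
  unfolding valid_path_def
  by (intro C1_differentiable_imp_piecewise)
     (use loop_has_vector_derivative continuous_loop(2) in \<open>auto simp: C1_differentiable_on_def\<close>)

lemma winding_number_loop:
  assumes "a \<notin> path_image loop"
  shows "2 * pi * \<i> * winding_number loop a = integral {0..1} (\<lambda>t. loop' t / (loop t - a))"
  using winding_number_valid_path[OF valid_path_loop assms] vector_derivative_at[OF loop_has_vector_derivative]
  by (simp add: contour_integral_integral)

lemma winding_number_loop_lborel:
  assumes "a \<notin> path_image loop"
  shows "set_integrable lborel {0..1} (\<lambda>t. loop' t / (loop t - a))"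
    "(LINT t:{0..1}|lborel. loop' t / (loop t - a)) = 2 * pi * \<i> * winding_number loop a"
proof -
  have "loop t \<noteq> a" if "t \<in> {0..1}" for t using assms that by (auto simp: path_image_def)
  then have "continuous_on {0..1} (\<lambda>t. loop' t / (loop t - a))"
    by (intro continuous_intros continuous_loop) auto
  then show *: "set_integrable lborel {0..1} (\<lambda>t. loop' t / (loop t - a))"
    by (rule borel_integrable_atLeastAtMost')
  show "(LINT t:{0..1}|lborel. loop' t / (loop t - a)) = 2 * pi * \<i> * winding_number loop a"
    using set_borel_integral_eq_integral(2)[OF *] winding_number_loop[OF assms] by simp
qed

text \<open>By the Jordan curve theorem the complement of the curve has two components. A connected
  set that misses the frontier of \<open>D\<close> and meets \<open>D\<close> lies in \<open>D\<close>; hence \<open>D\<close>, being bounded, is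
  the inner one.\<close>
lemma winding_number_obstacle:
  assumes "open D" "connected D" "bounded D" "D \<noteq> {}" "frontier D = range c"
  obtains W :: real where "W = 1 \<or> W = -1" "\<And>x. x \<in> D \<Longrightarrow> winding_number loop (zc x) = W"
    "\<And>x. x \<notin> closure D \<Longrightarrow> winding_number loop (zc x) = 0"
proof -
  define rz :: "complex \<Rightarrow> real^2" where "rz z = vector [Re z, Im z]" for z
  have rz: "zc (rz z) = z" "rz (zc x) = x" for z x by (simp_all add: rz_def zc_def vec_eq_iff forall_2)
  have "bounded_linear rz"
  proof (rule bounded_linear_intro[of _ 1])
    show "norm (rz z) \<le> norm z * 1" for z using norm_zc[of "rz z"] rz by simp
  qed (simp_all add: rz_def vec_eq_iff forall_2)
  then have "continuous_on S rz" for S by (rule linear_continuous_on)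
  define A where "A = rz ` inside (path_image loop)"
  define B where "B = rz ` outside (path_image loop)"
  note J = Jordan_inside_outside[OF simple_path_loop closed_loop]
  have conn: "connected A" "connected B"
    unfolding A_def B_def using J \<open>\<And>S. continuous_on S rz\<close> by (auto intro: connected_continuous_image)
  have memA: "x \<in> A \<longleftrightarrow> zc x \<in> inside (path_image loop)" and memB: "x \<in> B \<longleftrightarrow> zc x \<in> outside (path_image loop)" for x
    unfolding A_def B_def using rz by (metis image_eqI imageE)+
  have "x \<in> A \<union> B \<longleftrightarrow> x \<in> - range c" "x \<notin> A \<inter> B" for x
    unfolding Un_iff Int_iff memA memB
    using inside_Un_outside[of "path_image loop"] inside_Int_outside[of "path_image loop"] in_path_image_loop[of x]
    by blast+
  then have AB: "A \<union> B = - range c" "A \<inter> B = {}" by blast+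
  have Dc: "D \<inter> range c = {}"
    using assms(1,5) frontier_disjoint_eq[of D] by blast
  have sub: "X \<subseteq> D" if "connected X" "X \<inter> range c = {}" "X \<inter> D \<noteq> {}" for X
    using connected_Int_frontier[of X D] that assms(5) by auto
  have "\<not> B \<subseteq> D"
  proof
    assume "B \<subseteq> D"
    then have "outside (path_image loop) \<subseteq> zc ` D"
      using memB rz(1) by (metis image_eqI subsetD subsetI)
    moreover have "bounded (zc ` D)"
      using assms(3) bounded_linear_zc by (rule bounded_linear_image)
    ultimately show False using J bounded_subset by blast
  qed
  then have "B \<inter> D = {}" using sub[of B] conn AB by auto
  then have "D \<subseteq> A" using Dc AB by blast
  then have DA: "D = A" using sub[of A] conn AB assms(4) by auto
  have out: "winding_number loop (zc x) = 0" if "x \<notin> closure D" for x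
  proof -
    have "x \<notin> range c" "x \<notin> D"
      using that assms(5) closure_Un_frontier[of D] by auto
    then have "x \<in> B" using AB DA by auto
    then show ?thesis
      using memB winding_number_zero_in_outside[OF valid_path_imp_path[OF valid_path_loop] closed_loop] by blast
  qed
  show thesis
    using simple_closed_path_winding_number_inside[OF simple_path_loop]
  proof cases
    case 1
    then show ?thesis using that[of 1] DA memA out by auto
  next
    case 2
    then show ?thesis using that[of "-1"] DA memA out by auto
  qed
qed

text \<open>The Cauchy-Pompeiu formula is inserted for the values of \<open>v\<close> on the curve, and Fubini's
  theorem exchanges the integrations. The form \<open>dz / z\<close> is chosen because its imaginary part is
  \<open>d\<theta>\<close>, the flux of \<open>x / \<bar>x\<bar>\<^sup>2\<close> through the curve.\<close>
lemma loop_kernel_swap: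
  assumes v: "C1_test UNIV v vx vy" and 0: "0 \<notin> range c"
  shows "(LINT t:{0..1}|lborel. of_real (v (c t)) * (loop' t / loop t))
    = - (1 / (2 * pi)) * (LINT w|lborel. (of_real (vx w) + \<i> * of_real (vy w))
        * (LINT t:{0..1}|lborel. loop' t / (loop t * (zc w - loop t))))"
proof -
  define F where "F = (\<lambda>w. of_real (vx w) + \<i> * of_real (vy w) :: complex)"
  define \<phi> where "\<phi> = (\<lambda>t. indicator {0..1} t *\<^sub>R (loop' t / loop t))"
  define k where "k = (\<lambda>t w. \<phi> t * (F w / (zc w - loop t)))"
  have vC: "C1_on v vx vy UNIV" using v by (simp add: C1_test_def)
  obtain S where S: "compact S" "\<And>x. x \<notin> S \<Longrightarrow> v x = 0 \<and> vx x = 0 \<and> vy x = 0"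
    using C1_test_support[OF v] by metis
  obtain R where R: "\<And>x. x \<in> S \<Longrightarrow> norm x \<le> R"
    using S(1) compact_imp_bounded by (metis bounded_iff)
  obtain L where L: "L \<ge> 0" "\<And>x. \<bar>vx x\<bar> \<le> L" "\<And>x. \<bar>vy x\<bar> \<le> L"
    using C1_test_lipschitz[OF v] by metis
  have Fm [measurable]: "F \<in> borel_measurable borel"
    unfolding F_def using C1_onD(2,3)[OF vC]
    by (intro borel_measurable_continuous_onI continuous_intros) auto
  have Fb: "norm (F w) \<le> 2 * L * indicator (cball 0 R) w" for w
  proof (cases "w \<in> S")
    case True
    have "norm (F w) \<le> \<bar>vx w\<bar> + \<bar>vy w\<bar>"
      unfolding F_def by (rule order_trans[OF norm_triangle_ineq]) (simp add: norm_mult)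
    then show ?thesis using L(2,3)[of w] R[OF True] by simp
  next
    case False
    then show ?thesis using S(2)[of w] L(1) by (simp add: F_def)
  qed
  have loopm [measurable]: "loop \<in> borel_measurable borel" "loop' \<in> borel_measurable borel"
    using continuous_loop by (auto intro: borel_measurable_continuous_onI)
  have \<phi>m [measurable]: "\<phi> \<in> borel_measurable borel" unfolding \<phi>_def by measurable
  have nz: "loop t \<noteq> 0" for t using 0 by (auto simp: loop_def)
  have "bounded ((\<lambda>t. loop' t / loop t) ` {0..1})"
    by (intro compact_imp_bounded compact_continuous_image continuous_intros continuous_loop) (auto simp: nz)
  then obtain M where M: "M > 0" "\<And>t. t \<in> {0..1} \<Longrightarrow> norm (loop' t / loop t) \<le> M"
    unfolding bounded_pos by auto
  have \<phi>b: "norm (\<phi> t) \<le> M * indicator {0..1} t" for t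
    using M(2)[of t] by (auto simp: \<phi>_def indicator_def)
  obtain C where C: "C \<ge> 0" "\<And>z. (\<integral>\<^sup>+w. ennreal (indicator (cball 0 R) w / norm (w - z :: real^2)) \<partial>lborel) \<le> ennreal C"
    using nn_integral_inverse_dist_bounded[of R] by metis
  have km [measurable]: "case_prod k \<in> borel_measurable (lborel \<Otimes>\<^sub>M lborel)"
    unfolding k_def by measurable
  have kb: "norm (k t w) \<le> (M * indicator {0..1} t * (2 * L)) * (indicator (cball 0 R) w / norm (w - c t))" for t w
  proof -
    have "norm (zc w - loop t) = norm (w - c t)" by (simp add: loop_def flip: zc_simps(5))
    then have "norm (k t w) = norm (\<phi> t) * norm (F w) / norm (w - c t)"
      by (simp add: k_def norm_mult norm_divide)
    also have "\<dots> \<le> (M * indicator {0..1} t) * (2 * L * indicator (cball 0 R) w) / norm (w - c t)"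
      using M(1) by (intro divide_right_mono mult_mono \<phi>b Fb) auto
    finally show ?thesis by (simp add: mult_ac)
  qed
  have kint: "integrable (lborel \<Otimes>\<^sub>M lborel) (case_prod k)"
  proof (rule integrableI_bounded[OF km])
    have "(\<integral>\<^sup>+p. ennreal (norm (case_prod k p)) \<partial>(lborel \<Otimes>\<^sub>M lborel))
        = (\<integral>\<^sup>+t. \<integral>\<^sup>+w. ennreal (norm (k t w)) \<partial>lborel \<partial>lborel)"
      by (subst lborel.nn_integral_fst[symmetric]) auto
    also have "\<dots> \<le> (\<integral>\<^sup>+t. ennreal (M * 2 * L * C) * indicator {0..1} (t::real) \<partial>lborel)"
    proof (rule nn_integral_mono)
      fix t :: real
      have "(\<integral>\<^sup>+w. ennreal (norm (k t w)) \<partial>lborel)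
          \<le> (\<integral>\<^sup>+w. ennreal (M * indicator {0..1} t * (2 * L)) * ennreal (indicator (cball 0 R) w / norm (w - c t)) \<partial>lborel)"
        using kb M(1) L(1) by (intro nn_integral_mono) (simp add: ennreal_leI flip: ennreal_mult)
      also have "\<dots> = ennreal (M * indicator {0..1} t * (2 * L)) * (\<integral>\<^sup>+w. ennreal (indicator (cball 0 R) w / norm (w - c t)) \<partial>lborel)"
        by (intro nn_integral_cmult measurable_compose[OF _ measurable_ennreal] borel_measurable_divide borel_measurable_indicator borel_measurable_continuous_onI continuous_intros) auto
      also have "\<dots> \<le> ennreal (M * indicator {0..1} t * (2 * L)) * ennreal C"
        by (intro mult_left_mono C) auto
      also have "\<dots> = ennreal (M * 2 * L * C) * indicator {0..1} t"
        using M(1) L(1) C(1) by (auto simp: indicator_def simp flip: ennreal_mult)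
      finally show "(\<integral>\<^sup>+w. ennreal (norm (k t w)) \<partial>lborel) \<le> ennreal (M * 2 * L * C) * indicator {0..1} t" .
    qed
    also have "\<dots> = ennreal (M * 2 * L * C)"
      by (subst nn_integral_cmult_indicator) auto
    finally show "(\<integral>\<^sup>+p. ennreal (norm (case_prod k p)) \<partial>(lborel \<Otimes>\<^sub>M lborel)) < \<infinity>"
      by (rule le_less_trans) simp
  qed
  have inner: "(LINT w|lborel. k t w) = - (2 * pi) * (\<phi> t * of_real (v (c t)))" for t
  proof -
    have "(LINT w|lebesgue. F w / zc (w - c t)) = - (2 * pi) * v (c t)"
      using cauchy_pompeiu(2)[OF v, of "c t"] by (simp add: F_def)
    moreover have "(\<lambda>w. F w / (zc w - loop t)) \<in> borel_measurable lborel" by measurable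
    ultimately have "(LINT w|lborel. F w / (zc w - loop t)) = - (2 * pi) * v (c t)"
      by (simp add: integral_completion loop_def)
    then show ?thesis unfolding k_def integral_mult_right_zero by simp
  qed
  have outer: "(LINT t|lborel. k t w) = F w * (LINT t:{0..1}|lborel. loop' t / (loop t * (zc w - loop t)))" for w
  proof -
    have "(LINT t|lborel. k t w) = (LINT t|lborel. F w * (indicator {0..1} t *\<^sub>R (loop' t / (loop t * (zc w - loop t)))))"
      by (intro Bochner_Integration.integral_cong refl) (simp add: k_def \<phi>_def scaleR_conv_of_real)
    then show ?thesis by (simp only: set_lebesgue_integral_def integral_mult_right_zero)
  qed
  have gen: "- (2 * pi) * X = Y \<Longrightarrow> X = - (1 / (2 * pi)) * Y" for X Y :: complex
    by (auto simp: field_simps)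
  have "(LINT t|lborel. LINT w|lborel. k t w) = (LINT w|lborel. LINT t|lborel. k t w)"
    using lborel_pair.Fubini_integral[OF kint] by simp
  then have E1: "- (2 * pi) * (LINT t|lborel. \<phi> t * of_real (v (c t)))
      = (LINT w|lborel. F w * (LINT t:{0..1}|lborel. loop' t / (loop t * (zc w - loop t))))"
    unfolding inner outer by simp
  have E2: "(LINT t:{0..1}|lborel. of_real (v (c t)) * (loop' t / loop t)) = (LINT t|lborel. \<phi> t * of_real (v (c t)))"
    unfolding set_lebesgue_integral_def by (intro Bochner_Integration.integral_cong refl) (simp add: \<phi>_def)
  show ?thesis unfolding E2 by (rule gen[OF E1[unfolded F_def]])
qed

end

section \<open>Green's formula outside a smooth Jordan curve\<close>

text \<open>As a function of the starting point the integral has derivative \<open>f(x + 1) - f(x) = 0\<close>.\<close>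
lemma integral_period_shift:
  fixes f :: "real \<Rightarrow> 'a::banach"
  assumes c: "continuous_on UNIV f" and per: "\<And>x. f (x + 1) = f x"
  shows "integral {a..a + 1} f = integral {0..1} f"
proof -
  define l u where "l = min a 0" and "u = max a 0"
  have cont: "continuous_on S f" for S using c continuous_on_subset by blast
  have int: "f integrable_on {x..y}" for x y by (intro integrable_continuous_real cont)
  define P where "P = (\<lambda>x. integral {l..x} f)"
  have D: "(P has_vector_derivative f x) (at x within {l..u + 1})" if "x \<in> {l..u + 1}" for x
    unfolding P_def by (rule integral_has_vector_derivative[OF cont that])
  have D1: "((\<lambda>x. P (x + 1)) has_vector_derivative f x) (at x within {l..u})" if "x \<in> {l..u}" for x
  proof -
    have "((\<lambda>x. x + 1) has_vector_derivative 1) (at x within {l..u})"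
      by (auto intro!: derivative_eq_intros simp: has_vector_derivative_def)
    moreover have "(P has_vector_derivative f (x + 1)) (at (x + 1) within (\<lambda>x. x + 1) ` {l..u})"
      by (rule has_vector_derivative_within_subset[OF D]) (use that in auto)
    ultimately show ?thesis
      using vector_diff_chain_within[of "\<lambda>x. x + 1" 1 x "{l..u}" P "f (x + 1)"] per by (simp add: o_def)
  qed
  have D2: "((\<lambda>x. P (x + 1) - P x) has_vector_derivative 0) (at x within {l..u})" if "x \<in> {l..u}" for x
    using has_vector_derivative_diff[OF D1[OF that] has_vector_derivative_within_subset[OF D, of x "{l..u}"]] that by simp
  obtain k where k: "\<And>x. x \<in> {l..u} \<Longrightarrow> P (x + 1) - P x = k"
    using has_vector_derivative_zero_constant[OF convex_real_interval(5) D2] by blast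
  have "a \<in> {l..u}" "0 \<in> {l..u}" by (auto simp: l_def u_def)
  then have "P (a + 1) - P a = P (0 + 1) - P 0" using k by metis
  moreover have *: "P (x + 1) - P x = integral {x..x + 1} f" if "x \<in> {l..u}" for x
    using Henstock_Kurzweil_Integration.integral_combine[of l x "x + 1" f, OF _ _ int] that
    unfolding P_def by (auto simp: algebra_simps)
  ultimately show ?thesis using *[of a] *[of 0] by (simp add: l_def u_def)
qed

text \<open>The total mass of the Poisson kernel, up to the factor \<open>\<pi>\<close>.\<close>
lemma inverse_1_plus_square_line:
  shows "integrable lborel (\<lambda>y::real. 1 / (1 + y\<^sup>2))" "(LINT y|lborel. 1 / (1 + y\<^sup>2)) = pi"
proof -
  have A: "set_integrable lborel (einterval (-\<infinity>) \<infinity>) (\<lambda>y::real. 1 / (1 + y\<^sup>2))"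
    and B: "(LBINT y=-\<infinity>..\<infinity>. 1 / (1 + y\<^sup>2)) = pi / 2 - (- (pi / 2))"
  proof -
    have D: "(arctan has_real_derivative 1 / (1 + y\<^sup>2)) (at y)" for y :: real
      using DERIV_arctan[of y] by (simp add: divide_inverse)
    have C: "isCont (\<lambda>y. 1 / (1 + y\<^sup>2)) y" for y :: real
      by (intro continuous_intros) (simp add: add_nonneg_eq_0_iff)
    have lim: "((arctan \<circ> real_of_ereal) \<longlongrightarrow> - (pi / 2)) (at_right (- \<infinity>))"
      "((arctan \<circ> real_of_ereal) \<longlongrightarrow> pi / 2) (at_left \<infinity>)"
      using tendsto_arctan_at_bot tendsto_arctan_at_top by (simp_all add: ereal_tendsto_simps)
    note FTC = interval_integral_FTC_nonneg[OF _ D C _ lim, simplified]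
    show "set_integrable lborel (einterval (-\<infinity>) \<infinity>) (\<lambda>y::real. 1 / (1 + y\<^sup>2))"
      "(LBINT y=-\<infinity>..\<infinity>. 1 / (1 + y\<^sup>2)) = pi / 2 - (- (pi / 2))"
      using FTC by simp_all
  qed
  show "integrable lborel (\<lambda>y::real. 1 / (1 + y\<^sup>2))"
    using A by (simp add: set_integrable_def)
  show "(LINT y|lborel. 1 / (1 + y\<^sup>2)) = pi"
    using B by (simp add: interval_lebesgue_integral_def set_lebesgue_integral_def)
qed

lemma norm2_sq: "(norm (x::real^2))\<^sup>2 = (x$1)\<^sup>2 + (x$2)\<^sup>2"
  using cmod_power2[of "zc x"] by simp

context smooth_loop
begin

text \<open>By partial fractions the curve integral \<open>J w\<close> inside the area integral is \<open>2 \<pi> \<i> / w\<close>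
  times the difference of the winding numbers about \<open>0\<close> and \<open>w\<close>. The origin lies in \<open>D\<close>, so this
  vanishes for \<open>w\<close> in \<open>D\<close> and leaves an integral over the exterior. With \<open>F = v\<^sub>x + \<i> v\<^sub>y\<close>, the
  real part of \<open>F / w\<close> is \<open>(x \<bullet> \<nabla>v) / \<bar>x\<bar>\<^sup>2\<close>.\<close>
lemma green_exterior:
  assumes v: "C1_test UNIV v vx vy" and 0: "0 \<in> D" and D: "frontier D = range c" "open D"
    and W: "W = 1 \<or> W = -1" "\<And>x. x \<in> D \<Longrightarrow> winding_number loop (zc x) = of_real W"
      "\<And>x. x \<notin> closure D \<Longrightarrow> winding_number loop (zc x) = 0"
  shows "(LINT x|lebesgue_on (- D). (x$1 * vx x + x$2 * vy x) / (norm x)\<^sup>2)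
    = - W * integral {0..1} (\<lambda>t. v (c t) * (c t$1 * c' t$2 - c t$2 * c' t$1) / (norm (c t))\<^sup>2)"
proof -
  define F where "F = (\<lambda>w. of_real (vx w) + \<i> * of_real (vy w) :: complex)"
  have Dc: "D \<inter> range c = {}"
    using D frontier_disjoint_eq[of D] by blast
  then have notin0: "0 \<notin> range c" using 0 by blast
  then have nz: "loop t \<noteq> 0" for t by (auto simp: loop_def)
  have notin0p: "0 \<notin> path_image loop" using in_path_image_loop[of 0] notin0 by simp
  have W0: "winding_number loop 0 = of_real W" using W(2)[OF 0] by simp
  have vC: "C1_on v vx vy UNIV" using v by (simp add: C1_test_def)
  have Fm [measurable]: "F \<in> borel_measurable borel"
    unfolding F_def using C1_onD(2,3)[OF vC]
    by (intro borel_measurable_continuous_onI continuous_intros) auto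
  have loopm [measurable]: "loop \<in> borel_measurable borel" "loop' \<in> borel_measurable borel"
    using continuous_loop by (auto intro: borel_measurable_continuous_onI)
  have Db [measurable]: "- D \<in> sets borel" using D(2) by auto
  define J where "J = (\<lambda>w. LINT t:{0..1}|lborel. loop' t / (loop t * (zc w - loop t)))"
  have Jm [measurable]: "J \<in> borel_measurable borel"
  proof -
    have "(\<lambda>w. LINT t|lborel. indicat_real {0..1} t *\<^sub>R (loop' t / (loop t * (zc w - loop t)))) \<in> borel_measurable lborel"
      by (rule lborel.borel_measurable_lebesgue_integral) measurable
    then show ?thesis by (simp add: J_def set_lebesgue_integral_def)
  qed
  have Jeq: "J w = 2 * pi * \<i> * W * indicator (- D) w / zc w" if "w \<notin> range c" "w \<noteq> 0" for w
  proof -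
    have Z: "zc w \<notin> path_image loop" "zc w \<noteq> 0" using that by simp_all
    have neq: "zc w \<noteq> loop t" for t
      using that(1) by (auto simp: loop_def)
    have "loop' t / (loop t * (zc w - loop t))
        = (1 / zc w) * (loop' t / (loop t - 0) - loop' t / (loop t - zc w))" for t
      using nz[of t] neq[of t] Z(2) by (simp add: divide_simps) (simp add: algebra_simps)
    \<comment> \<open>Both fractions integrate to a winding number.\<close>
    then have "J w = (LINT t:{0..1}|lborel. (1 / zc w) * (loop' t / (loop t - 0) - loop' t / (loop t - zc w)))"
      unfolding J_def by presburger
    also have "\<dots> = (1 / zc w) * (2 * pi * \<i> * winding_number loop 0 - 2 * pi * \<i> * winding_number loop (zc w))"
      unfolding set_integral_mult_right
      using winding_number_loop_lborel[OF notin0p] winding_number_loop_lborel[OF Z(1)] by (simp add: set_integral_diff)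
    also have "winding_number loop (zc w) = (if w \<in> D then of_real W else 0)"
      using that(1) D(1) W(2)[of w] W(3)[of w] closure_Un_frontier[of D] by auto
    finally show ?thesis by (auto simp: W0 indicator_def)
  qed
  have AE: "AE w in lborel. w \<notin> range c \<and> w \<noteq> 0"
  proof -
    have "AE w in lborel. w \<notin> range c"
      using AE_not_in[OF range_c_null] by (simp add: AE_completion_iff)
    then show ?thesis using AE_lborel_singleton[of 0] by eventually_elim auto
  qed
  define Q where "Q = (LINT w|lebesgue. indicat_real (- D) w *\<^sub>R (F w / zc w))"
  have "(LINT w|lborel. F w * J w) = (LINT w|lborel. (2 * pi * \<i> * W) * (indicat_real (- D) w *\<^sub>R (F w / zc w)))"
  proof (rule integral_cong_AE)
    show "AE w in lborel. F w * J w = 2 * pi * \<i> * W * (indicat_real (- D) w *\<^sub>R (F w / zc w))"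
      using AE by eventually_elim (simp add: Jeq scaleR_conv_of_real indicator_def)
  qed measurable
  also have "\<dots> = (2 * pi * \<i> * W) * (LINT w|lborel. indicat_real (- D) w *\<^sub>R (F w / zc w))"
    by (rule integral_mult_right_zero)
  also have "(LINT w|lborel. indicat_real (- D) w *\<^sub>R (F w / zc w)) = Q"
    unfolding Q_def by (subst integral_completion) measurable
  finally have "(LINT t:{0..1}|lborel. of_real (v (c t)) * (loop' t / loop t)) = - (1 / (2 * pi)) * ((2 * pi * \<i> * W) * Q)"
    using loop_kernel_swap[OF v notin0] by (simp add: F_def J_def)
  then have eq: "(LINT t:{0..1}|lborel. of_real (v (c t)) * (loop' t / loop t)) = - \<i> * W * Q"
    by simp
  have cont: "continuous_on {0..1} (\<lambda>t. of_real (v (c t)) * (loop' t / loop t))"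
    using continuous_on_compose2[OF C1_onD(4)[OF vC] continuous_c[of "{0..1}"]]
    by (intro continuous_intros continuous_loop) (auto simp: nz)
  have SI: "set_integrable lborel {0..1} (\<lambda>t. of_real (v (c t)) * (loop' t / loop t))"
    by (rule borel_integrable_atLeastAtMost'[OF cont])
  have hi: "((\<lambda>t. of_real (v (c t)) * (loop' t / loop t)) has_integral (- \<i> * W * Q)) {0..1}"
    using set_borel_integral_eq_integral[OF SI] eq by (metis integrable_integral)
  have Im1: "Im (of_real (v (c t)) * (loop' t / loop t)) = v (c t) * (c t$1 * c' t$2 - c t$2 * c' t$1) / (norm (c t))\<^sup>2" for t
    by (simp add: Im_divide loop_def loop'_def norm2_sq algebra_simps)
  have L: "integral {0..1} (\<lambda>t. v (c t) * (c t$1 * c' t$2 - c t$2 * c' t$1) / (norm (c t))\<^sup>2) = - W * Re Q"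
    using has_integral_Im[OF hi] unfolding Im1 by (simp add: integral_unique)
  have QI: "integrable lebesgue (\<lambda>w. indicat_real (- D) w *\<^sub>R (F w / zc w))"
    using cauchy_pompeiu(1)[OF v, of 0] D(2) by (intro integrable_mult_indicator) (auto simp: F_def)
  have Re1: "Re (indicat_real (- D) w *\<^sub>R (F w / zc w)) = indicat_real (- D) w *\<^sub>R ((w$1 * vx w + w$2 * vy w) / (norm w)\<^sup>2)" for w
    by (simp add: Re_divide F_def norm2_sq algebra_simps)
  have "Re Q = (LINT w|lebesgue. indicat_real (- D) w *\<^sub>R ((w$1 * vx w + w$2 * vy w) / (norm w)\<^sup>2))"
    unfolding Q_def integral_Re[OF QI, symmetric] Re1 ..
  also have "\<dots> = (LINT x|lebesgue_on (- D). (x$1 * vx x + x$2 * vy x) / (norm x)\<^sup>2)"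
    using D(2) by (subst integral_restrict_space) auto
  finally have R: "Re Q = (LINT x|lebesgue_on (- D). (x$1 * vx x + x$2 * vy x) / (norm x)\<^sup>2)" .
  show ?thesis using W(1) L R by auto
qed

lemma loop_period: "loop (t + 1) = loop t" "loop' (t + 1) = loop' t"
proof -
  have 1: "loop (t + 1) = loop t" for t
    using c_periodic[of t 1] by (simp add: loop_def)
  then show "loop (t + 1) = loop t" .
  have "((\<lambda>t. t + 1) has_vector_derivative 1) (at t)"
    by (auto intro!: derivative_eq_intros simp: has_vector_derivative_def)
  then have "((\<lambda>t. loop (t + 1)) has_vector_derivative loop' (t + 1)) (at t)"
    using vector_diff_chain_at[of "\<lambda>t. t + 1" 1 t loop "loop' (t + 1)"] loop_has_vector_derivative[of "t + 1"]
    by (simp add: o_def)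
  then show "loop' (t + 1) = loop' t"
    using loop_has_vector_derivative[of t] vector_derivative_unique_at unfolding 1 by blast
qed

text \<open>The quantity bounded from below is the product of the distances from \<open>loop (t0 + x)\<close> to
  the two points \<open>loop t0 \<plusminus> \<i> s loop' t0\<close> on either side of the curve. For small \<open>x\<close> the curve
  is compared with its tangent, where the product is \<open>(x\<^sup>2 + s\<^sup>2) \<bar>loop' t0\<bar>\<^sup>2\<close>; away from \<open>t0\<close>
  the curve keeps a positive distance from \<open>loop t0\<close>, because it is simple.\<close>
lemma loop_separation:
  obtains m s0 where "m > 0" "s0 > 0"
    "\<And>x s. \<bar>x\<bar> \<le> 1 / 2 \<Longrightarrow> 0 < s \<Longrightarrow> s < s0 \<Longrightarrow>
       m * (x\<^sup>2 + s\<^sup>2) \<le> norm ((loop (t0 + x) - loop t0)\<^sup>2 + (of_real s * loop' t0)\<^sup>2)"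
proof -
  define \<tau> where "\<tau> = loop' t0"
  define h where "h = (\<lambda>x. loop (t0 + x) - loop t0)"
  have \<tau>: "norm \<tau> > 0" using c'_nonzero[of t0] by (simp add: \<tau>_def loop'_def)
  have "\<exists>d>0. \<forall>y. norm (y - t0) < d \<longrightarrow> norm (loop y - loop t0 - (y - t0) *\<^sub>R \<tau>) \<le> norm \<tau> / 10 * norm (y - t0)"
    using loop_has_vector_derivative[of t0] \<tau>
    unfolding has_vector_derivative_def has_derivative_at_alt \<tau>_def by (meson divide_pos_pos zero_less_numeral)
  then obtain d where d: "d > 0" "\<And>y. norm (y - t0) < d \<Longrightarrow> norm (loop y - loop t0 - (y - t0) *\<^sub>R \<tau>) \<le> norm \<tau> / 10 * norm (y - t0)"
    by blast
  define \<delta> where "\<delta> = min (d / 2) (1 / 4)"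
  have \<delta>: "0 < \<delta>" "\<delta> < d" "\<delta> \<le> 1/4" using d(1) by (auto simp: \<delta>_def)
  have near: "norm (h x - of_real x * \<tau>) \<le> norm \<tau> / 10 * \<bar>x\<bar>" if "\<bar>x\<bar> \<le> \<delta>" for x
    using d(2)[of "t0 + x"] that \<delta> by (simp add: h_def scaleR_conv_of_real)
  define K where "K = {-1/2..-\<delta>} \<union> {\<delta>..1/2}"
  have "h x \<noteq> 0" if "x \<in> K" for x
  proof
    assume "h x = 0"
    then have "c (t0 + x) = c t0" by (simp add: h_def loop_def)
    then have "x \<in> \<int>" using c_eq_imp by force
    then obtain n where "x = of_int n" using Ints_cases by metis
    moreover have "x \<noteq> 0" "\<bar>x\<bar> < 1" using that \<delta> by (auto simp: K_def)
    ultimately show False by (metis abs_zero of_int_0 of_int_abs of_int_less_1_iff zero_less_abs_iff int_one_le_iff_zero_less not_less)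
  qed
  moreover have "compact K" "K \<noteq> {}" using \<delta> by (auto simp: K_def)
  moreover have "continuous_on K (\<lambda>x. norm (h x))"
    unfolding h_def by (intro continuous_intros continuous_on_compose2[OF continuous_loop(1)[of UNIV]]) auto
  ultimately obtain x0 where x0: "x0 \<in> K" "\<And>x. x \<in> K \<Longrightarrow> norm (h x0) \<le> norm (h x)" "h x0 \<noteq> 0"
    using continuous_attains_inf by metis
  define m0 where "m0 = norm (h x0)"
  have m0: "m0 > 0" using x0 by (simp add: m0_def)
  \<comment> \<open>For \<open>s < s0\<close> the term \<open>(s \<tau>)\<^sup>2\<close> is at most a quarter of \<open>m0\<^sup>2\<close>, so it cannot cancel
    \<open>(h x)\<^sup>2\<close> away from \<open>t0\<close>.\<close>
  define s0 where "s0 = m0 / (2 * norm \<tau>)"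
  have s0: "s0 > 0" using m0 \<tau> by (simp add: s0_def)
  define m where "m = min ((norm \<tau>)\<^sup>2 / 2) ((3 / 4 * m0\<^sup>2) / (1 / 4 + s0\<^sup>2))"
  have pos: "0 < 1 / 4 + s0\<^sup>2" by (simp add: add_pos_nonneg)
  have "m \<le> (3 / 4 * m0\<^sup>2) / (1 / 4 + s0\<^sup>2)" by (simp only: m_def min.cobounded2)
  then have m3: "m * (1 / 4 + s0\<^sup>2) \<le> 3 / 4 * m0\<^sup>2" by (simp only: pos_le_divide_eq[OF pos])
  have m1: "m > 0" unfolding m_def min_less_iff_conj using \<tau> m0 pos by (intro conjI divide_pos_pos) simp_all
  have m2: "m \<le> (norm \<tau>)\<^sup>2 / 2" by (simp only: m_def min.cobounded1)
  note m = m1 m2 m3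
  have "m * (x\<^sup>2 + s\<^sup>2) \<le> norm ((h x)\<^sup>2 + (of_real s * \<tau>)\<^sup>2)" if x: "\<bar>x\<bar> \<le> 1/2" and s: "0 < s" "s < s0" for x s
  proof (cases "\<bar>x\<bar> \<le> \<delta>")
    case True
    define e where "e = h x - of_real x * \<tau>"
    have e: "norm e \<le> norm \<tau> / 10 * \<bar>x\<bar>" using near[OF True] by (simp add: e_def)
    have "norm (2 * of_real x * \<tau> + e) \<le> 2 * \<bar>x\<bar> * norm \<tau> + norm \<tau> / 10 * \<bar>x\<bar>"
      by (rule order_trans[OF norm_triangle_ineq]) (use e in \<open>simp add: norm_mult mult.commute[of "norm \<tau>"]\<close>)
    then have "norm (e * (2 * of_real x * \<tau> + e)) \<le> (norm \<tau> / 10 * \<bar>x\<bar>) * (2 * \<bar>x\<bar> * norm \<tau> + norm \<tau> / 10 * \<bar>x\<bar>)"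
      unfolding norm_mult[of e] using e by (intro mult_mono) auto
    also have "\<dots> = 21 / 100 * ((norm \<tau>)\<^sup>2 * x\<^sup>2)"
      by (simp add: power2_eq_square algebra_simps flip: abs_mult)
    also have "\<dots> \<le> 1 / 2 * ((norm \<tau>)\<^sup>2 * x\<^sup>2)" by (intro mult_right_mono) auto
    finally have E: "norm (e * (2 * of_real x * \<tau> + e)) \<le> 1 / 2 * ((norm \<tau>)\<^sup>2 * x\<^sup>2)" .
    have "(h x)\<^sup>2 + (of_real s * \<tau>)\<^sup>2 = of_real (x\<^sup>2 + s\<^sup>2) * \<tau>\<^sup>2 + e * (2 * of_real x * \<tau> + e)"
      by (simp add: e_def power2_eq_square algebra_simps)
    then have "norm ((h x)\<^sup>2 + (of_real s * \<tau>)\<^sup>2) \<ge> norm (of_real (x\<^sup>2 + s\<^sup>2) * \<tau>\<^sup>2) - norm (e * (2 * of_real x * \<tau> + e))"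
      using norm_diff_ineq by metis
    moreover have "norm (of_real (x\<^sup>2 + s\<^sup>2) * \<tau>\<^sup>2) = (norm \<tau>)\<^sup>2 * x\<^sup>2 + (norm \<tau>)\<^sup>2 * s\<^sup>2"
      by (simp add: norm_mult norm_power algebra_simps del: of_real_add)
    moreover have "m * (x\<^sup>2 + s\<^sup>2) \<le> (norm \<tau>)\<^sup>2 / 2 * (x\<^sup>2 + s\<^sup>2)" using m(2) by (intro mult_right_mono) auto
    then have "m * (x\<^sup>2 + s\<^sup>2) \<le> 1 / 2 * ((norm \<tau>)\<^sup>2 * x\<^sup>2) + 1 / 2 * ((norm \<tau>)\<^sup>2 * s\<^sup>2)"
      by (simp add: algebra_simps)
    moreover have "0 \<le> (norm \<tau>)\<^sup>2 * s\<^sup>2" by simp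
    ultimately show ?thesis using E by linarith
  next
    case False
    then have "x \<in> K" using x by (auto simp: K_def abs_le_iff)
    then have hx: "m0 \<le> norm (h x)" using x0 by (simp add: m0_def)
    have "s * norm \<tau> \<le> s0 * norm \<tau>" using s \<tau> by simp
    also have "\<dots> = m0 / 2" using \<tau> by (simp add: s0_def)
    finally have "(s * norm \<tau>)\<^sup>2 \<le> (m0 / 2)\<^sup>2" using s by (intro power_mono) auto
    moreover have "m0\<^sup>2 \<le> (norm (h x))\<^sup>2" using hx m0 by (intro power_mono) auto
    moreover have "norm ((h x)\<^sup>2 + (of_real s * \<tau>)\<^sup>2) \<ge> norm ((h x)\<^sup>2) - norm ((of_real s * \<tau>)\<^sup>2)"
      by (rule norm_diff_ineq)
    moreover have "norm ((of_real s * \<tau>)\<^sup>2) = (s * norm \<tau>)\<^sup>2" using s by (simp add: norm_mult norm_power)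
    ultimately have 1: "norm ((h x)\<^sup>2 + (of_real s * \<tau>)\<^sup>2) \<ge> 3 / 4 * m0\<^sup>2"
      by (simp add: norm_power power_divide)
    have "x\<^sup>2 \<le> (1/2)\<^sup>2" using power_mono[OF x, of 2] by simp
    moreover have "s\<^sup>2 \<le> s0\<^sup>2" using s by (intro power_mono) auto
    ultimately have "m * (x\<^sup>2 + s\<^sup>2) \<le> m * (1 / 4 + s0\<^sup>2)"
      using m(1) by (intro mult_left_mono) (auto simp: power_divide)
    then show ?thesis using 1 m(3) by linarith
  qed
  then show ?thesis using that[OF m(1) s0] by (simp add: h_def \<tau>_def)
qed

end

section \<open>Orientation of the inward normal\<close>

context smooth_loop
begin

text \<open>The two Cauchy integrals are combined over a common denominator and rescaled by
  \<open>t = t0 + s y\<close>, so that the integrand tends to the Poisson kernel as \<open>s \<rightarrow> 0\<close>.\<close>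
lemma winding_number_difference:
  assumes s: "s > 0" and ab: "\<And>x. \<bar>x\<bar> \<le> 1/2 \<Longrightarrow> (loop (t0 + x) - loop t0)\<^sup>2 + (of_real s * loop' t0)\<^sup>2 \<noteq> 0"
  defines "a \<equiv> loop t0 + \<i> * of_real s * loop' t0" and "b \<equiv> loop t0 - \<i> * of_real s * loop' t0"
  shows "a \<notin> path_image loop" "b \<notin> path_image loop"
    "of_real pi * (winding_number loop a - winding_number loop b)
      = (LINT y|lborel. indicat_real {-1/2..1/2} (s * y) *\<^sub>R
          (loop' t0 * loop' (t0 + s * y) / (((loop (t0 + s * y) - loop t0) / of_real s)\<^sup>2 + (loop' t0)\<^sup>2)))"
proof -
  define p \<tau> where "p = loop t0" and "\<tau> = loop' t0"
  have prod: "(z - a) * (z - b) = (z - p)\<^sup>2 + (of_real s * \<tau>)\<^sup>2" for z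
    by (simp add: a_def b_def p_def \<tau>_def power2_eq_square algebra_simps)
  have ne: "loop (t0 + x) \<noteq> a" "loop (t0 + x) \<noteq> b" if "\<bar>x\<bar> \<le> 1/2" for x
    using ab[OF that] prod[of "loop (t0 + x)"] by (auto simp: p_def \<tau>_def)
  have ne': "loop t \<noteq> a" "loop t \<noteq> b" for t
  proof -
    \<comment> \<open>\<open>x\<close> reduces \<open>t - t0\<close> modulo the period to the window around 0.\<close>
    define x where "x = frac (t - t0 + 1/2) - 1/2"
    have "\<bar>x\<bar> \<le> 1/2" using frac_ge_0[of "t - t0 + 1/2"] frac_lt_1[of "t - t0 + 1/2"] by (intro abs_leI; unfold x_def; linarith)
    moreover have "t0 + x = t + of_int (- \<lfloor>t - t0 + 1/2\<rfloor>)" by (simp add: x_def frac_def)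
    then have "loop (t0 + x) = loop t" using c_periodic[of t "- \<lfloor>t - t0 + 1/2\<rfloor>"] by (simp add: loop_def)
    ultimately show "loop t \<noteq> a" "loop t \<noteq> b" using ne[of x] by auto
  qed
  then show na: "a \<notin> path_image loop" and nb: "b \<notin> path_image loop"
    by (auto simp: path_image_def)
  have wn: "2 * pi * \<i> * winding_number loop z = integral {t0 - 1/2..t0 + 1/2} (\<lambda>t. loop' t / (loop t - z))"
    if "z \<notin> path_image loop" "\<And>t. loop t \<noteq> z" for z
  proof -
    have "continuous_on UNIV (\<lambda>t. loop' t / (loop t - z))"
      using that(2) by (intro continuous_intros continuous_loop) auto
    moreover have "t0 - 1/2 + 1 = t0 + 1/2" by simp
    ultimately have "integral {t0 - 1/2..t0 + 1/2} (\<lambda>t. loop' t / (loop t - z)) = integral {0..1} (\<lambda>t. loop' t / (loop t - z))"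
      using integral_period_shift[of "\<lambda>t. loop' t / (loop t - z)" "t0 - 1/2"] by (simp only: loop_period)
    then show ?thesis using winding_number_loop[OF that(1)] by (simp only:)
  qed
  have cz: "continuous_on {t0 - 1/2..t0 + 1/2} (\<lambda>t. loop' t / (loop t - z))" if "\<And>t. loop t \<noteq> z" for z
    using that by (intro continuous_intros continuous_loop) auto
  define f where "f = (\<lambda>t. loop' t * (2 * \<i> * of_real s * \<tau>) / ((loop t - p)\<^sup>2 + (of_real s * \<tau>)\<^sup>2))"
  have f_eq: "loop' t / (loop t - a) - loop' t / (loop t - b) = f t" for t
  proof -
    have "loop' t / (loop t - a) - loop' t / (loop t - b) = loop' t * (a - b) / ((loop t - a) * (loop t - b))"
      using ne'[of t] by (simp add: field_simps)
    moreover have "a - b = 2 * \<i> * of_real s * \<tau>" by (simp add: a_def b_def \<tau>_def)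
    ultimately show ?thesis unfolding f_def prod by simp
  qed
  have "2 * pi * \<i> * (winding_number loop a - winding_number loop b) = integral {t0 - 1/2..t0 + 1/2} f"
    using Henstock_Kurzweil_Integration.integral_diff[OF integrable_continuous_real[OF cz] integrable_continuous_real[OF cz], of a b]
      wn[OF na] wn[OF nb] ne' f_eq by (simp add: right_diff_distrib)
  also have "\<dots> = (LINT t:{t0 - 1/2..t0 + 1/2}|lborel. f t)"
  proof -
    have "continuous_on {t0 - 1/2..t0 + 1/2} (\<lambda>t. loop' t / (loop t - a) - loop' t / (loop t - b))"
      using ne' by (intro continuous_on_diff cz)
    then have "continuous_on {t0 - 1/2..t0 + 1/2} f" by (simp add: f_eq)
    from set_borel_integral_eq_integral(2)[OF borel_integrable_atLeastAtMost'[OF this]] show ?thesis by simp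
  qed
  also have "\<dots> = \<bar>s\<bar> *\<^sub>R (LINT y|lborel. indicat_real {t0 - 1/2..t0 + 1/2} (t0 + s * y) *\<^sub>R f (t0 + s * y))"
    unfolding set_lebesgue_integral_def using s by (intro lborel_integral_real_affine) auto
  also have "\<dots> = (LINT y|lborel. (2 * \<i>) * (indicat_real {-1/2..1/2} (s * y) *\<^sub>R
          (\<tau> * loop' (t0 + s * y) / (((loop (t0 + s * y) - p) / of_real s)\<^sup>2 + \<tau>\<^sup>2))))"
    unfolding integral_scaleR_right[symmetric]
  proof (rule Bochner_Integration.integral_cong[OF refl])
    fix y
    have ind: "indicat_real {t0 - 1/2..t0 + 1/2} (t0 + s * y) = indicat_real {-1/2..1/2} (s * y)"
      by (auto simp: indicator_def)
    define h where "h = loop (t0 + s * y) - p"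
    have sc: "(complex_of_real s)\<^sup>2 * ((h / of_real s)\<^sup>2 + \<tau>\<^sup>2) = h\<^sup>2 + (of_real s * \<tau>)\<^sup>2"
      using s by (simp add: field_simps power2_eq_square)
    have "\<bar>s\<bar> *\<^sub>R f (t0 + s * y) = (complex_of_real s)\<^sup>2 * (2 * \<i> * (\<tau> * loop' (t0 + s * y))) / ((complex_of_real s)\<^sup>2 * ((h / of_real s)\<^sup>2 + \<tau>\<^sup>2))"
      unfolding sc using s by (simp add: f_def h_def scaleR_conv_of_real power2_eq_square)
    also have "\<dots> = 2 * \<i> * (\<tau> * loop' (t0 + s * y) / ((h / of_real s)\<^sup>2 + \<tau>\<^sup>2))"
      using s by simp
    finally show "\<bar>s\<bar> *\<^sub>R (indicat_real {t0 - 1/2..t0 + 1/2} (t0 + s * y) *\<^sub>R f (t0 + s * y))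
      = (2 * \<i>) * (indicat_real {-1/2..1/2} (s * y) *\<^sub>R
          (\<tau> * loop' (t0 + s * y) / (((loop (t0 + s * y) - p) / of_real s)\<^sup>2 + \<tau>\<^sup>2)))"
      unfolding ind h_def by (auto simp: indicator_def)
  qed
  also have "\<dots> = (2 * \<i>) * (LINT y|lborel. indicat_real {-1/2..1/2} (s * y) *\<^sub>R
          (\<tau> * loop' (t0 + s * y) / (((loop (t0 + s * y) - p) / of_real s)\<^sup>2 + \<tau>\<^sup>2)))"
    by (rule integral_mult_right_zero)
  finally show "of_real pi * (winding_number loop a - winding_number loop b)
      = (LINT y|lborel. indicat_real {-1/2..1/2} (s * y) *\<^sub>R
          (loop' t0 * loop' (t0 + s * y) / (((loop (t0 + s * y) - loop t0) / of_real s)\<^sup>2 + (loop' t0)\<^sup>2)))"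
    by (simp add: p_def \<tau>_def)
qed

text \<open>After rescaling the curve looks like its tangent line, and the integrand converges to
  \<open>1 / (1 + y\<^sup>2)\<close> with a multiple of the same function as majorant. The point \<open>a n\<close> lies to the
  left of the curve, where the winding number is larger by one.\<close>
lemma winding_number_jump:
  fixes s :: "nat \<Rightarrow> real" and t0 :: real
  assumes s: "\<And>n. s n > 0" "s \<longlonglongrightarrow> 0"
  defines "a \<equiv> \<lambda>n. loop t0 + \<i> * of_real (s n) * loop' t0" and "b \<equiv> \<lambda>n. loop t0 - \<i> * of_real (s n) * loop' t0"
  shows "\<forall>\<^sub>F n in sequentially. a n \<notin> path_image loop \<and> b n \<notin> path_image loop"
    "(\<lambda>n. winding_number loop (a n) - winding_number loop (b n)) \<longlonglongrightarrow> 1"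
proof -
  define p \<tau> where "p = loop t0" and "\<tau> = loop' t0"
  have \<tau>: "\<tau> \<noteq> 0" using c'_nonzero[of t0] by (simp add: \<tau>_def loop'_def)
  obtain m s0 where m: "m > 0" "s0 > 0" "\<And>x s. \<bar>x\<bar> \<le> 1 / 2 \<Longrightarrow> 0 < s \<Longrightarrow> s < s0 \<Longrightarrow>
       m * (x\<^sup>2 + s\<^sup>2) \<le> norm ((loop (t0 + x) - p)\<^sup>2 + (of_real s * \<tau>)\<^sup>2)"
    unfolding p_def \<tau>_def using loop_separation by blast
  have ev: "\<forall>\<^sub>F n in sequentially. s n < s0"
    using s(2) m(2) by (rule order_tendstoD)
  have nz: "(loop (t0 + x) - loop t0)\<^sup>2 + (of_real r * loop' t0)\<^sup>2 \<noteq> 0" if "\<bar>x\<bar> \<le> 1/2" "0 < r" "r < s0" for x r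
  proof -
    have "0 < m * (x\<^sup>2 + r\<^sup>2)" using m(1) that(2) by (intro mult_pos_pos add_nonneg_pos) auto
    then show ?thesis using m(3)[OF that] by (auto simp: p_def \<tau>_def)
  qed
  show "\<forall>\<^sub>F n in sequentially. a n \<notin> path_image loop \<and> b n \<notin> path_image loop"
    using ev
  proof eventually_elim
    case (elim n)
    show ?case
      using winding_number_difference(1,2)[OF s(1)[of n] nz[OF _ s(1)[of n] elim]] by (auto simp: a_def b_def)
  qed
  define f where "f = (\<lambda>n y. if s n < s0 then indicat_real {-1/2..1/2} (s n * y) *\<^sub>R
          (\<tau> * loop' (t0 + s n * y) / (((loop (t0 + s n * y) - p) / of_real (s n))\<^sup>2 + \<tau>\<^sup>2)) else 0)"
  have "bounded (loop' ` {t0 - 1/2..t0 + 1/2})"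
    by (intro compact_imp_bounded compact_continuous_image continuous_loop) auto
  then obtain M where M: "M > 0" "\<And>t. t \<in> {t0 - 1/2..t0 + 1/2} \<Longrightarrow> norm (loop' t) \<le> M"
    unfolding bounded_pos by auto
  have loopm [measurable]: "loop \<in> borel_measurable borel" "loop' \<in> borel_measurable borel"
    using continuous_loop by (auto intro: borel_measurable_continuous_onI)
  have fm: "f n \<in> borel_measurable lborel" for n
    unfolding f_def by measurable
  have lm: "(\<lambda>y. complex_of_real (1 / (1 + y\<^sup>2))) \<in> borel_measurable lborel" by measurable
  have wi: "integrable lborel (\<lambda>y. norm \<tau> * M / m * (1 / (1 + y\<^sup>2)))"
    by (intro integrable_mult_right inverse_1_plus_square_line)
  have bound: "norm (f n y) \<le> norm \<tau> * M / m * (1 / (1 + y\<^sup>2))" for n y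
  proof (cases "s n < s0 \<and> \<bar>s n * y\<bar> \<le> 1/2")
    case True
    define h where "h = loop (t0 + s n * y) - p"
    have sc: "(complex_of_real (s n))\<^sup>2 * ((h / of_real (s n))\<^sup>2 + \<tau>\<^sup>2) = h\<^sup>2 + (of_real (s n) * \<tau>)\<^sup>2"
      using s(1)[of n] by (simp add: field_simps power2_eq_square)
    have "m * ((s n * y)\<^sup>2 + (s n)\<^sup>2) \<le> norm (h\<^sup>2 + (of_real (s n) * \<tau>)\<^sup>2)"
      unfolding h_def using True s(1)[of n] by (intro m(3)) auto
    also have "\<dots> = (s n)\<^sup>2 * norm ((h / of_real (s n))\<^sup>2 + \<tau>\<^sup>2)"
      unfolding sc[symmetric] norm_mult by (simp add: norm_power)
    also have "m * ((s n * y)\<^sup>2 + (s n)\<^sup>2) = (s n)\<^sup>2 * (m * (1 + y\<^sup>2))"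
      by (simp add: power_mult_distrib algebra_simps)
    finally have lower: "m * (1 + y\<^sup>2) \<le> norm ((h / of_real (s n))\<^sup>2 + \<tau>\<^sup>2)"
      using s(1)[of n] by simp
    have pos: "0 < m * (1 + y\<^sup>2)" using m(1) by (intro mult_pos_pos add_pos_nonneg) auto
    have "norm (loop' (t0 + s n * y)) \<le> M" using True by (intro M(2)) (auto simp: abs_le_iff)
    then have "norm \<tau> * norm (loop' (t0 + s n * y)) / norm ((h / of_real (s n))\<^sup>2 + \<tau>\<^sup>2) \<le> norm \<tau> * M / (m * (1 + y\<^sup>2))"
      using lower pos M(1) by (intro frac_le mult_left_mono mult_nonneg_nonneg) auto
    moreover have "norm (f n y) \<le> norm \<tau> * norm (loop' (t0 + s n * y)) / norm ((h / of_real (s n))\<^sup>2 + \<tau>\<^sup>2)"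
      by (auto simp: f_def h_def indicator_def norm_mult norm_divide)
    ultimately show ?thesis by simp
  next
    case False
    then have "f n y = 0" by (auto simp: f_def indicator_def abs_le_iff)
    then show ?thesis using M(1) m(1) by (simp add: add_nonneg_nonneg)
  qed
  have lim: "(\<lambda>n. f n y) \<longlonglongrightarrow> complex_of_real (1 / (1 + y\<^sup>2))" for y
  proof -
    have sy: "(\<lambda>n. s n * y) \<longlonglongrightarrow> 0" using tendsto_mult_left_zero[OF s(2)] by simp
    have "(\<lambda>n. \<bar>s n * y\<bar>) \<longlonglongrightarrow> 0" using tendsto_rabs_zero[OF sy] .
    then have ev2: "\<forall>\<^sub>F n in sequentially. \<bar>s n * y\<bar> < 1/2"
      by (rule order_tendstoD) simp
    have snz: "s n \<noteq> 0" for n using s(1)[of n] by simp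
    have q: "(\<lambda>n. (loop (t0 + s n * y) - p) / of_real (s n)) \<longlonglongrightarrow> of_real y * \<tau>"
      using difference_quotient_tendsto[OF loop_has_vector_derivative[of t0, unfolded has_vector_derivative_def] s(2) snz, of y]
      by (simp add: p_def \<tau>_def scaleR_conv_of_real divide_inverse mult.commute)
    have "(\<lambda>n. t0 + s n * y) \<longlonglongrightarrow> t0 + 0" by (intro tendsto_intros sy)
    then have l: "(\<lambda>n. loop' (t0 + s n * y)) \<longlonglongrightarrow> \<tau>"
      using continuous_loop(2)[of UNIV] unfolding \<tau>_def
      by (auto simp: continuous_on_eq_continuous_at intro: isCont_tendsto_compose)
    have den: "(of_real y * \<tau>)\<^sup>2 + \<tau>\<^sup>2 = of_real (1 + y\<^sup>2) * \<tau>\<^sup>2" by (simp add: power_mult_distrib algebra_simps)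
    have y0: "1 + y\<^sup>2 \<noteq> 0" by (metis add_pos_nonneg less_irrefl zero_le_power2 zero_less_one)
    have dn: "(of_real y * \<tau>)\<^sup>2 + \<tau>\<^sup>2 \<noteq> 0"
      unfolding den using \<tau> y0 by (simp del: of_real_add)
    have "(\<lambda>n. \<tau> * loop' (t0 + s n * y) / (((loop (t0 + s n * y) - p) / of_real (s n))\<^sup>2 + \<tau>\<^sup>2))
        \<longlonglongrightarrow> \<tau> * \<tau> / ((of_real y * \<tau>)\<^sup>2 + \<tau>\<^sup>2)"
      by (intro tendsto_intros l q dn)
    also have "\<tau> * \<tau> / ((of_real y * \<tau>)\<^sup>2 + \<tau>\<^sup>2) = complex_of_real (1 / (1 + y\<^sup>2))"
      unfolding den using \<tau> by (simp add: power2_eq_square del: of_real_add)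
    finally show ?thesis
    proof (rule Lim_transform_eventually)
      show "\<forall>\<^sub>F n in sequentially. \<tau> * loop' (t0 + s n * y) / (((loop (t0 + s n * y) - p) / of_real (s n))\<^sup>2 + \<tau>\<^sup>2) = f n y"
        using ev ev2
      proof eventually_elim
        case (elim n)
        have "s n * y < 1/2" "- (s n * y) < 1/2" using elim(2) unfolding abs_less_iff by auto
        then have "s n * y \<in> {-1/2..1/2}" by simp
        then show ?case using elim(1) by (simp add: f_def)
      qed
    qed
  qed
  have "(\<lambda>n. LINT y|lborel. f n y) \<longlonglongrightarrow> (LINT y|lborel. complex_of_real (1 / (1 + y\<^sup>2)))"
    by (rule integral_dominated_convergence[OF lm fm wi]) (use lim bound in auto)
  also have "(LINT y|lborel. complex_of_real (1 / (1 + y\<^sup>2))) = of_real pi"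
    using inverse_1_plus_square_line(2) by (simp only: integral_complex_of_real)
  finally have "(\<lambda>n. (LINT y|lborel. f n y) / of_real pi) \<longlonglongrightarrow> of_real pi / of_real pi"
    by (intro tendsto_intros) auto
  then have "(\<lambda>n. (LINT y|lborel. f n y) / of_real pi) \<longlonglongrightarrow> 1" by simp
  then show "(\<lambda>n. winding_number loop (a n) - winding_number loop (b n)) \<longlonglongrightarrow> 1"
  proof (rule Lim_transform_eventually)
    show "\<forall>\<^sub>F n in sequentially. (LINT y|lborel. f n y) / of_real pi = winding_number loop (a n) - winding_number loop (b n)"
      using ev
    proof eventually_elim
      case (elim n)
      show ?case
        using winding_number_difference(3)[OF s(1)[of n] nz[OF _ s(1)[of n] elim]] elim
        by (simp add: a_def b_def f_def p_def \<tau>_def field_simps)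
    qed
  qed
qed

text \<open>A unit normal is the left normal \<open>\<i> c' / \<bar>c'\<bar>\<close> up to a sign. The winding number is \<open>W\<close> on
  the side of \<open>D\<close> and \<open>0\<close> on the other, and it is larger by one on the left, so the left side is
  that of \<open>D\<close> exactly when \<open>W = 1\<close>.\<close>
lemma normal_orientation:
  assumes D: "frontier D = range c" "open D"
    and W: "W = 1 \<or> W = -1" "\<And>x. x \<in> D \<Longrightarrow> winding_number loop (zc x) = of_real W"
      "\<And>x. x \<notin> closure D \<Longrightarrow> winding_number loop (zc x) = 0"
    and n: "norm n = 1" "n \<bullet> c' t = 0" "\<forall>\<^sub>F s in at_right 0. c t + s *\<^sub>R n \<in> D"
  shows "norm (c' t) *\<^sub>R n = W *\<^sub>R vector [- (c' t $ 2), c' t $ 1]"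
proof -
  define N where "N = norm (c' t)"
  define x y a b where "x = n$1" and "y = n$2" and "a = c' t$1" and "b = c' t$2"
  have N: "N > 0" using c'_nonzero by (simp add: N_def)
  have 1: "x * a + y * b = 0" using n(2) by (simp add: x_def y_def a_def b_def inner_vec_def sum_2)
  have 2: "x\<^sup>2 + y\<^sup>2 = 1" using n(1) norm2_sq[of n] by (simp add: x_def y_def)
  have 3: "N\<^sup>2 = a\<^sup>2 + b\<^sup>2" using norm2_sq[of "c' t"] by (simp add: N_def a_def b_def)
  \<comment> \<open>The component of \<open>n\<close> along the left normal; it is 1 or -1 since \<open>n\<close> is a unit vector
    orthogonal to the tangent.\<close>
  define \<sigma> where "\<sigma> = (y * a - x * b) / N"
  have \<sigma>N: "\<sigma> * N = y * a - x * b" using N by (simp add: \<sigma>_def)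
  have e1: "N\<^sup>2 * x = - b * (y * a - x * b)" and e2: "N\<^sup>2 * y = a * (y * a - x * b)"
    unfolding 3 using 1 by (simp_all add: power2_eq_square, algebra+)
  have E: "N * (N * x) = N * (- b * \<sigma>)" "N * (N * y) = N * (a * \<sigma>)"
    using e1 e2 unfolding \<sigma>N[symmetric] by (simp_all add: power2_eq_square mult_ac)
  have Nx: "N * x = - b * \<sigma>" and Ny: "N * y = a * \<sigma>"
    using N iffD1[OF mult_left_cancel E(1)] iffD1[OF mult_left_cancel E(2)] by simp_all
  have "(\<sigma> * N)\<^sup>2 = (x\<^sup>2 + y\<^sup>2) * N\<^sup>2"
    unfolding \<sigma>N 3 using 1 by (simp add: power2_eq_square) algebra
  then have "\<sigma>\<^sup>2 = 1" using 2 N by (simp add: power_mult_distrib)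
  then have \<sigma>: "\<sigma> = 1 \<or> \<sigma> = -1" by (simp add: power2_eq_1_iff)
  have vec: "N *\<^sub>R n = \<sigma> *\<^sub>R vector [- (c' t $ 2), c' t $ 1]"
    using Nx Ny by (simp add: vec_eq_iff forall_2 x_def y_def a_def b_def mult.commute)
  have zN: "zc (N *\<^sub>R n) = \<sigma> *\<^sub>R (\<i> * loop' t)"
    unfolding vec by (simp add: complex_eq_iff loop'_def)
  have zn: "zc (c t + (r * N) *\<^sub>R n) = loop t + of_real \<sigma> * \<i> * of_real r * loop' t" for r
  proof -
    have "zc ((r * N) *\<^sub>R n) = r *\<^sub>R zc (N *\<^sub>R n)" by simp
    then show ?thesis
      unfolding zc_simps(4) zN by (simp add: loop_def scaleR_conv_of_real)
  qed
  define s where "s = (\<lambda>n. inverse (real (Suc n)))"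
  have s: "s n > 0" "s \<longlonglongrightarrow> 0" for n unfolding s_def using LIMSEQ_inverse_real_of_nat by auto
  have "filterlim (\<lambda>n. s n * N) (at_right 0) sequentially"
    unfolding filterlim_at using tendsto_mult_left_zero[OF s(2), of N] s(1) N less_imp_neq[OF s(1), symmetric] by (auto intro!: always_eventually mult_pos_pos)
  then have inD: "\<forall>\<^sub>F k in sequentially. c t + (s k * N) *\<^sub>R n \<in> D"
    by (rule eventually_compose_filterlim[OF n(3)])
  have val: "winding_number loop z = of_real W \<or> winding_number loop z = 0" if "z \<notin> path_image loop" for z
  proof -
    obtain q where q: "z = zc q" using surj_zc by (metis surjD)
    then have "q \<notin> range c" using that by simp
    then have "q \<in> D \<or> q \<notin> closure D" using D(1) closure_Un_frontier[of D] by auto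
    then show ?thesis using W(2,3) q by metis
  qed
  define A B where "A = (\<lambda>n. loop t + \<i> * of_real (s n) * loop' t)" and "B = (\<lambda>n. loop t - \<i> * of_real (s n) * loop' t)"
  have J: "\<forall>\<^sub>F n in sequentially. A n \<notin> path_image loop \<and> B n \<notin> path_image loop"
    "(\<lambda>n. winding_number loop (A n) - winding_number loop (B n)) \<longlonglongrightarrow> 1"
    unfolding A_def B_def by (rule winding_number_jump[OF s])+
  have "(\<lambda>n. dist (winding_number loop (A n) - winding_number loop (B n)) 1) \<longlonglongrightarrow> 0"
    using J(2) by (simp add: tendsto_dist_iff[symmetric])
  then have "\<forall>\<^sub>F n in sequentially. dist (winding_number loop (A n) - winding_number loop (B n)) 1 < 1"
    by (rule order_tendstoD) simp
  then have "\<forall>\<^sub>F k in sequentially. (A k \<notin> path_image loop \<and> B k \<notin> path_image loop) \<and> c t + (s k * N) *\<^sub>R n \<in> D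
      \<and> dist (winding_number loop (A k) - winding_number loop (B k)) 1 < 1"
    using J(1) inD by eventually_elim auto
  then obtain k where k: "A k \<notin> path_image loop" "B k \<notin> path_image loop" "c t + (s k * N) *\<^sub>R n \<in> D"
    "dist (winding_number loop (A k) - winding_number loop (B k)) 1 < 1"
    by (metis (no_types, lifting) eventually_sequentially order_refl)
  \<comment> \<open>Of the two winding numbers, whose difference is close to 1, one is \<open>W\<close> and the other is \<open>W\<close>
    or \<open>0\<close>.\<close>
  from \<sigma> have "\<sigma> = W"
  proof
    assume "\<sigma> = 1"
    then have "winding_number loop (A k) = of_real W" using W(2)[OF k(3)] unfolding zn by (simp add: A_def)
    then show "\<sigma> = W" using val[OF k(2)] k(4) W(1) \<open>\<sigma> = 1\<close> by (auto simp: dist_norm)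
  next
    assume "\<sigma> = -1"
    then have "winding_number loop (B k) = of_real W" using W(2)[OF k(3)] unfolding zn by (simp add: B_def)
    then show "\<sigma> = W" using val[OF k(1)] k(4) W(1) \<open>\<sigma> = -1\<close> by (auto simp: dist_norm)
  qed
  then show ?thesis using vec by (simp add: N_def)
qed

end

text \<open>The orientation \<open>W\<close> of the parametrisation enters twice, through Green's formula and
  through the direction of the normal, and cancels.\<close>
lemma radial_field_normal_trace:
  assumes ob: "obstacle D c" and n: "inward_unit_normal D c n" and v: "C1_test UNIV v vx vy"
  shows "(LINT x|lebesgue_on (- D). (x$1 * vx x + x$2 * vy x) / (norm x)\<^sup>2)
    = arclength_integral c (\<lambda>x. (1 / norm x) * (e_r x \<bullet> n x) * v x)"
proof -
  interpret smooth_loop c using ob by unfold_locales (simp add: obstacle_def)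
  have D: "open D" "connected D" "bounded D" "0 \<in> D" "frontier D = range c"
    using ob by (auto simp: obstacle_def)
  obtain W :: real where W: "W = 1 \<or> W = -1" "\<And>x. x \<in> D \<Longrightarrow> winding_number loop (zc x) = W"
    "\<And>x. x \<notin> closure D \<Longrightarrow> winding_number loop (zc x) = 0"
    using winding_number_obstacle[OF D(1-3) _ D(5)] D(4) by blast
  have or: "norm (c' t) *\<^sub>R n (c t) = W *\<^sub>R vector [- (c' t $ 2), c' t $ 1]" for t
    using n by (intro normal_orientation[OF D(5,1) W]) (auto simp: inward_unit_normal_def c'_def)
  have "(1 / norm (c t)) * (e_r (c t) \<bullet> n (c t)) * v (c t) * norm (c' t)
      = - W * (v (c t) * (c t$1 * c' t$2 - c t$2 * c' t$1) / (norm (c t))\<^sup>2)" for t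
  proof -
    have "e_r (c t) \<bullet> n (c t) * norm (c' t) = e_r (c t) \<bullet> (norm (c' t) *\<^sub>R n (c t))" by simp
    also have "\<dots> = - W * (c t$1 * c' t$2 - c t$2 * c' t$1) / norm (c t)"
      unfolding or by (simp add: e_r_def inner_vec_def sum_2 divide_inverse algebra_simps)
    finally have e: "e_r (c t) \<bullet> n (c t) * norm (c' t) = - W * (c t$1 * c' t$2 - c t$2 * c' t$1) / norm (c t)" .
    have "(1 / norm (c t)) * (e_r (c t) \<bullet> n (c t)) * v (c t) * norm (c' t)
        = (1 / norm (c t)) * v (c t) * (e_r (c t) \<bullet> n (c t) * norm (c' t))" by simp
    then show ?thesis unfolding e by (simp add: power2_eq_square)
  qed
  then have "arclength_integral c (\<lambda>x. (1 / norm x) * (e_r x \<bullet> n x) * v x)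
      = integral {0..1} (\<lambda>t. - W * (v (c t) * (c t$1 * c' t$2 - c t$2 * c' t$1) / (norm (c t))\<^sup>2))"
    unfolding arclength_integral_def c'_def[symmetric] by presburger
  also have "\<dots> = - W * integral {0..1} (\<lambda>t. v (c t) * (c t$1 * c' t$2 - c t$2 * c' t$1) / (norm (c t))\<^sup>2)"
    by (rule Henstock_Kurzweil_Integration.integral_mult_right)
  finally show ?thesis
    using green_exterior[OF v D(4,5,1) W] by simp
qed

section \<open>Compactness of stream functions\<close>

text \<open>A diagonal argument yields convergence on a countable dense set, and equicontinuity
  carries it to all points. Division by \<open>1 + \<bar>x\<bar>\<close> turns the linear growth of the functions into
  a uniform bound.\<close>
lemma equilipschitz_convergent_subsequence:
  fixes f :: "nat \<Rightarrow> 'a::euclidean_space \<Rightarrow> real"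
  assumes lip: "\<And>n x y. \<bar>f n x - f n y\<bar> \<le> L * norm (x - y)" and zero: "\<And>n. f n 0 = 0" and L: "0 \<le> L"
  obtains r :: "nat \<Rightarrow> nat" where "strict_mono r" "\<And>x. convergent (\<lambda>n. f (r n) x)"
proof -
  obtain S :: "'a set" where S: "countable S" "\<And>X. open X \<Longrightarrow> X \<noteq> {} \<Longrightarrow> \<exists>d\<in>S. d \<in> X"
    using countable_dense_exists by blast
  have bd: "norm (f n x / (1 + norm x)) \<le> L" for n x
  proof -
    have "\<bar>f n x\<bar> \<le> L * norm x" using lip[of n x 0] zero by simp
    also have "\<dots> \<le> L * (1 + norm x)" using L by (intro mult_left_mono) auto
    finally show ?thesis by (simp add: divide_le_eq add_pos_nonneg)
  qed
  obtain r :: "nat \<Rightarrow> nat" where r: "strict_mono r" "\<And>x. x \<in> S \<Longrightarrow> \<exists>l. (\<lambda>n. f (r n) x / (1 + norm x)) \<longlonglongrightarrow> l"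
    using function_convergent_subsequence[OF S(1), of "\<lambda>n x. f n x / (1 + norm x)" L] bd by blast
  have "Cauchy (\<lambda>n. f (r n) x)" for x
  proof (rule CauchyI)
    fix e :: real assume e: "0 < e"
    define \<delta> where "\<delta> = e / (4 * (L + 1))"
    have \<delta>: "\<delta> > 0" using e L by (simp add: \<delta>_def)
    obtain d where d: "d \<in> S" "d \<in> ball x \<delta>" using S(2)[of "ball x \<delta>"] \<delta> by auto
    obtain l where "(\<lambda>n. f (r n) d / (1 + norm d)) \<longlonglongrightarrow> l" using r(2)[OF d(1)] by blast
    from tendsto_mult_left[OF this, of "1 + norm d"]
    have "(\<lambda>n. (1 + norm d) * (f (r n) d / (1 + norm d))) \<longlonglongrightarrow> (1 + norm d) * l" .
    moreover have "(1 + norm d) * (f (r n) d / (1 + norm d)) = f (r n) d" for n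
      using norm_ge_zero[of d] by (simp add: add_nonneg_eq_0_iff)
    ultimately have "(\<lambda>n. f (r n) d) \<longlonglongrightarrow> (1 + norm d) * l" by simp
    then have "Cauchy (\<lambda>n. f (r n) d)" by (rule LIMSEQ_imp_Cauchy)
    then obtain N where N: "\<And>m n. N \<le> m \<Longrightarrow> N \<le> n \<Longrightarrow> norm (f (r m) d - f (r n) d) < e / 2"
      using e CauchyD[of "\<lambda>n. f (r n) d" "e / 2"] by auto
    have near: "\<bar>f n x - f n d\<bar> \<le> e / 4" for n
    proof -
      have "norm (x - d) \<le> \<delta>" using d(2) by (simp add: dist_norm)
      then have "L * norm (x - d) \<le> (L + 1) * \<delta>" using L \<delta> by (intro mult_mono) auto
      also have "\<dots> = e / 4" using L by (simp add: \<delta>_def field_simps)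
      finally show ?thesis using lip[of n x d] by linarith
    qed
    show "\<exists>M. \<forall>m\<ge>M. \<forall>n\<ge>M. norm (f (r m) x - f (r n) x) < e"
    proof (intro exI allI impI)
      fix m n assume "N \<le> m" "N \<le> n"
      then show "norm (f (r m) x - f (r n) x) < e"
        using N[of m n] near[of "r m"] near[of "r n"] unfolding real_norm_def by linarith
    qed
  qed
  then show thesis using that[OF r(1)] Cauchy_convergent_iff by blast
qed

text \<open>The square of the positive part of \<open>R\<^sup>2 - \<bar>x - a\<bar>\<^sup>2\<close>, which is continuously
  differentiable.\<close>
lemma C1_test_bump:
  fixes a :: "real^2"
  assumes R: "R > 0" "cball a R \<subseteq> U"
  obtains \<eta> \<eta>x \<eta>y where "C1_test U \<eta> \<eta>x \<eta>y" "\<And>x. x \<notin> cball a R \<Longrightarrow> \<eta> x = 0 \<and> \<eta>x x = 0 \<and> \<eta>y x = 0" "\<And>x. 0 \<le> \<eta> x"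
    "\<And>x. x \<in> ball a (R / 2) \<Longrightarrow> (R\<^sup>2 / 2)\<^sup>2 \<le> \<eta> x"
proof -
  define k where "k = (\<lambda>t::real. (max 0 t)\<^sup>2)"
  have kd: "(k has_real_derivative 2 * max 0 t) (at t)" for t
  proof (cases "t = 0")
    case False
    show ?thesis
    proof (cases "t > 0")
      case True
      have "((\<lambda>t. t\<^sup>2) has_real_derivative 2 * max 0 t) (at t)" using True by (auto intro!: derivative_eq_intros)
      then show ?thesis
        by (rule has_field_derivative_transform_within_open[of _ _ _ "{0<..}"]) (use True in \<open>auto simp: k_def\<close>)
    next
      case F: False
      have "((\<lambda>t. 0) has_real_derivative 2 * max 0 t) (at t)" using F by auto
      then show ?thesis
        by (rule has_field_derivative_transform_within_open[of _ _ _ "{..<0}"]) (use F False in \<open>auto simp: k_def\<close>)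
    qed
  next
    case True
    have "((\<lambda>h. (k (0 + h) - k 0) / h) \<longlongrightarrow> 0) (at 0)"
    proof (rule Lim_null_comparison[OF always_eventually[OF allI]])
      show "norm ((k (0 + h) - k 0) / h) \<le> \<bar>h\<bar>" for h :: real
        by (cases "h > 0") (auto simp: k_def power2_eq_square)
      show "((\<lambda>h::real. \<bar>h\<bar>) \<longlongrightarrow> 0) (at 0)" using tendsto_rabs_zero[OF tendsto_ident_at[of 0 UNIV]] .
    qed
    then show ?thesis using True by (simp add: DERIV_def)
  qed
  define f where "f = (\<lambda>x::real^2. R\<^sup>2 - ((x$1 - a$1) * (x$1 - a$1) + (x$2 - a$2) * (x$2 - a$2)))"
  have n: "f x = R\<^sup>2 - (norm (x - a))\<^sup>2" for x by (simp add: f_def norm_vec2 power2_eq_square)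
  note X = C1_on_diff[OF C1_on_coords(1)[OF open_UNIV] C1_on_const[OF open_UNIV, of "a$1"]]
  note Y = C1_on_diff[OF C1_on_coords(2)[OF open_UNIV] C1_on_const[OF open_UNIV, of "a$2"]]
  obtain fx fy where "C1_on f fx fy UNIV"
    using C1_on_diff[OF C1_on_const[OF open_UNIV, of "R\<^sup>2"] C1_on_add[OF C1_on_mult[OF X X] C1_on_mult[OF Y Y]]]
    unfolding f_def by blast
  moreover have "continuous_on (range f) (\<lambda>t. 2 * max 0 t)" by (intro continuous_intros)
  ultimately have c1: "C1_on (\<lambda>x. k (f x)) (\<lambda>x. 2 * max 0 (f x) * fx x) (\<lambda>x. 2 * max 0 (f x) * fy x) UNIV"
    using C1_on_compose[of f fx fy UNIV k "\<lambda>t. 2 * max 0 t"] kd by blast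
  have zero: "k (f x) = 0 \<and> 2 * max 0 (f x) * fx x = 0 \<and> 2 * max 0 (f x) * fy x = 0" if "x \<notin> cball a R" for x
  proof -
    have "R\<^sup>2 \<le> (norm (x - a))\<^sup>2" using that R(1) by (intro power_mono) (auto simp: dist_norm norm_minus_commute)
    then show ?thesis by (simp add: k_def n)
  qed
  have pos: "0 \<le> k (f x)" for x by (simp add: k_def)
  have big: "(R\<^sup>2 / 2)\<^sup>2 \<le> k (f x)" if "x \<in> ball a (R / 2)" for x
  proof -
    have "(norm (x - a))\<^sup>2 \<le> (R / 2)\<^sup>2" using that by (intro power_mono) (auto simp: dist_norm norm_minus_commute)
    moreover have "(R / 2)\<^sup>2 = R\<^sup>2 / 4" by (simp add: power_divide)
    moreover have "0 \<le> (norm (x - a))\<^sup>2" by simp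
    ultimately have "R\<^sup>2 / 2 \<le> f x" unfolding n by linarith
    then show ?thesis unfolding k_def by (intro power_mono) auto
  qed
  have "C1_test U (\<lambda>x. k (f x)) (\<lambda>x. 2 * max 0 (f x) * fx x) (\<lambda>x. 2 * max 0 (f x) * fy x)"
    unfolding C1_test_def by (intro conjI c1 exI[of _ "cball a R"]) (use R(2) zero in auto)
  then show thesis by (rule that[OF _ zero pos big])
qed

lemma L1_cauchy_of_pointwise:
  fixes \<Phi> :: "nat \<Rightarrow> real^2 \<Rightarrow> real"
  assumes B: "B \<in> lmeasurable" "B \<subseteq> cball 0 R" and cont: "\<And>n. continuous_on UNIV (\<Phi> n)"
    and bd: "\<And>n x. \<bar>\<Phi> n x\<bar> \<le> L * norm x" and conv: "\<And>x. convergent (\<lambda>n. \<Phi> n x)" and e: "e > 0" and L: "0 \<le> L"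
  obtains N where "\<And>i j. N \<le> i \<Longrightarrow> N \<le> j \<Longrightarrow> (LINT x|lebesgue_on B. \<bar>\<Phi> i x - \<Phi> j x\<bar>) < e"
proof -
  define P where "P = (\<lambda>x. lim (\<lambda>n. \<Phi> n x))"
  have lim: "(\<lambda>n. \<Phi> n x) \<longlonglongrightarrow> P x" for x using conv[of x] by (simp add: P_def convergent_LIMSEQ_iff)
  have m: "\<Phi> n \<in> borel_measurable (lebesgue_on B)" for n
    using cont[of n] by (intro measurable_restrict_space1 measurable_completion) (simp add: borel_measurable_continuous_onI)
  then have Pm: "P \<in> borel_measurable (lebesgue_on B)" unfolding P_def by (rule borel_measurable_lim_metric)
  have Rb: "norm x \<le> \<bar>R\<bar>" if "x \<in> B" for x using that B(2) by force
  have bdB: "\<bar>\<Phi> n x\<bar> \<le> L * \<bar>R\<bar>" if "x \<in> B" for n x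
    using bd[of n x] mult_left_mono[OF Rb[OF that] L] by linarith
  have PB: "\<bar>P x\<bar> \<le> L * \<bar>R\<bar>" if "x \<in> B" for x
    using bdB[OF that] by (intro LIMSEQ_le_const2[OF tendsto_rabs[OF lim[of x]]]) auto
  interpret finite_measure "lebesgue_on B" using B(1) by (rule finite_measure_lebesgue_on)
  have int: "integrable (lebesgue_on B) (\<Phi> n)" "integrable (lebesgue_on B) P" for n
    using bdB PB m Pm by (auto intro!: integrable_const_bound[of _ "L * \<bar>R\<bar>"] AE_I2)
  have "(\<lambda>n. LINT x|lebesgue_on B. \<bar>\<Phi> n x - P x\<bar>) \<longlonglongrightarrow> (LINT x|lebesgue_on B. 0)"
  proof (rule integral_dominated_convergence[where w="\<lambda>_. 2 * (L * \<bar>R\<bar>)"])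
    show "AE x in lebesgue_on B. (\<lambda>n. \<bar>\<Phi> n x - P x\<bar>) \<longlonglongrightarrow> 0"
      using tendsto_rabs_zero[OF LIM_zero[OF lim]] by (intro AE_I2) auto
    show "AE x in lebesgue_on B. norm \<bar>\<Phi> n x - P x\<bar> \<le> 2 * (L * \<bar>R\<bar>)" for n
    proof (rule AE_I2)
      fix x assume "x \<in> space (lebesgue_on B)"
      then show "norm \<bar>\<Phi> n x - P x\<bar> \<le> 2 * (L * \<bar>R\<bar>)" using bdB[of x n] PB[of x] by auto
    qed
  qed (use m Pm in auto)
  then have "(\<lambda>n. LINT x|lebesgue_on B. \<bar>\<Phi> n x - P x\<bar>) \<longlonglongrightarrow> 0" by simp
  then have "\<forall>\<^sub>F n in sequentially. (LINT x|lebesgue_on B. \<bar>\<Phi> n x - P x\<bar>) < e / 2"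
    using e by (intro order_tendstoD) auto
  then obtain N where N: "\<And>n. N \<le> n \<Longrightarrow> (LINT x|lebesgue_on B. \<bar>\<Phi> n x - P x\<bar>) < e / 2"
    unfolding eventually_sequentially by blast
  show thesis
  proof (rule that[of N])
    fix i j assume ij: "N \<le> i" "N \<le> j"
    have "(LINT x|lebesgue_on B. \<bar>\<Phi> i x - \<Phi> j x\<bar>) \<le> (LINT x|lebesgue_on B. \<bar>\<Phi> i x - P x\<bar> + \<bar>\<Phi> j x - P x\<bar>)"
      using int by (intro integral_mono) auto
    also have "\<dots> = (LINT x|lebesgue_on B. \<bar>\<Phi> i x - P x\<bar>) + (LINT x|lebesgue_on B. \<bar>\<Phi> j x - P x\<bar>)"
      using int by (intro Bochner_Integration.integral_add) auto
    finally show "(LINT x|lebesgue_on B. \<bar>\<Phi> i x - \<Phi> j x\<bar>) < e" using N[OF ij(1)] N[OF ij(2)] by linarith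
  qed
qed

section \<open>Convergence of velocities\<close>

lemma continuous_on_vec2:
  fixes f :: "'a::topological_space \<Rightarrow> real^2"
  assumes "continuous_on S (\<lambda>x. f x $ 1)" "continuous_on S (\<lambda>x. f x $ 2)"
  shows "continuous_on S f"
proof -
  have "continuous_on S (\<lambda>x. \<chi> i. f x $ i)"
    using assms exhaust_2 by (intro continuous_on_vec_lambda) metis
  then show ?thesis by simp
qed

lemma spiral_stream_continuous:
  assumes "spiral_stream \<gamma> D c \<Phi> \<Phi>x \<Phi>y u"
  shows "continuous_on (- closure D) u"
proof -
  obtain u1x u1y u2x u2y where "C1_on (\<lambda>x. u x$1) u1x u1y (- closure D)" "C1_on (\<lambda>x. u x$2) u2x u2y (- closure D)"
    using assms unfolding spiral_stream_def by blast
  then show ?thesis by (intro continuous_on_vec2 C1_onD(4))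
qed

lemma abs_component_div_norm_sq:
  fixes x :: "real^2"
  assumes "1 \<le> norm x"
  shows "\<bar>x $ i / (norm x)\<^sup>2\<bar> \<le> 1"
proof -
  have "\<bar>x $ i\<bar> \<le> norm x * 1" using component_le_norm_cart[of x i] by simp
  also have "\<dots> \<le> norm x * norm x" using assms by (intro mult_left_mono) auto
  finally have "\<bar>x $ i\<bar> \<le> norm x * norm x" .
  moreover have "0 < norm x * norm x" using assms by (intro mult_pos_pos) auto
  ultimately show ?thesis by (simp add: power2_eq_square abs_mult divide_le_eq)
qed

lemma abs_mult_le: "\<bar>p\<bar> \<le> P \<Longrightarrow> \<bar>q\<bar> \<le> Q \<Longrightarrow> \<bar>p * q\<bar> \<le> P * Q" for p q P Q :: real
  unfolding abs_mult by (rule mult_mono') auto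

text \<open>With \<open>\<delta> = \<Phi> - \<Psi>\<close>, the fluxes differ by the rotated gradient of \<open>\<delta>\<close> plus
  \<open>(c - c2) x / \<bar>x\<bar>\<^sup>2\<close>. Up to terms in which \<open>\<delta>\<close> is not differentiated, the integrand is the
  curl equation of \<open>u - w\<close> tested with \<open>\<eta> \<delta>\<close>, whose integral is zero. The remaining terms
  contain \<open>\<delta>\<close> or \<open>c - c2\<close> and otherwise only bounded factors.\<close>
lemma energy_estimate:
  assumes st: "spiral_stream \<gamma> D c \<Phi> \<Phi>x \<Phi>y u" and st2: "spiral_stream \<gamma> D c2 \<Psi> \<Psi>x \<Psi>y w"
    and \<gamma>: "\<gamma> > 1" and D: "ball 0 1 \<subseteq> D" and B: "cball a R \<subseteq> - closure D"
    and \<eta>: "C1_test (- closure D) \<eta> \<eta>x \<eta>y" and supp': "\<forall>x. x \<notin> cball a R \<longrightarrow> \<eta> x = 0 \<and> \<eta>x x = 0 \<and> \<eta>y x = 0"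
    and bd: "\<And>x. \<bar>\<eta> x\<bar> \<le> L" "\<And>x. \<bar>\<eta>x x\<bar> \<le> L" "\<And>x. \<bar>\<eta>y x\<bar> \<le> L" and L: "0 \<le> L"
  shows "integrable (lebesgue_on (- closure D)) (\<lambda>x. \<eta> x * ((mass_flux \<gamma> (u x) - mass_flux \<gamma> (w x)) \<bullet> (u x - w x)))"
    "(LINT x|lebesgue_on (- closure D). \<eta> x * ((mass_flux \<gamma> (u x) - mass_flux \<gamma> (w x)) \<bullet> (u x - w x)))
      \<le> 4 * L * (LINT x|lebesgue_on (cball a R). \<bar>\<Phi> x - \<Psi> x\<bar>) + 4 * L * \<bar>c - c2\<bar> * measure lebesgue (cball a R)"
proof -
  define U where "U = - closure D"
  note s1 = st[unfolded spiral_stream_def U_def[symmetric]] and s2 = st2[unfolded spiral_stream_def U_def[symmetric]]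
  have U: "open U" unfolding U_def by (rule open_Compl) simp
  have Us: "U \<in> sets lebesgue" using U by auto
  have BU: "cball a R \<subseteq> U" using B by (simp add: U_def)
  have nU: "1 \<le> norm x" if "x \<in> U" for x using that D closure_subset[of D] by (force simp: U_def)
  have 0: "0 \<in> D" using D by auto
  have supp: "\<eta> x = 0 \<and> \<eta>x x = 0 \<and> \<eta>y x = 0" if "x \<notin> cball a R" for x using supp' that by blast
  have C\<Phi>: "C1_on \<Phi> \<Phi>x \<Phi>y U" and C\<Psi>: "C1_on \<Psi> \<Psi>x \<Psi>y U" using s1 s2 by blast+
  have cu: "continuous_on U u" "continuous_on U w"
    using spiral_stream_continuous[OF st] spiral_stream_continuous[OF st2] by (simp_all add: U_def)
  have sub: "norm (u x) \<le> 1" "norm (w x) \<le> 1" if "x \<in> U" for x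
    using s1 s2 that by (meson less_imp_le)+
  have flux: "mass_flux \<gamma> (u x) = vector [\<Phi>y x + c * (x$1 / (norm x)\<^sup>2), - \<Phi>x x + c * (x$2 / (norm x)\<^sup>2)]"
    "mass_flux \<gamma> (w x) = vector [\<Psi>y x + c2 * (x$1 / (norm x)\<^sup>2), - \<Psi>x x + c2 * (x$2 / (norm x)\<^sup>2)]" if "x \<in> U" for x
    using s1 s2 that by blast+
  define \<delta> \<delta>x \<delta>y d1 d2 where "\<delta> = (\<lambda>x. \<Phi> x - \<Psi> x)" and "\<delta>x = (\<lambda>x. \<Phi>x x - \<Psi>x x)" and "\<delta>y = (\<lambda>x. \<Phi>y x - \<Psi>y x)"
    and "d1 = (\<lambda>x. u x $ 1 - w x $ 1)" and "d2 = (\<lambda>x. u x $ 2 - w x $ 2)"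
  have C\<delta>: "C1_on \<delta> \<delta>x \<delta>y U" unfolding \<delta>_def \<delta>x_def \<delta>y_def by (rule C1_on_diff[OF C\<Phi> C\<Psi>])
  note \<eta>U = \<eta>[folded U_def]
  have C\<eta>: "C1_on \<eta> \<eta>x \<eta>y U"
    using \<eta>U U unfolding C1_test_def by (blast intro: C1_on_subset)
  note test = C1_test_mult[OF C\<delta> \<eta>U]
  define tx ty where "tx = (\<lambda>x. \<delta>x x * \<eta> x + \<delta> x * \<eta>x x)" and "ty = (\<lambda>x. \<delta>y x * \<eta> x + \<delta> x * \<eta>y x)"
  note test' = test[folded tx_def ty_def]
  have tsupp: "tx x = 0 \<and> ty x = 0" if "x \<notin> cball a R" for x using supp[OF that] by (simp add: tx_def ty_def)
  have tc: "continuous_on U tx" "continuous_on U ty"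
    using test' U unfolding C1_test_def by (meson C1_onD(2,3) continuous_on_subset subset_UNIV)+
  have comp: "continuous_on U (\<lambda>x. u x $ i)" "continuous_on U (\<lambda>x. w x $ i)" for i
    using cu by (auto intro: continuous_intros)
  have cint: "integrable (lebesgue_on U) f" if "continuous_on U f" "\<And>x. x \<notin> cball a R \<Longrightarrow> f x = 0" for f :: "real^2 \<Rightarrow> real"
    using that BU Us by (intro integrable_continuous_compact_support[of "cball a R"]) (auto intro: continuous_on_subset)
  have i1: "integrable (lebesgue_on U) (\<lambda>x. - (u x $ 2) * tx x + u x $ 1 * ty x)"
    and i2: "integrable (lebesgue_on U) (\<lambda>x. - (w x $ 2) * tx x + w x $ 1 * ty x)"
    using tsupp by (intro cint continuous_intros comp tc; simp)+
  have z: "(LINT x|lebesgue_on U. (- (u x $ 2) * tx x + u x $ 1 * ty x) - (- (w x $ 2) * tx x + w x $ 1 * ty x)) = 0"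
    using spiral_stream_weak_equations(4)[OF st \<gamma> 0 test'[unfolded U_def]]
      spiral_stream_weak_equations(4)[OF st2 \<gamma> 0 test'[unfolded U_def]]
    by (subst Bochner_Integration.integral_diff[OF i1 i2]) (simp add: U_def)
  define I where "I = (\<lambda>x. (- (u x $ 2) * tx x + u x $ 1 * ty x) - (- (w x $ 2) * tx x + w x $ 1 * ty x))"
  have Iint: "integrable (lebesgue_on U) I" "(LINT x|lebesgue_on U. I x) = 0"
    unfolding I_def using z i1 i2 by auto
  define E where "E = (\<lambda>x. \<eta> x * ((mass_flux \<gamma> (u x) - mass_flux \<gamma> (w x)) \<bullet> (u x - w x)))"
  have cflux: "continuous_on U (\<lambda>x. mass_flux \<gamma> (u x))" "continuous_on U (\<lambda>x. mass_flux \<gamma> (w x))"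
    using sub by (auto intro!: continuous_on_compose2[OF continuous_on_mass_flux[OF \<gamma>]] cu)
  have "continuous_on U E"
    unfolding E_def by (intro continuous_intros C1_onD(4)[OF C\<eta>] cflux cu)
  then have Eint: "integrable (lebesgue_on U) E" by (rule cint) (simp add: E_def supp)
  then show "integrable (lebesgue_on (- closure D)) (\<lambda>x. \<eta> x * ((mass_flux \<gamma> (u x) - mass_flux \<gamma> (w x)) \<bullet> (u x - w x)))"
    by (simp add: U_def E_def)
  define r where "r = (\<lambda>x. 4 * L * \<bar>\<delta> x\<bar> + 4 * L * \<bar>c - c2\<bar>)"
  have le: "E x \<le> I x + indicator (cball a R) x * r x" if x: "x \<in> U" for x
  proof (cases "x \<in> cball a R")
    case False
    then show ?thesis using supp tsupp by (simp add: E_def I_def)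
  next
    case True
    have d: "\<bar>d1 x\<bar> \<le> 2" "\<bar>d2 x\<bar> \<le> 2"
      using component_le_norm_cart[of "u x" 1] component_le_norm_cart[of "w x" 1]
        component_le_norm_cart[of "u x" 2] component_le_norm_cart[of "w x" 2] sub[OF x]
      by (auto simp: d1_def d2_def)
    define X1 X2 where "X1 = x$1 / (norm x)\<^sup>2" and "X2 = x$2 / (norm x)\<^sup>2"
    have X: "\<bar>X1\<bar> \<le> 1" "\<bar>X2\<bar> \<le> 1" unfolding X1_def X2_def using abs_component_div_norm_sq[OF nU[OF x]] by blast+
    \<comment> \<open>Adding and subtracting the terms with derivatives of \<open>\<eta>\<close> completes the test function
      \<open>\<eta> \<delta>\<close>.\<close>
    have "E x = \<eta> x * ((\<delta>y x + (c - c2) * X1) * d1 x + (- \<delta>x x + (c - c2) * X2) * d2 x)"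
      unfolding E_def flux[OF x]
      by (simp add: inner_vec_def sum_2 \<delta>y_def \<delta>x_def d1_def d2_def X1_def[symmetric] X2_def[symmetric] algebra_simps)
    also have "\<dots> = I x + (\<delta> x * (d2 x * \<eta>x x) - \<delta> x * (d1 x * \<eta>y x) + (c - c2) * (\<eta> x * (X1 * d1 x)) + (c - c2) * (\<eta> x * (X2 * d2 x)))"
      unfolding I_def tx_def ty_def d1_def d2_def by (simp add: algebra_simps)
    also have "\<dots> \<le> I x + (\<bar>\<delta> x\<bar> * (2 * L) + \<bar>\<delta> x\<bar> * (2 * L) + \<bar>c - c2\<bar> * (L * (1 * 2)) + \<bar>c - c2\<bar> * (L * (1 * 2)))"
    proof -
      have "\<bar>\<delta> x * (d2 x * \<eta>x x)\<bar> \<le> \<bar>\<delta> x\<bar> * (2 * L)" "\<bar>\<delta> x * (d1 x * \<eta>y x)\<bar> \<le> \<bar>\<delta> x\<bar> * (2 * L)"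
        "\<bar>(c - c2) * (\<eta> x * (X1 * d1 x))\<bar> \<le> \<bar>c - c2\<bar> * (L * (1 * 2))" "\<bar>(c - c2) * (\<eta> x * (X2 * d2 x))\<bar> \<le> \<bar>c - c2\<bar> * (L * (1 * 2))"
        by (intro abs_mult_le order_refl d X bd)+
      then show ?thesis by linarith
    qed
    also have "\<dots> = I x + indicator (cball a R) x * r x" using True by (simp add: r_def algebra_simps)
    finally show ?thesis .
  qed
  have B: "cball a R \<in> lmeasurable" by simp
  have "continuous_on (cball a R) \<delta>" using C1_onD(4)[OF C\<delta>] BU continuous_on_subset by blast
  then have "continuous_on (cball a R) r" unfolding r_def by (intro continuous_intros)
  then have rint: "integrable (lebesgue_on U) (\<lambda>x. indicator (cball a R) x * r x)"
    using BU Us by (intro integrable_continuous_compact_support[of "cball a R"]) (auto intro: continuous_on_eq)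
  have \<delta>int: "integrable (lebesgue_on (cball a R)) (\<lambda>x. \<bar>\<delta> x\<bar>)"
    using \<open>continuous_on (cball a R) \<delta>\<close>
    by (intro integrable_continuous_compact_support[of "cball a R"] continuous_intros) auto
  interpret finite_measure "lebesgue_on (cball a R)" using B by (rule finite_measure_lebesgue_on)
  have "(LINT x|lebesgue_on U. E x) \<le> (LINT x|lebesgue_on U. I x + indicator (cball a R) x * r x)"
    using Eint Iint rint le by (intro integral_mono) auto
  also have "\<dots> = (LINT x|lebesgue_on U. indicator (cball a R) x * r x)"
    using Iint rint by (subst Bochner_Integration.integral_add) auto
  also have "\<dots> = (LINT x|lebesgue_on (cball a R). r x)"
  proof -
    have "indicat_real U x *\<^sub>R (indicator (cball a R) x * r x) = indicator (cball a R) x *\<^sub>R r x" for x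
      using BU by (auto simp: indicator_def)
    then have "(LINT x|lebesgue. indicat_real U x *\<^sub>R (indicator (cball a R) x * r x)) = (LINT x|lebesgue. indicator (cball a R) x *\<^sub>R r x)"
      by presburger
    moreover have "(LINT x|lebesgue_on U. indicator (cball a R) x * r x) = (LINT x|lebesgue. indicat_real U x *\<^sub>R (indicator (cball a R) x * r x))"
      using Us by (intro integral_restrict_space) auto
    moreover have "(LINT x|lebesgue_on (cball a R). r x) = (LINT x|lebesgue. indicator (cball a R) x *\<^sub>R r x)"
      by (intro integral_restrict_space) auto
    ultimately show ?thesis by simp
  qed
  also have "\<dots> = 4 * L * (LINT x|lebesgue_on (cball a R). \<bar>\<delta> x\<bar>) + 4 * L * \<bar>c - c2\<bar> * measure lebesgue (cball a R)"
    unfolding r_def using \<delta>int B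
    by (subst Bochner_Integration.integral_add) (auto simp: measure_restrict_space)
  finally show "(LINT x|lebesgue_on (- closure D). \<eta> x * ((mass_flux \<gamma> (u x) - mass_flux \<gamma> (w x)) \<bullet> (u x - w x)))
      \<le> 4 * L * (LINT x|lebesgue_on (cball a R). \<bar>\<Phi> x - \<Psi> x\<bar>) + 4 * L * \<bar>c - c2\<bar> * measure lebesgue (cball a R)"
    by (simp add: U_def E_def \<delta>_def)
qed

lemma spiral_stream_bound:
  assumes "spiral_stream \<gamma> D c \<Phi> \<Phi>x \<Phi>y u" "0 \<in> D"
  shows "\<Phi> 0 = 0" "\<bar>\<Phi> x\<bar> \<le> (1 + c) * norm x" "continuous_on UNIV \<Phi>"
proof -
  have c: "0 \<le> c" using assms(1) unfolding spiral_stream_def by blast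
  have lip: "\<bar>\<Phi> x - \<Phi> y\<bar> \<le> (1 + c) * norm (x - y)" for x y
    using assms(1) unfolding spiral_stream_def by blast
  have "0 \<in> closure D" using assms(2) closure_subset by blast
  then show zero: "\<Phi> 0 = 0" using assms(1) unfolding spiral_stream_def by blast
  show "\<bar>\<Phi> x\<bar> \<le> (1 + c) * norm x" using lip[of x 0] zero by simp
  have "(1 + c)-lipschitz_on UNIV \<Phi>"
    using lip c by (intro lipschitz_onI) (auto simp: dist_norm)
  then show "continuous_on UNIV \<Phi>" by (rule lipschitz_on_continuous_on)
qed

locale stream_sequence =
  fixes \<gamma> :: real and D :: "(real^2) set" and cs :: "nat \<Rightarrow> real" and c :: real
    and \<Phi> \<Phi>x \<Phi>y :: "nat \<Rightarrow> real^2 \<Rightarrow> real" and u :: "nat \<Rightarrow> real^2 \<Rightarrow> real^2"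
  assumes \<gamma>: "\<gamma> > 1" and D: "open D" "bounded D" "ball 0 1 \<subseteq> D"
    and st: "\<And>n. spiral_stream \<gamma> D (cs n) (\<Phi> n) (\<Phi>x n) (\<Phi>y n) (u n)"
    and cs: "cs \<longlonglongrightarrow> c" and conv: "\<And>x. convergent (\<lambda>n. \<Phi> n x)"
begin

lemma D0: "0 \<in> D" using D(3) by auto

lemma speed: "x \<notin> closure D \<Longrightarrow> norm (u n x) < 1"
  using st[of n] unfolding spiral_stream_def by blast

text \<open>The set where two velocities differ by less than \<open>e'\<close> contributes at most \<open>e'\<close> times the
  area; elsewhere uniform monotonicity bounds the difference by a multiple of the energy
  density, whose integral is small by the energy estimate.\<close>
lemma velocity_L1_cauchy:
  assumes R: "R > 0" "cball a R \<subseteq> - closure D" and e: "e > 0"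
  obtains N where "\<And>i j. N \<le> i \<Longrightarrow> N \<le> j \<Longrightarrow> (LINT x|lebesgue_on (ball a (R / 2)). norm (u i x - u j x)) < e"
proof -
  define B where "B = ball a (R / 2)"
  have Bl: "B \<in> lmeasurable" by (simp add: B_def)
  have BR: "B \<subseteq> cball a R" using R(1) by (auto simp: B_def)
  obtain M where M: "\<And>n. norm (cs n) \<le> M"
    using cs convergent_imp_Bseq[of cs] unfolding Bseq_def convergent_def by blast
  have M0: "0 \<le> M" using order_trans[OF norm_ge_zero M] .
  obtain \<eta> \<eta>x \<eta>y where \<eta>: "C1_test (- closure D) \<eta> \<eta>x \<eta>y" "\<And>x. x \<notin> cball a R \<Longrightarrow> \<eta> x = 0 \<and> \<eta>x x = 0 \<and> \<eta>y x = 0" "\<And>x. 0 \<le> \<eta> x"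
    "\<And>x. x \<in> ball a (R / 2) \<Longrightarrow> (R\<^sup>2 / 2)\<^sup>2 \<le> \<eta> x"
    using C1_test_bump[OF R] by metis
  have \<eta>s: "\<forall>x. x \<notin> cball a R \<longrightarrow> \<eta> x = 0 \<and> \<eta>x x = 0 \<and> \<eta>y x = 0" using \<eta>(2) by blast
  obtain L where L: "L \<ge> 0" "\<And>x. \<bar>\<eta>x x\<bar> \<le> L" "\<And>x. \<bar>\<eta>y x\<bar> \<le> L" "\<And>x. \<bar>\<eta> x\<bar> \<le> L"
    using C1_test_lipschitz[OF \<eta>(1)] by metis
  define \<eta>0 where "\<eta>0 = (R\<^sup>2 / 2)\<^sup>2"
  have \<eta>0: "\<eta>0 > 0" using R(1) by (simp add: \<eta>0_def)
  define mB where "mB = measure lebesgue B"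
  \<comment> \<open>The three contributions, from small differences, from the stream functions and from the
    source strengths, get \<open>e / 3\<close> each; adding 1 to the denominators keeps them positive.\<close>
  define e' where "e' = e / (3 * (mB + 1))"
  have mB: "mB \<ge> 0" by (simp add: mB_def)
  have e': "e' > 0" "e' * mB \<le> e / 3" using e mB by (auto simp: e'_def field_simps)
  obtain \<mu> where \<mu>: "\<mu> > 0" "\<And>v w :: real^2. norm v \<le> 1 \<Longrightarrow> norm w \<le> 1 \<Longrightarrow> norm (v - w) \<ge> e' \<Longrightarrow>
       (mass_flux \<gamma> v - mass_flux \<gamma> w) \<bullet> (v - w) \<ge> \<mu>"
    using mass_flux_uniformly_monotone[OF \<gamma> e'(1)] by metis
  define K where "K = 2 / (\<mu> * \<eta>0)"
  have K: "K > 0" using \<mu> \<eta>0 by (simp add: K_def)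
  have pointwise: "norm (v - w) \<le> e' + 2 / \<mu> * ((mass_flux \<gamma> v - mass_flux \<gamma> w) \<bullet> (v - w))"
    if "norm v \<le> 1" "norm w \<le> 1" for v w :: "real^2"
  proof -
    have pos: "0 \<le> (mass_flux \<gamma> v - mass_flux \<gamma> w) \<bullet> (v - w)"
      using mass_flux_strictly_monotone[OF \<gamma> that] by (cases "v = w") auto
    show ?thesis
    proof (cases "norm (v - w) \<ge> e'")
      case True
      have "norm (v - w) \<le> 2" using norm_triangle_ineq4[of v w] that by linarith
      also have "2 = 2 / \<mu> * \<mu>" using \<mu>(1) by simp
      also have "\<dots> \<le> 2 / \<mu> * ((mass_flux \<gamma> v - mass_flux \<gamma> w) \<bullet> (v - w))"
        using \<mu>(1) \<mu>(2)[OF that True] by (intro mult_left_mono) auto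
      finally show ?thesis using e'(1) by linarith
    next
      case False
      then show ?thesis using pos \<mu>(1) by (simp add: add_increasing2)
    qed
  qed
  define mR where "mR = measure lebesgue (cball a R)"
  have mR: "mR \<ge> 0" by (simp add: mR_def)
  define e1 e2 where "e1 = e / (3 * (K * (4 * L) + 1))" and "e2 = e / (3 * (K * (4 * L * mR) + 1))"
  have KL: "0 \<le> K * (4 * L)" "0 \<le> K * (4 * L * mR)" using K L(1) mR by auto
  have e12: "0 < e1" "0 < e2" unfolding e1_def e2_def using e KL by (auto intro!: divide_pos_pos)
  have K1: "K * (4 * L) * e1 < e / 3" "K * (4 * L * mR) * e2 < e / 3"
    using e KL by (simp_all add: e1_def e2_def field_simps)
  obtain N1 where N1: "\<And>i j. N1 \<le> i \<Longrightarrow> N1 \<le> j \<Longrightarrow> (LINT x|lebesgue_on (cball a R). \<bar>\<Phi> i x - \<Phi> j x\<bar>) < e1"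
  proof (rule L1_cauchy_of_pointwise[of "cball a R" "norm a + R" \<Phi> "1 + M" e1])
    show "cball a R \<subseteq> cball 0 (norm a + R)"
    proof
      fix x assume "x \<in> cball a R"
      then show "x \<in> cball 0 (norm a + R)" using norm_triangle_ineq2[of x a] by (simp add: dist_norm norm_minus_commute)
    qed
    show "\<bar>\<Phi> n x\<bar> \<le> (1 + M) * norm x" for n x
      using order_trans[OF spiral_stream_bound(2)[OF st D0] mult_right_mono[of "1 + cs n" "1 + M" "norm x"]] M[of n] by simp
  qed (use spiral_stream_bound(3)[OF st D0] conv e12 M0 in auto)
  have "Cauchy cs" using cs by (rule LIMSEQ_imp_Cauchy)
  then obtain N2 where N2: "\<And>i j. N2 \<le> i \<Longrightarrow> N2 \<le> j \<Longrightarrow> \<bar>cs i - cs j\<bar> < e2"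
    using e12(2) by (metis CauchyD real_norm_def)
  show thesis
  proof (rule that[of "max N1 N2"])
    fix i j assume "max N1 N2 \<le> i" "max N1 N2 \<le> j"
    then have n1: "(LINT x|lebesgue_on (cball a R). \<bar>\<Phi> i x - \<Phi> j x\<bar>) < e1" and n2: "\<bar>cs i - cs j\<bar> < e2"
      using N1[of i j] N2[of i j] by auto
    define E where "E = (\<lambda>x. \<eta> x * ((mass_flux \<gamma> (u i x) - mass_flux \<gamma> (u j x)) \<bullet> (u i x - u j x)))"
    note en = energy_estimate[OF st[of i] st[of j] \<gamma> D(3) R(2) \<eta>(1) \<eta>s L(4,2,3,1), folded E_def mR_def]
    have sub: "norm (u n x) \<le> 1" if "x \<in> cball a R" for n x using speed[of x n] that R(2) by auto
    have Epos: "0 \<le> E x" if "x \<in> cball a R" for x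
      using mass_flux_strictly_monotone[OF \<gamma> sub[OF that, of i] sub[OF that, of j]] \<eta>(3)[of x]
      by (cases "u i x = u j x") (auto simp: E_def)
    have pw: "norm (u i x - u j x) \<le> e' + K * E x" if x: "x \<in> B" for x
    proof -
      have xR: "x \<in> cball a R" using x BR by auto
      define d where "d = (mass_flux \<gamma> (u i x) - mass_flux \<gamma> (u j x)) \<bullet> (u i x - u j x)"
      have d: "0 \<le> d" using mass_flux_strictly_monotone[OF \<gamma> sub[OF xR, of i] sub[OF xR, of j]]
        by (cases "u i x = u j x") (auto simp: d_def)
      have "\<eta>0 * d \<le> \<eta> x * d" using \<eta>(4)[of x] x d by (intro mult_right_mono) (auto simp: B_def \<eta>0_def)
      then have "K * (\<eta>0 * d) \<le> K * E x" using K by (simp add: E_def d_def)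
      moreover have "K * (\<eta>0 * d) = 2 / \<mu> * d" using \<eta>0 by (simp add: K_def)
      ultimately show ?thesis using pointwise[OF sub[OF xR, of i] sub[OF xR, of j]] by (simp add: d_def)
    qed
    have Bs: "B \<in> sets lebesgue" using Bl by auto
    have EB: "integrable (lebesgue_on B) E" "(LINT x|lebesgue_on B. E x) \<le> (LINT x|lebesgue_on (- closure D). E x)"
    proof -
      have Us: "- closure D \<in> sets lebesgue" by simp
      have 1: "integrable lebesgue (\<lambda>x. indicator (- closure D) x *\<^sub>R E x)"
        using en(1) Us by (subst (asm) integrable_restrict_space) auto
      have 2: "indicator B x *\<^sub>R E x = indicator B x *\<^sub>R (indicator (- closure D) x *\<^sub>R E x)" for x
        using BR R(2) by (auto simp: indicator_def)
      have 3: "integrable lebesgue (\<lambda>x. indicator B x *\<^sub>R E x)"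
        unfolding 2 by (rule integrable_mult_indicator[OF Bs 1])
      then show "integrable (lebesgue_on B) E" using Bs by (subst integrable_restrict_space) auto
      have "(LINT x|lebesgue. indicator B x *\<^sub>R E x) \<le> (LINT x|lebesgue. indicator (- closure D) x *\<^sub>R E x)"
      proof (rule integral_mono[OF 3 1])
        show "indicator B x *\<^sub>R E x \<le> indicator (- closure D) x *\<^sub>R E x" for x
          using BR R(2) Epos[of x] \<eta>(2)[of x] by (cases "x \<in> cball a R") (auto simp: indicator_def E_def)
      qed
      then show "(LINT x|lebesgue_on B. E x) \<le> (LINT x|lebesgue_on (- closure D). E x)"
        using Bs Us by (simp add: integral_restrict_space)
    qed
    interpret finite_measure "lebesgue_on B" using Bl by (rule finite_measure_lebesgue_on)
    have cont: "continuous_on B (\<lambda>x. norm (u i x - u j x))"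
      using BR R(2) continuous_on_subset[OF spiral_stream_continuous[OF st]] by (intro continuous_intros) blast+
    have di: "integrable (lebesgue_on B) (\<lambda>x. norm (u i x - u j x))"
    proof (rule integrable_const_bound[of _ 2])
      show "(\<lambda>x. norm (u i x - u j x)) \<in> borel_measurable (lebesgue_on B)"
        using cont Bs by (rule continuous_imp_measurable_on_sets_lebesgue)
      show "AE x in lebesgue_on B. norm (norm (u i x - u j x)) \<le> 2"
      proof (rule AE_I2)
        fix x assume "x \<in> space (lebesgue_on B)"
        then have "x \<in> cball a R" using BR by auto
        then show "norm (norm (u i x - u j x)) \<le> 2"
          using sub[of x i] sub[of x j] norm_triangle_ineq4[of "u i x" "u j x"] by simp
      qed
    qed
    have "(LINT x|lebesgue_on B. norm (u i x - u j x)) \<le> (LINT x|lebesgue_on B. e' + K * E x)"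
      using di EB(1) pw by (intro integral_mono) auto
    also have "\<dots> = e' * mB + K * (LINT x|lebesgue_on B. E x)"
      using EB(1) Bs by (subst Bochner_Integration.integral_add) (auto simp: mB_def measure_restrict_space)
    also have "K * (LINT x|lebesgue_on B. E x)
        \<le> K * (4 * L * (LINT x|lebesgue_on (cball a R). \<bar>\<Phi> i x - \<Phi> j x\<bar>) + 4 * L * \<bar>cs i - cs j\<bar> * mR)"
      using EB(2) en(2) K by (intro mult_left_mono) auto
    also have "\<dots> = K * (4 * L) * (LINT x|lebesgue_on (cball a R). \<bar>\<Phi> i x - \<Phi> j x\<bar>) + K * (4 * L * mR) * \<bar>cs i - cs j\<bar>"
      by (simp add: algebra_simps)
    also have "\<dots> \<le> K * (4 * L) * e1 + K * (4 * L * mR) * e2"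
      using n1 n2 KL by (intro add_mono mult_left_mono) auto
    finally show "(LINT x|lebesgue_on (ball a (R / 2)). norm (u i x - u j x)) < e"
      using e'(2) K1 unfolding B_def by linarith
  qed
qed

end

context stream_sequence
begin

abbreviation (input) U where "U \<equiv> - closure D"

lemma open_U: "open U" by (rule open_Compl) simp

text \<open>On each ball of a countable cover of the exterior, an \<open>L\<^sup>1\<close> Cauchy sequence has a
  subsequence that converges almost everywhere; the diagonal sequence serves all balls at once.\<close>
lemma velocity_ae_convergent_subsequence:
  obtains r :: "nat \<Rightarrow> nat" where "strict_mono r" "AE x in lebesgue. x \<in> U \<longrightarrow> convergent (\<lambda>k. u (r k) x)"
proof -
  define F where "F = {ball a (R / 2) | a R. 0 < R \<and> cball a R \<subseteq> U}"
  obtain F' where F': "F' \<subseteq> F" "countable F'" "\<Union>F' = \<Union>F"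
  proof (rule Lindelof[of F])
    show "open S" if "S \<in> F" for S using that by (auto simp: F_def)
  qed
  have UF: "\<Union>F = U"
  proof
    show "\<Union>F \<subseteq> U"
    proof
      fix x assume "x \<in> \<Union>F"
      then obtain a R where "0 < R" "cball a R \<subseteq> U" "x \<in> ball a (R / 2)" unfolding F_def by blast
      then show "x \<in> U" by force
    qed
    show "U \<subseteq> \<Union>F"
    proof
      fix x assume "x \<in> U"
      then obtain R where "0 < R" "cball x R \<subseteq> U" using open_U open_contains_cball by blast
      moreover have "x \<in> ball x (R / 2)" using \<open>0 < R\<close> by simp
      ultimately show "x \<in> \<Union>F" unfolding F_def by blast
    qed
  qed
  have "closure D \<noteq> UNIV" using bounded_closure[OF D(2)] not_bounded_UNIV by metis
  then have "F' \<noteq> {}" using F' UF by blast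
  define B where "B = from_nat_into F'"
  have B: "range B = F'" unfolding B_def using F'(2) \<open>F' \<noteq> {}\<close> by (rule range_from_nat_into[rotated])
  define P where "P = (\<lambda>n s. AE x in lebesgue. x \<in> B n \<longrightarrow> convergent (\<lambda>k. u (s k) x))"
  interpret subseqs P
  proof
    fix n and s :: "nat \<Rightarrow> nat" assume s: "strict_mono s"
    have "B n \<in> F" using B F' by blast
    then obtain a R where R: "0 < R" "cball a R \<subseteq> U" and Bn: "B n = ball a (R / 2)" unfolding F_def by blast
    have BR: "B n \<subseteq> cball a R" using R(1) by (auto simp: Bn)
    have Bl: "B n \<in> lmeasurable" by (simp add: Bn)
    have Bs: "B n \<in> sets lebesgue" using Bl by auto
    interpret finite_measure "lebesgue_on (B n)" using Bl by (rule finite_measure_lebesgue_on)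
    have int: "integrable (lebesgue_on (B n)) (u (s k))" for k
    proof (rule integrable_const_bound[of _ 1])
      have "continuous_on (B n) (u (s k))"
        using BR R(2) continuous_on_subset[OF spiral_stream_continuous[OF st[of "s k"]]] by blast
      then show "u (s k) \<in> borel_measurable (lebesgue_on (B n))"
        using Bs by (rule continuous_imp_measurable_on_sets_lebesgue)
      show "AE x in lebesgue_on (B n). norm (u (s k) x) \<le> 1"
      proof (rule AE_I2)
        fix x assume "x \<in> space (lebesgue_on (B n))"
        then have "x \<notin> closure D" using BR R(2) by auto
        then show "norm (u (s k) x) \<le> 1" using speed less_imp_le by blast
      qed
    qed
    have cau: "\<exists>N. \<forall>i\<ge>N. \<forall>j\<ge>N. (LINT x|lebesgue_on (B n). norm (u (s i) x - u (s j) x)) < e" if e: "0 < e" for e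
    proof (rule velocity_L1_cauchy[OF R e])
      fix N assume N: "\<And>i j. N \<le> i \<Longrightarrow> N \<le> j \<Longrightarrow> (LINT x|lebesgue_on (ball a (R / 2)). norm (u i x - u j x)) < e"
      show ?thesis
      proof (intro exI allI impI)
        fix i j assume "N \<le> i" "N \<le> j"
        then have "N \<le> s i" "N \<le> s j" using seq_suble[OF s, of i] seq_suble[OF s, of j] by linarith+
        then show "(LINT x|lebesgue_on (B n). norm (u (s i) x - u (s j) x)) < e" unfolding Bn by (rule N)
      qed
    qed
    obtain r' where r': "strict_mono r'" "AE x in lebesgue_on (B n). Cauchy (\<lambda>i. u (s (r' i)) x)"
      by (rule cauchy_L1_AE_cauchy_subseq[OF int cau])
    have "AE x in lebesgue. x \<in> B n \<longrightarrow> Cauchy (\<lambda>i. u (s (r' i)) x)"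
      using r'(2) Bs by (subst (asm) AE_restrict_space_iff) auto
    then have "P n (s \<circ> r')" unfolding P_def by eventually_elim (auto simp: Cauchy_convergent)
    then show "\<exists>r'. strict_mono r' \<and> P n (s \<circ> r')" using r'(1) by blast
  qed
  have "P k (diagseq \<circ> ((+) (Suc k)))" for k
  proof (rule diagseq_holds)
    fix r s :: "nat \<Rightarrow> nat" and n assume r: "strict_mono r" and P: "P n s"
    show "P n (s \<circ> r)"
      using P unfolding P_def
    proof eventually_elim
      case (elim x)
      show ?case using elim convergent_subseq_convergent[of "\<lambda>k. u (s k) x" r] r by (auto simp: o_def)
    qed
  qed
  then have "AE x in lebesgue. \<forall>k. x \<in> B k \<longrightarrow> convergent (\<lambda>j. u ((diagseq \<circ> ((+) (Suc k))) j) x)"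
    unfolding P_def by (simp add: AE_all_countable)
  then have "AE x in lebesgue. x \<in> U \<longrightarrow> convergent (\<lambda>j. u (diagseq j) x)"
  proof eventually_elim
    case (elim x)
    show ?case
    proof
      assume "x \<in> U"
      then have "x \<in> \<Union>F'" using F' UF by blast
      then obtain k where "x \<in> B k" using B by blast
      then have "convergent (\<lambda>j. u (diagseq (j + Suc k)) x)" using elim by (auto simp: o_def add.commute)
      then show "convergent (\<lambda>j. u (diagseq j) x)"
        using convergent_ignore_initial_segment[of "\<lambda>j. u (diagseq j) x" "Suc k"] by simp
    qed
  qed
  then show thesis using that[OF subseq_diagseq] by blast
qed

end

section \<open>Limits of weak equations\<close>

locale stream_limit = stream_sequence +
  assumes ae: "AE x in lebesgue. x \<in> - closure D \<longrightarrow> convergent (\<lambda>k. u k x)"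
begin

text \<open>Velocities are extended by zero over the obstacle, so that the limit is a measurable
  function on the plane.\<close>
definition V :: "nat \<Rightarrow> real^2 \<Rightarrow> real^2" where "V k x = (if x \<in> - closure D then u k x else 0)"
definition ut :: "real^2 \<Rightarrow> real^2" where "ut x = lim (\<lambda>k. V k x)"

lemma U_sets: "- closure D \<in> sets lebesgue" using open_U by auto

lemma V_le: "norm (V k x) \<le> 1"
  using speed[of x k] by (auto simp: V_def intro: less_imp_le)

lemma V_tendsto: "AE x in lebesgue. (\<lambda>k. V k x) \<longlonglongrightarrow> ut x"
  using ae
proof eventually_elim
  case (elim x)
  then have "convergent (\<lambda>k. V k x)" unfolding V_def by (cases "x \<in> - closure D") (auto simp: convergent_const)
  then show ?case by (simp add: ut_def convergent_LIMSEQ_iff)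
qed

lemma ut_le: "AE x in lebesgue. norm (ut x) \<le> 1"
  using V_tendsto
proof eventually_elim
  case (elim x)
  show ?case using tendsto_norm[OF elim] by (rule LIMSEQ_le_const2) (use V_le in auto)
qed

context
  fixes \<Psi> :: "real^2 \<Rightarrow> real"
  assumes \<Psi>: "continuous_on (cball 0 1) \<Psi>"
begin

lemma field_bounded:
  obtains C where "C \<ge> 0" "\<And>w. norm w \<le> 1 \<Longrightarrow> \<bar>\<Psi> w\<bar> \<le> C"
proof -
  have "bounded (\<Psi> ` cball 0 1)" using \<Psi> by (intro compact_imp_bounded compact_continuous_image) auto
  then show thesis using that unfolding bounded_pos by (metis imageI less_imp_le mem_cball_0 real_norm_def)
qed

lemma field_tendsto: "AE x in lebesgue. (\<lambda>k. \<Psi> (V k x)) \<longlonglongrightarrow> \<Psi> (ut x)"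
  using V_tendsto ut_le
proof eventually_elim
  case (elim x)
  show ?case
    by (rule continuous_on_tendsto_compose[OF \<Psi> elim(1)]) (use elim(2) V_le in auto)
qed

lemma field_V_measurable: "(\<lambda>x. \<Psi> (V k x)) \<in> borel_measurable lebesgue"
proof -
  have "continuous_on (- closure D) (\<lambda>x. \<Psi> (u k x))"
  proof (rule continuous_on_compose2[OF \<Psi> spiral_stream_continuous[OF st]])
    show "u k ` (- closure D) \<subseteq> cball 0 1"
    proof
      fix z assume "z \<in> u k ` (- closure D)"
      then obtain x where "x \<notin> closure D" "z = u k x" by blast
      then show "z \<in> cball 0 1" using speed[of x k] by simp
    qed
  qed
  \<comment> \<open>Subtracting \<open>\<Psi> 0\<close> gives a function that vanishes on the obstacle, where \<open>V\<close> is zero.\<close>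
  then have "continuous_on (- closure D) (\<lambda>x. \<Psi> (u k x) - \<Psi> 0)" by (intro continuous_intros)
  then have "(\<lambda>x. \<Psi> (u k x) - \<Psi> 0) \<in> borel_measurable (lebesgue_on (- closure D))"
    using U_sets by (rule continuous_imp_measurable_on_sets_lebesgue)
  then have "(\<lambda>x. if x \<in> - closure D then \<Psi> (u k x) - \<Psi> 0 else 0) \<in> borel_measurable lebesgue"
    using U_sets by (simp only: borel_measurable_if)
  then have "(\<lambda>x. (if x \<in> - closure D then \<Psi> (u k x) - \<Psi> 0 else 0) + \<Psi> 0) \<in> borel_measurable lebesgue"
    by (intro borel_measurable_add borel_measurable_const)
  moreover have "(if x \<in> - closure D then \<Psi> (u k x) - \<Psi> 0 else 0) + \<Psi> 0 = \<Psi> (V k x)" for x by (simp add: V_def)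
  ultimately show ?thesis by simp
qed

lemma field_measurable: "(\<lambda>x. \<Psi> (ut x)) \<in> borel_measurable lebesgue"
proof -
  have "(\<lambda>x. lim (\<lambda>k. \<Psi> (V k x))) \<in> borel_measurable lebesgue"
    using field_V_measurable by (rule borel_measurable_lim_metric)
  moreover have "AE x in lebesgue. lim (\<lambda>k. \<Psi> (V k x)) = \<Psi> (ut x)"
    using field_tendsto by eventually_elim (rule limI)
  ultimately show ?thesis by (rule borel_measurable_AE)
qed

end

text \<open>Every term of the flow equations has the form \<open>\<Psi>(u)\<close> with \<open>\<Psi>\<close> continuous on the closed
  unit disc, hence is bounded and converges almost everywhere.\<close>
lemma weak_limit:
  fixes \<Psi>1 \<Psi>2 :: "real^2 \<Rightarrow> real"
  assumes 1: "continuous_on (cball 0 1) \<Psi>1" and 2: "continuous_on (cball 0 1) \<Psi>2"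
    and vx: "integrable (lebesgue_on (- closure D)) vx" and vy: "integrable (lebesgue_on (- closure D)) vy"
  shows "(\<lambda>k. LINT x|lebesgue_on (- closure D). \<Psi>1 (u k x) * vx x + \<Psi>2 (u k x) * vy x)
    \<longlonglongrightarrow> (LINT x|lebesgue_on (- closure D). \<Psi>1 (ut x) * vx x + \<Psi>2 (ut x) * vy x)"
proof -
  let ?M = "lebesgue_on (- closure D)"
  obtain C1 where C1: "C1 \<ge> 0" "\<And>w. norm w \<le> 1 \<Longrightarrow> \<bar>\<Psi>1 w\<bar> \<le> C1" using field_bounded[OF 1] by metis
  obtain C2 where C2: "C2 \<ge> 0" "\<And>w. norm w \<le> 1 \<Longrightarrow> \<bar>\<Psi>2 w\<bar> \<le> C2" using field_bounded[OF 2] by metis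
  have m: "f \<in> borel_measurable ?M" if "f \<in> borel_measurable lebesgue" for f :: "real^2 \<Rightarrow> real"
    using that by (rule measurable_restrict_space1)
  have ae: "AE x in ?M. Q x" if "AE x in lebesgue. Q x" for Q
    using that U_sets by (subst AE_restrict_space_iff) (auto elim: eventually_mono)
  have "(\<lambda>k. LINT x|?M. \<Psi>1 (V k x) * vx x + \<Psi>2 (V k x) * vy x) \<longlonglongrightarrow> (LINT x|?M. \<Psi>1 (ut x) * vx x + \<Psi>2 (ut x) * vy x)"
  proof (rule integral_dominated_convergence[where w="\<lambda>x. C1 * \<bar>vx x\<bar> + C2 * \<bar>vy x\<bar>"])
    show "(\<lambda>x. \<Psi>1 (ut x) * vx x + \<Psi>2 (ut x) * vy x) \<in> borel_measurable ?M"
      using m[OF field_measurable[OF 1]] m[OF field_measurable[OF 2]] vx vy by measurable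
    show "(\<lambda>x. \<Psi>1 (V k x) * vx x + \<Psi>2 (V k x) * vy x) \<in> borel_measurable ?M" for k
      using m[OF field_V_measurable[OF 1, of k]] m[OF field_V_measurable[OF 2, of k]] vx vy by measurable
    show "integrable ?M (\<lambda>x. C1 * \<bar>vx x\<bar> + C2 * \<bar>vy x\<bar>)" using vx vy by simp
    show "AE x in ?M. (\<lambda>k. \<Psi>1 (V k x) * vx x + \<Psi>2 (V k x) * vy x) \<longlonglongrightarrow> \<Psi>1 (ut x) * vx x + \<Psi>2 (ut x) * vy x"
      using ae[OF field_tendsto[OF 1]] ae[OF field_tendsto[OF 2]]
      by eventually_elim (intro tendsto_intros)
    show "AE x in ?M. norm (\<Psi>1 (V k x) * vx x + \<Psi>2 (V k x) * vy x) \<le> C1 * \<bar>vx x\<bar> + C2 * \<bar>vy x\<bar>" for k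
    proof (rule AE_I2)
      fix x
      have "\<bar>\<Psi>1 (V k x) * vx x\<bar> \<le> C1 * \<bar>vx x\<bar>" "\<bar>\<Psi>2 (V k x) * vy x\<bar> \<le> C2 * \<bar>vy x\<bar>"
        by (intro abs_mult_le C1(2) C2(2) V_le order_refl)+
      then show "norm (\<Psi>1 (V k x) * vx x + \<Psi>2 (V k x) * vy x) \<le> C1 * \<bar>vx x\<bar> + C2 * \<bar>vy x\<bar>"
        unfolding real_norm_def by linarith
    qed
  qed
  moreover have "(LINT x|?M. \<Psi>1 (V k x) * vx x + \<Psi>2 (V k x) * vy x) = (LINT x|?M. \<Psi>1 (u k x) * vx x + \<Psi>2 (u k x) * vy x)" for k
    by (rule Bochner_Integration.integral_cong) (auto simp: V_def)
  ultimately show ?thesis by simp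
qed

lemma vector_field_measurable:
  fixes \<Psi>1 \<Psi>2 :: "real^2 \<Rightarrow> real"
  assumes 1: "continuous_on (cball 0 1) \<Psi>1" and 2: "continuous_on (cball 0 1) \<Psi>2"
  shows "(\<lambda>x. vector [\<Psi>1 (ut x), \<Psi>2 (ut x)] :: real^2) \<in> borel_measurable lebesgue"
    and "\<exists>C. AE x in lebesgue. norm (vector [\<Psi>1 (ut x), \<Psi>2 (ut x)] :: real^2) \<le> C"
proof -
  have eq: "vector [\<Psi>1 (ut x), \<Psi>2 (ut x)] = \<Psi>1 (ut x) *\<^sub>R axis 1 1 + \<Psi>2 (ut x) *\<^sub>R (axis 2 1 :: real^2)" for x
    by (simp add: vec_eq_iff forall_2 axis_def)
  show "(\<lambda>x. vector [\<Psi>1 (ut x), \<Psi>2 (ut x)] :: real^2) \<in> borel_measurable lebesgue"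
    unfolding eq by (intro borel_measurable_add borel_measurable_scaleR borel_measurable_const field_measurable 1 2)
  obtain C1 where C1: "\<And>w. norm w \<le> 1 \<Longrightarrow> \<bar>\<Psi>1 w\<bar> \<le> C1" using field_bounded[OF 1] by metis
  obtain C2 where C2: "\<And>w. norm w \<le> 1 \<Longrightarrow> \<bar>\<Psi>2 w\<bar> \<le> C2" using field_bounded[OF 2] by metis
  have "AE x in lebesgue. norm (vector [\<Psi>1 (ut x), \<Psi>2 (ut x)] :: real^2) \<le> C1 + C2"
    using ut_le
  proof eventually_elim
    case (elim x)
    have "norm (vector [\<Psi>1 (ut x), \<Psi>2 (ut x)] :: real^2) \<le> \<bar>\<Psi>1 (ut x)\<bar> + \<bar>\<Psi>2 (ut x)\<bar>"
      unfolding eq by (rule order_trans[OF norm_triangle_ineq]) simp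
    then show ?case using C1[OF elim] C2[OF elim] by linarith
  qed
  then show "\<exists>C. AE x in lebesgue. norm (vector [\<Psi>1 (ut x), \<Psi>2 (ut x)] :: real^2) \<le> C" by blast
qed

lemma distr_div_free_limit:
  fixes \<Psi>1 \<Psi>2 :: "real^2 \<Rightarrow> real"
  assumes 1: "continuous_on (cball 0 1) \<Psi>1" and 2: "continuous_on (cball 0 1) \<Psi>2"
    and weak: "\<And>k v vx vy. C1_test (- closure D) v vx vy \<Longrightarrow>
      (LINT x|lebesgue_on (- closure D). \<Psi>1 (u k x) * vx x + \<Psi>2 (u k x) * vy x) = 0"
  shows "distr_div_free (interior (- D)) (\<lambda>x. vector [\<Psi>1 (ut x), \<Psi>2 (ut x)])"
  unfolding distr_div_free_def interior_complement
proof (intro conjI allI impI)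
  fix K :: "(real^2) set" assume K: "compact K \<and> K \<subseteq> - closure D"
  then have Kl: "K \<in> lmeasurable" using lmeasurable_compact by blast
  interpret finite_measure "lebesgue_on K" using Kl by (rule finite_measure_lebesgue_on)
  obtain C where C: "AE x in lebesgue. norm (vector [\<Psi>1 (ut x), \<Psi>2 (ut x)] :: real^2) \<le> C"
    using vector_field_measurable(2)[OF 1 2] by blast
  show "integrable (lebesgue_on K) (\<lambda>x. vector [\<Psi>1 (ut x), \<Psi>2 (ut x)] :: real^2)"
  proof (rule integrable_const_bound)
    show "AE x in lebesgue_on K. norm (vector [\<Psi>1 (ut x), \<Psi>2 (ut x)] :: real^2) \<le> C"
      using C Kl by (subst AE_restrict_space_iff) (auto elim: eventually_mono)
    show "(\<lambda>x. vector [\<Psi>1 (ut x), \<Psi>2 (ut x)] :: real^2) \<in> borel_measurable (lebesgue_on K)"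
      using vector_field_measurable(1)[OF 1 2] by (rule measurable_restrict_space1)
  qed
next
  fix v assume v: "test_function (- closure D) v"
  obtain vx vy where t: "C1_test (- closure D) v vx vy" and gr: "\<And>x. grad v x = vector [vx x, vy x]"
    using test_function_C1[OF v] by metis
  have "(\<lambda>k. LINT x|lebesgue_on (- closure D). \<Psi>1 (u k x) * vx x + \<Psi>2 (u k x) * vy x)
    \<longlonglongrightarrow> (LINT x|lebesgue_on (- closure D). \<Psi>1 (ut x) * vx x + \<Psi>2 (ut x) * vy x)"
    by (rule weak_limit[OF 1 2 C1_test_integrable(2,3)[OF t open_U]])
  then have "(LINT x|lebesgue_on (- closure D). \<Psi>1 (ut x) * vx x + \<Psi>2 (ut x) * vy x) = 0"
    unfolding weak[OF t] by (simp add: LIMSEQ_const_iff)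
  then show "(LINT x|lebesgue_on (- closure D). vector [\<Psi>1 (ut x), \<Psi>2 (ut x)] \<bullet> grad v x) = 0"
    by (simp add: gr inner_vec_def sum_2)
qed

end

section \<open>The subsonic-sonic limit\<close>

lemma strictly_decreasing_sequence:
  assumes E: "E \<subseteq> {0<..}" "(0::real) islimpt E"
  obtains e :: "nat \<Rightarrow> real" where "\<And>n. e n \<in> E" "\<And>n. e (Suc n) < e n" "e \<longlonglongrightarrow> 0"
proof -
  have below: "\<exists>y\<in>E. y < b" if "0 < b" for b
    using islimptE[OF E(2), of "{-b<..<b}"] that by auto
  have "\<exists>e. \<forall>n. (e n \<in> E \<and> e n < inverse (real (Suc n))) \<and> e (Suc n) < e n"
  proof (rule dependent_nat_choice)
    show "\<exists>x. x \<in> E \<and> x < inverse (real (Suc 0))" using below[of 1] by auto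
    fix x n assume x: "x \<in> E \<and> x < inverse (real (Suc n))"
    then have "0 < min x (inverse (real (Suc (Suc n))))" using E(1) by auto
    from below[OF this] show "\<exists>y. (y \<in> E \<and> y < inverse (real (Suc (Suc n)))) \<and> y < x" by auto
  qed
  then obtain e where e: "\<And>n. e n \<in> E" "\<And>n. e n < inverse (real (Suc n))" "\<And>n. e (Suc n) < e n" by blast
  have "e \<longlonglongrightarrow> 0"
  proof (rule tendsto_sandwich[OF _ _ tendsto_const LIMSEQ_inverse_real_of_nat])
    show "\<forall>\<^sub>F n in sequentially. 0 \<le> e n"
      using e(1) E(1) by (intro always_eventually allI) (meson greaterThan_iff less_imp_le subsetD)
    show "\<forall>\<^sub>F n in sequentially. e n \<le> inverse (real (Suc n))"
      using e(2) by (intro always_eventually allI less_imp_le)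
  qed
  then show thesis using that e by blast
qed

text \<open>For limiting parameters with \<open>\<kappa>\<^sub>1\<^sup>2 + \<kappa>\<^sub>2\<^sup>2 = 1\<close> the background density is still given by
  \<open>g\<close>, which is continuous up to the sonic speed.\<close>
lemma tendsto_source_strength:
  assumes \<gamma>: "\<gamma> > 1" and k: "k \<longlonglongrightarrow> \<kappa>t" and sub: "\<And>n. (k n)\<^sup>2 + \<kappa>2\<^sup>2 < 1"
  shows "(\<lambda>n. rho0 \<gamma> (k n) \<kappa>2 * k n) \<longlonglongrightarrow> rho0 \<gamma> \<kappa>t \<kappa>2 * \<kappa>t"
proof -
  have s: "(\<lambda>n. (k n)\<^sup>2 + \<kappa>2\<^sup>2) \<longlonglongrightarrow> \<kappa>t\<^sup>2 + \<kappa>2\<^sup>2" by (intro tendsto_intros k)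
  have le: "\<kappa>t\<^sup>2 + \<kappa>2\<^sup>2 \<le> 1" using s by (rule LIMSEQ_le_const2) (use sub less_imp_le in blast)
  have "(\<lambda>n. g \<gamma> ((k n)\<^sup>2 + \<kappa>2\<^sup>2)) \<longlonglongrightarrow> g \<gamma> (\<kappa>t\<^sup>2 + \<kappa>2\<^sup>2)"
    by (rule continuous_on_tendsto_compose[OF continuous_on_g[OF \<gamma>] s]) (auto intro!: always_eventually le less_imp_le sub)
  then show ?thesis
    using rho0_eq_g[OF \<gamma> le] rho0_eq_g[OF \<gamma> less_imp_le[OF sub]] by (auto intro!: tendsto_mult k)
qed

lemma arclength_integral_cmult: "arclength_integral c (\<lambda>x. a * f x) = a * arclength_integral c f"
  unfolding arclength_integral_def by (simp only: mult.assoc Henstock_Kurzweil_Integration.integral_mult_right)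

context stream_limit
begin

text \<open>For each approximating flow the trace identity is proportional to its source strength,
  with a factor that depends on \<open>v\<close> and the curve alone; so it passes to the limit with the
  source strengths.\<close>
lemma limit_normal_trace:
  assumes ob: "obstacle D cv" and n: "inward_unit_normal D cv n"
  shows "has_normal_trace (- D) cv (\<lambda>x. g \<gamma> ((norm (ut x))\<^sup>2) *\<^sub>R ut x) (\<lambda>x. (c / norm x) * (e_r x \<bullet> n x))"
proof -
  define F where "F = (\<lambda>x. g \<gamma> ((norm (ut x))\<^sup>2) *\<^sub>R ut x)"
  define \<Psi> where "\<Psi> = (\<lambda>i (w::real^2). g \<gamma> ((norm w)\<^sup>2) * w $ i)"
  have c\<Psi>: "continuous_on (cball 0 1) (\<Psi> i)" for i
    unfolding \<Psi>_def by (intro continuous_intros continuous_on_density \<gamma>)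
  have F: "F = (\<lambda>x. vector [\<Psi> 1 (ut x), \<Psi> 2 (ut x)])"
    by (auto simp: F_def \<Psi>_def fun_eq_iff vec_eq_iff forall_2)
  have flux: "mass_flux \<gamma> w $ i = \<Psi> i w" for w i by (simp add: mass_flux_def \<Psi>_def)
  interpret L: smooth_loop cv using ob by unfold_locales (simp add: obstacle_def)
  have null: "frontier D \<in> null_sets lebesgue" using L.range_c_null ob by (simp add: obstacle_def)
  have Ds: "- D \<in> sets lebesgue" using D(1) by auto
  have 1: "F \<in> borel_measurable (lebesgue_on (- D))"
    unfolding F by (rule measurable_restrict_space1[OF vector_field_measurable(1)[OF c\<Psi> c\<Psi>]])
  obtain C where C: "AE x in lebesgue. norm (F x) \<le> C" unfolding F using vector_field_measurable(2)[OF c\<Psi> c\<Psi>] by blast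
  have 2: "AE x in lebesgue_on (- D). norm (F x) \<le> C"
    using C Ds by (subst AE_restrict_space_iff) (auto elim: eventually_mono)
  have 3: "distr_div_free (interior (- D)) F"
    unfolding F
    using spiral_stream_weak_equations(1)[OF st \<gamma> D0] by (intro distr_div_free_limit c\<Psi>) (simp add: flux)
  have 4: "(LINT x|lebesgue_on (- D). F x \<bullet> grad v x) = arclength_integral cv (\<lambda>x. (c / norm x) * (e_r x \<bullet> n x) * v x)"
    if v: "test_function UNIV v" for v
  proof -
    obtain vx vy vxx vxy vyx vyy where t: "C1_test UNIV v vx vy" and gr: "\<And>x. grad v x = vector [vx x, vy x]"
      and t2: "C1_test UNIV vx vxx vxy" "C1_test UNIV vy vyx vyy"
      using test_function_C1[OF v] by metis
    define T where "T = arclength_integral cv (\<lambda>x. (1 / norm x) * (e_r x \<bullet> n x) * v x)"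
    have int: "integrable (lebesgue_on (- closure D)) vx" "integrable (lebesgue_on (- closure D)) vy"
      using integrable_mult_indicator[OF U_sets C1_test_integrable(2)[OF t open_UNIV, unfolded lebesgue_on_UNIV_eq]]
        integrable_mult_indicator[OF U_sets C1_test_integrable(3)[OF t open_UNIV, unfolded lebesgue_on_UNIV_eq]] U_sets
      by (auto simp: integrable_restrict_space lebesgue_on_UNIV_eq)
    have "(\<lambda>k. LINT x|lebesgue_on (- closure D). \<Psi> 1 (u k x) * vx x + \<Psi> 2 (u k x) * vy x)
      \<longlonglongrightarrow> (LINT x|lebesgue_on (- closure D). \<Psi> 1 (ut x) * vx x + \<Psi> 2 (ut x) * vy x)"
      by (rule weak_limit[OF c\<Psi> c\<Psi> int])
    moreover have "(LINT x|lebesgue_on (- closure D). \<Psi> 1 (u k x) * vx x + \<Psi> 2 (u k x) * vy x) = cs k * T" for k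
      using spiral_stream_normal_trace[OF st D(1) D0 null t t2, of k] radial_field_normal_trace[OF ob n t]
      by (simp add: flux T_def)
    moreover have "(\<lambda>k. cs k * T) \<longlonglongrightarrow> c * T" by (intro tendsto_intros cs)
    ultimately have "(LINT x|lebesgue_on (- closure D). \<Psi> 1 (ut x) * vx x + \<Psi> 2 (ut x) * vy x) = c * T"
      using LIMSEQ_unique by auto
    moreover have "F x \<bullet> grad v x = \<Psi> 1 (ut x) * vx x + \<Psi> 2 (ut x) * vy x" for x
      unfolding F gr by (simp add: inner_vec_def sum_2)
    moreover have "(LINT x|lebesgue_on (- D). F x \<bullet> grad v x) = (LINT x|lebesgue_on (- closure D). F x \<bullet> grad v x)"
    proof -
      have "(LINT x|lebesgue. indicator (- D) x *\<^sub>R (F x \<bullet> grad v x)) = (LINT x|lebesgue. indicator (- closure D) x *\<^sub>R (F x \<bullet> grad v x))"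
      proof (rule integral_lebesgue_cong_AE)
        show "AE x in lebesgue. indicator (- D) x *\<^sub>R (F x \<bullet> grad v x) = indicator (- closure D) x *\<^sub>R (F x \<bullet> grad v x)"
          using AE_not_in[OF null]
        proof eventually_elim
          case (elim x)
          then show ?case using closure_Un_frontier[of D] by (auto simp: indicator_def)
        qed
      qed
      then show ?thesis using Ds U_sets by (simp add: integral_restrict_space)
    qed
    moreover have "arclength_integral cv (\<lambda>x. (c / norm x) * (e_r x \<bullet> n x) * v x) = c * T"
      unfolding T_def arclength_integral_cmult[symmetric] by (rule arg_cong[where f="arclength_integral cv"]) auto
    ultimately show ?thesis by simp
  qed
  show ?thesis
    unfolding has_normal_trace_def F_def[symmetric] using 1 2 3 4 by blast
qed

end

theorem theorem1p4:
  fixes D :: "(real^2) set" and c :: "real \<Rightarrow> real^2" and n :: "real^2 \<Rightarrow> real^2"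
    and \<gamma> \<kappa>2 \<kappa>t :: real and E :: "real set" and \<kappa>1 :: "real \<Rightarrow> real"
    and u :: "real \<Rightarrow> real^2 \<Rightarrow> real^2"
  assumes D: "obstacle D c" and n: "inward_unit_normal D c n"
    and \<gamma>: "\<gamma> > 1" and \<kappa>2: "-1 < \<kappa>2" "\<kappa>2 < 1"
    and threshold: "is_threshold D \<gamma> \<kappa>2 \<kappa>t" "\<kappa>t > 0"
    and E: "E \<subseteq> {0<..}" "0 islimpt E"
    and \<kappa>1: "\<And>\<epsilon>. \<epsilon> \<in> E \<Longrightarrow> \<kappa>1 \<epsilon> < \<kappa>t" "(\<kappa>1 \<longlongrightarrow> \<kappa>t) (at 0 within E)"
    and u: "\<And>\<epsilon>. \<epsilon> \<in> E \<Longrightarrow> uniformly_subsonic_spiral_flow D \<gamma> (\<kappa>1 \<epsilon>) \<kappa>2 (u \<epsilon>)"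
  shows "\<exists>\<epsilon> :: nat \<Rightarrow> real. \<exists>ut :: real^2 \<Rightarrow> real^2. \<exists>\<rho>t pt :: real^2 \<Rightarrow> real.
    range \<epsilon> \<subseteq> E \<and> (\<forall>k. \<epsilon> (Suc k) < \<epsilon> k) \<and> \<epsilon> \<longlonglongrightarrow> 0 \<and>
    (\<forall>x. \<rho>t x = g \<gamma> ((norm (ut x))\<^sup>2)) \<and> (\<forall>x. pt x = \<rho>t x powr \<gamma> / \<gamma>) \<and>
    (AE x in lebesgue_on (- D).
      (\<lambda>k. u (\<epsilon> k) x $ 1) \<longlonglongrightarrow> ut x $ 1 \<and>
      (\<lambda>k. u (\<epsilon> k) x $ 2) \<longlonglongrightarrow> ut x $ 2 \<and>
      (\<lambda>k. g \<gamma> ((norm (u (\<epsilon> k) x))\<^sup>2) * u (\<epsilon> k) x $ 1) \<longlonglongrightarrow> \<rho>t x * ut x $ 1 \<and>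
      (\<lambda>k. g \<gamma> ((norm (u (\<epsilon> k) x))\<^sup>2) * u (\<epsilon> k) x $ 2) \<longlonglongrightarrow> \<rho>t x * ut x $ 2) \<and>
    (AE x in lebesgue_on (- D). norm (ut x) \<le> 1) \<and>
    distr_div_free (interior (- D)) (\<lambda>x. vector [\<rho>t x * ut x $ 1, \<rho>t x * ut x $ 2]) \<and>
    distr_div_free (interior (- D))
      (\<lambda>x. vector [\<rho>t x * (ut x $ 1)\<^sup>2 + pt x, \<rho>t x * ut x $ 1 * ut x $ 2]) \<and>
    distr_div_free (interior (- D))
      (\<lambda>x. vector [\<rho>t x * ut x $ 1 * ut x $ 2, \<rho>t x * (ut x $ 2)\<^sup>2 + pt x]) \<and>
    distr_div_free (interior (- D)) (\<lambda>x. vector [- (ut x $ 2), ut x $ 1]) \<and>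
    has_normal_trace (- D) c (\<lambda>x. \<rho>t x *\<^sub>R ut x)
      (\<lambda>x. (rho0 \<gamma> \<kappa>t \<kappa>2 * \<kappa>t / norm x) * (e_r x \<bullet> n x))"
proof -
  have Dp: "open D" "bounded D" "ball 0 1 \<subseteq> D" "frontier D = range c" using D by (auto simp: obstacle_def)
  then have D0: "0 \<in> D" by auto
  obtain e :: "nat \<Rightarrow> real" where e: "\<And>n. e n \<in> E" "\<And>n. e (Suc n) < e n" "e \<longlonglongrightarrow> 0"
    using strictly_decreasing_sequence[OF E] by metis
  define k where "k = (\<lambda>n. \<kappa>1 (e n))"
  define cs where "cs = (\<lambda>n. rho0 \<gamma> (k n) \<kappa>2 * k n)"
  define ct where "ct = rho0 \<gamma> \<kappa>t \<kappa>2 * \<kappa>t"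
  have "\<exists>\<Phi> \<Phi>x \<Phi>y. (k n)\<^sup>2 + \<kappa>2\<^sup>2 < 1 \<and> spiral_stream \<gamma> D (cs n) \<Phi> \<Phi>x \<Phi>y (u (e n))" for n
    unfolding cs_def k_def by (rule spiral_stream_of_flow[OF D \<gamma> u[OF e(1)[of n]]]) blast
  then obtain \<Phi> \<Phi>x \<Phi>y where sub: "\<And>n. (k n)\<^sup>2 + \<kappa>2\<^sup>2 < 1"
    and st: "\<And>n. spiral_stream \<gamma> D (cs n) (\<Phi> n) (\<Phi>x n) (\<Phi>y n) (u (e n))" by metis
  have "filterlim e (at 0 within E) sequentially"
  proof -
    have "e i \<noteq> 0" for i using e(1)[of i] E(1) by auto
    then show ?thesis unfolding filterlim_at using e(1,3) by (auto intro!: always_eventually)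
  qed
  then have klim: "k \<longlonglongrightarrow> \<kappa>t" unfolding k_def by (rule filterlim_compose[OF \<kappa>1(2)])
  have cslim: "cs \<longlonglongrightarrow> ct" unfolding cs_def ct_def by (rule tendsto_source_strength[OF \<gamma> klim sub])
  obtain M where M: "\<And>n. norm (cs n) \<le> M"
    using cslim convergent_imp_Bseq[of cs] unfolding Bseq_def convergent_def by blast
  have M0: "0 \<le> M" using order_trans[OF norm_ge_zero M] .
  have lip: "\<bar>\<Phi> n x - \<Phi> n y\<bar> \<le> (1 + M) * norm (x - y)" for n x y
  proof -
    have "\<bar>\<Phi> n x - \<Phi> n y\<bar> \<le> (1 + cs n) * norm (x - y)" using st[of n] unfolding spiral_stream_def by blast
    also have "\<dots> \<le> (1 + M) * norm (x - y)" using M[of n] by (intro mult_right_mono) auto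
    finally show ?thesis .
  qed
  \<comment> \<open>Along \<open>r\<close> the stream functions converge; along the further subsequence \<open>q\<close> the velocities
    do.\<close>
  have "\<exists>r. strict_mono r \<and> (\<forall>x. convergent (\<lambda>n. \<Phi> (r n) x))"
  proof (rule equilipschitz_convergent_subsequence[of \<Phi> "1 + M", OF lip spiral_stream_bound(1)[OF st D0]])
    show "0 \<le> 1 + M" using M0 by simp
  qed blast
  then obtain r :: "nat \<Rightarrow> nat" where r: "strict_mono r" "\<And>x. convergent (\<lambda>n. \<Phi> (r n) x)" by blast
  have rlim: "(\<lambda>n. cs (r n)) \<longlonglongrightarrow> ct" using LIMSEQ_subseq_LIMSEQ[OF cslim r(1)] by (simp add: o_def)
  have S: "stream_sequence \<gamma> D (\<lambda>n. cs (r n)) ct (\<lambda>n. \<Phi> (r n)) (\<lambda>n. \<Phi>x (r n)) (\<lambda>n. \<Phi>y (r n)) (\<lambda>n. u (e (r n)))"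
  proof unfold_locales
    show "\<gamma> > 1" by (rule \<gamma>)
    show "open D" "bounded D" "ball 0 1 \<subseteq> D" by (rule Dp)+
    show "spiral_stream \<gamma> D (cs (r n)) (\<Phi> (r n)) (\<Phi>x (r n)) (\<Phi>y (r n)) (u (e (r n)))" for n by (rule st)
    show "(\<lambda>n. cs (r n)) \<longlonglongrightarrow> ct" by (rule rlim)
    show "convergent (\<lambda>n. \<Phi> (r n) x)" for x by (rule r(2))
  qed
  obtain q :: "nat \<Rightarrow> nat" where q: "strict_mono q" "AE x in lebesgue. x \<in> - closure D \<longrightarrow> convergent (\<lambda>k. u (e (r (q k))) x)"
    by (rule stream_sequence.velocity_ae_convergent_subsequence[OF S])
  interpret L: stream_limit \<gamma> D "\<lambda>n. cs (r (q n))" ct "\<lambda>n. \<Phi> (r (q n))" "\<lambda>n. \<Phi>x (r (q n))" "\<lambda>n. \<Phi>y (r (q n))" "\<lambda>n. u (e (r (q n)))"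
  proof unfold_locales
    show "(\<lambda>n. cs (r (q n))) \<longlonglongrightarrow> ct" using LIMSEQ_subseq_LIMSEQ[OF rlim q(1)] by (simp add: o_def)
    show "convergent (\<lambda>n. \<Phi> (r (q n)) x)" for x
      using convergent_subseq_convergent[OF r(2) q(1)] by (simp add: o_def)
    show "AE x in lebesgue. x \<in> - closure D \<longrightarrow> convergent (\<lambda>k. u (e (r (q k))) x)" by (rule q(2))
  qed (rule \<gamma> Dp st)+
  define \<epsilon> where "\<epsilon> = (\<lambda>n. e (r (q n)))"
  have rq: "strict_mono (\<lambda>n. r (q n))" using strict_mono_o[OF r(1) q(1)] by (simp add: o_def)
  have "\<epsilon> (Suc i) < \<epsilon> i" for i
    using strict_mono_Suc_iff[of "\<lambda>n. - e n"] e(2) strict_monoD[OF rq, of i "Suc i"]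
    unfolding \<epsilon>_def by (auto simp: strict_mono_def)
  moreover have "\<epsilon> \<longlonglongrightarrow> 0" using LIMSEQ_subseq_LIMSEQ[OF e(3) rq] by (simp add: o_def \<epsilon>_def)
  moreover have "range \<epsilon> \<subseteq> E" using e(1) by (auto simp: \<epsilon>_def)
  moreover define \<rho>t where "\<rho>t = (\<lambda>x. g \<gamma> ((norm (L.ut x))\<^sup>2))"
  moreover define pt where "pt = (\<lambda>x. \<rho>t x powr \<gamma> / \<gamma>)"
  moreover have "AE x in lebesgue_on (- D).
      (\<lambda>k. u (\<epsilon> k) x $ 1) \<longlonglongrightarrow> L.ut x $ 1 \<and> (\<lambda>k. u (\<epsilon> k) x $ 2) \<longlonglongrightarrow> L.ut x $ 2 \<and>
      (\<lambda>k. g \<gamma> ((norm (u (\<epsilon> k) x))\<^sup>2) * u (\<epsilon> k) x $ 1) \<longlonglongrightarrow> \<rho>t x * L.ut x $ 1 \<and>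
      (\<lambda>k. g \<gamma> ((norm (u (\<epsilon> k) x))\<^sup>2) * u (\<epsilon> k) x $ 2) \<longlonglongrightarrow> \<rho>t x * L.ut x $ 2"
  proof -
    interpret loop: smooth_loop c using D by unfold_locales (simp add: obstacle_def)
    have null: "frontier D \<in> null_sets lebesgue" using loop.range_c_null Dp(4) by simp
    have c\<Psi>: "continuous_on (cball 0 1) (\<lambda>w::real^2. g \<gamma> ((norm w)\<^sup>2) * w $ i)" for i
      by (intro continuous_intros continuous_on_density \<gamma>)
    have "AE x in lebesgue. x \<in> - D \<longrightarrow>
      (\<lambda>k. u (\<epsilon> k) x $ 1) \<longlonglongrightarrow> L.ut x $ 1 \<and> (\<lambda>k. u (\<epsilon> k) x $ 2) \<longlonglongrightarrow> L.ut x $ 2 \<and>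
      (\<lambda>k. g \<gamma> ((norm (u (\<epsilon> k) x))\<^sup>2) * u (\<epsilon> k) x $ 1) \<longlonglongrightarrow> \<rho>t x * L.ut x $ 1 \<and>
      (\<lambda>k. g \<gamma> ((norm (u (\<epsilon> k) x))\<^sup>2) * u (\<epsilon> k) x $ 2) \<longlonglongrightarrow> \<rho>t x * L.ut x $ 2"
      using AE_not_in[OF null] L.V_tendsto L.field_tendsto[OF c\<Psi>[of 1]] L.field_tendsto[OF c\<Psi>[of 2]]
    proof eventually_elim
      case (elim x)
      show ?case
      proof
        assume "x \<in> - D"
        then have "x \<in> - closure D" using elim(1) closure_Un_frontier[of D] by auto
        then have V: "L.V k x = u (\<epsilon> k) x" for k by (simp add: L.V_def \<epsilon>_def)
        show "(\<lambda>k. u (\<epsilon> k) x $ 1) \<longlonglongrightarrow> L.ut x $ 1 \<and> (\<lambda>k. u (\<epsilon> k) x $ 2) \<longlonglongrightarrow> L.ut x $ 2 \<and>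
          (\<lambda>k. g \<gamma> ((norm (u (\<epsilon> k) x))\<^sup>2) * u (\<epsilon> k) x $ 1) \<longlonglongrightarrow> \<rho>t x * L.ut x $ 1 \<and>
          (\<lambda>k. g \<gamma> ((norm (u (\<epsilon> k) x))\<^sup>2) * u (\<epsilon> k) x $ 2) \<longlonglongrightarrow> \<rho>t x * L.ut x $ 2"
          using elim(2-4) unfolding V \<rho>t_def by (auto intro: tendsto_vec_nth)
      qed
    qed
    then show ?thesis using Dp(1) by (subst AE_restrict_space_iff) auto
  qed
  moreover have "AE x in lebesgue_on (- D). norm (L.ut x) \<le> 1"
    using L.ut_le Dp(1) by (subst AE_restrict_space_iff) (auto elim: eventually_mono)
  moreover have "distr_div_free (interior (- D)) (\<lambda>x. vector [\<rho>t x * L.ut x $ 1, \<rho>t x * L.ut x $ 2])"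
    unfolding \<rho>t_def
  proof (rule L.distr_div_free_limit)
    fix k v vx vy assume v: "C1_test (- closure D) v vx vy"
    show "(LINT x|lebesgue_on (- closure D). g \<gamma> ((norm (u (e (r (q k))) x))\<^sup>2) * u (e (r (q k))) x $ 1 * vx x
        + g \<gamma> ((norm (u (e (r (q k))) x))\<^sup>2) * u (e (r (q k))) x $ 2 * vy x) = 0"
      using spiral_stream_weak_equations(1)[OF st[of "r (q k)"] \<gamma> D0 v] by (simp add: mass_flux_def)
  qed (intro continuous_intros continuous_on_density \<gamma>)+
  moreover have "distr_div_free (interior (- D)) (\<lambda>x. vector [\<rho>t x * (L.ut x $ 1)\<^sup>2 + pt x, \<rho>t x * L.ut x $ 1 * L.ut x $ 2])"
    unfolding \<rho>t_def pt_def
  proof (rule L.distr_div_free_limit)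
    fix k v vx vy assume v: "C1_test (- closure D) v vx vy"
    show "(LINT x|lebesgue_on (- closure D). (g \<gamma> ((norm (u (e (r (q k))) x))\<^sup>2) * (u (e (r (q k))) x $ 1)\<^sup>2
          + g \<gamma> ((norm (u (e (r (q k))) x))\<^sup>2) powr \<gamma> / \<gamma>) * vx x
        + g \<gamma> ((norm (u (e (r (q k))) x))\<^sup>2) * u (e (r (q k))) x $ 1 * u (e (r (q k))) x $ 2 * vy x) = 0"
      using spiral_stream_weak_equations(2)[OF st[of "r (q k)"] \<gamma> D0 v] by (simp add: mass_flux_def power2_eq_square mult_ac)
  qed (intro continuous_intros continuous_on_density continuous_on_pressure \<gamma>)+
  moreover have "distr_div_free (interior (- D)) (\<lambda>x. vector [\<rho>t x * L.ut x $ 1 * L.ut x $ 2, \<rho>t x * (L.ut x $ 2)\<^sup>2 + pt x])"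
    unfolding \<rho>t_def pt_def
  proof (rule L.distr_div_free_limit)
    fix k v vx vy assume v: "C1_test (- closure D) v vx vy"
    show "(LINT x|lebesgue_on (- closure D). g \<gamma> ((norm (u (e (r (q k))) x))\<^sup>2) * u (e (r (q k))) x $ 1 * u (e (r (q k))) x $ 2 * vx x
        + (g \<gamma> ((norm (u (e (r (q k))) x))\<^sup>2) * (u (e (r (q k))) x $ 2)\<^sup>2
          + g \<gamma> ((norm (u (e (r (q k))) x))\<^sup>2) powr \<gamma> / \<gamma>) * vy x) = 0"
      using spiral_stream_weak_equations(3)[OF st[of "r (q k)"] \<gamma> D0 v] by (simp add: mass_flux_def power2_eq_square mult_ac)
  qed (intro continuous_intros continuous_on_density continuous_on_pressure \<gamma>)+
  moreover have "distr_div_free (interior (- D)) (\<lambda>x. vector [- (L.ut x $ 2), L.ut x $ 1])"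
  proof (rule L.distr_div_free_limit)
    fix k v vx vy assume v: "C1_test (- closure D) v vx vy"
    show "(LINT x|lebesgue_on (- closure D). - (u (e (r (q k))) x $ 2) * vx x + u (e (r (q k))) x $ 1 * vy x) = 0"
      by (rule spiral_stream_weak_equations(4)[OF st[of "r (q k)"] \<gamma> D0 v])
  qed (intro continuous_intros)+
  moreover have "has_normal_trace (- D) c (\<lambda>x. \<rho>t x *\<^sub>R L.ut x) (\<lambda>x. (rho0 \<gamma> \<kappa>t \<kappa>2 * \<kappa>t / norm x) * (e_r x \<bullet> n x))"
    using L.limit_normal_trace[OF D n] by (simp add: \<rho>t_def ct_def)
  ultimately show ?thesis
    by (intro exI[of _ \<epsilon>] exI[of _ L.ut] exI[of _ \<rho>t] exI[of _ pt]) auto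
qed

end
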